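(* Let $X$ be a compact, connected Riemannian manifold of dimension $\ge 3$ equipped with its intrinsic metric $d$. Then $k_X=1$, that is, for every $\mu,\nu\in\mathcal{M}_g(X)$ and every $\varepsilon>0$, there exists a homeomorphism $h\colon X\to X$ homotopic to the identity such that $W_\infty(h_*\nu,\mu)<\varepsilon$ and $d(h,\mathrm{id})<W_\infty(\mu,\nu)+\varepsilon$.
   Context: The intrinsic metric is the geodesic distance (infimum of lengths of paths joining points). $\mathcal{M}_g(X)$ is the set of Borel probability measures on $X$ that are faithful (fully supported) and diffuse (atomless). For Borel probability measures, $W_\infty(\mu,\nu)=\inf\{r>0\mid\forall\,U\subseteq X\text{ Borel }(\mu(U)\le\nu(U_r))\}$, where $U_r=\{x\in X\mid d(x,U)<r\}$; $h_*\nu=\nu\circ h^{-1}$; $d(h,\mathrm{id})=\sup_{x\in X}d(h(x),x)$. The transport constant is \[ k_X=\sup_{\nu\ne\mu\in\mathcal{M}_g(X)}\ \sup_{\varepsilon>0}\ \inf_{h\in\mathcal{H}_0(\nu,\mu,\varepsilon)}\frac{d(h,\mathrm{id})}{W_\infty(\mu,\nu)}, \] where $\mathcal{H}_0(\nu,\mu,\varepsilon)$ is the set of homeomorphisms $h\colon X\to X$ homotopic to $\mathrm{id}$ with $W_\infty(h_*\nu,\mu)<\varepsilon$. *)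

theory Defs
  imports "HOL-Probability.Probability"
begin

section \<open>Smooth manifolds and Riemannian metrics\<close>

text \<open>Intended for open \<open>S\<close>. In finite dimensions, continuity of all iterated directional
  derivatives is the usual notion of \<open>C\<^sup>k\<close>.\<close>

primrec Ck_on :: "nat \<Rightarrow> 'a::euclidean_space set \<Rightarrow> ('a \<Rightarrow> 'b::real_normed_vector) \<Rightarrow> bool" where
  "Ck_on 0 S f \<longleftrightarrow> continuous_on S f"
| "Ck_on (Suc k) S f \<longleftrightarrow>
     (\<forall>x\<in>S. f differentiable (at x)) \<and>
     (\<forall>v. Ck_on k S (\<lambda>x. frechet_derivative f (at x) v))"

definition smooth_on :: "'a::euclidean_space set \<Rightarrow> ('a \<Rightarrow> 'b::real_normed_vector) \<Rightarrow> bool" where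
  "smooth_on S f \<longleftrightarrow> (\<forall>k. Ck_on k S f)"

text \<open>A chart \<open>(U, \<phi>)\<close> consists of an open subset of the manifold and a homeomorphism of it onto
  an open subset of the model space \<open>'e\<close>; the values of \<open>\<phi>\<close> outside \<open>U\<close> are irrelevant.
  The manifold is the whole type \<open>'a\<close>, it has no boundary, and its dimension is
  \<open>DIM('e)\<close>.\<close>

type_synonym ('a, 'e) chart = "'a set \<times> ('a \<Rightarrow> 'e)"

definition is_chart :: "('a::topological_space, 'e::euclidean_space) chart \<Rightarrow> bool" where
  "is_chart c \<longleftrightarrow> open (fst c) \<and> open (snd c ` fst c) \<and>
     (\<exists>\<psi>. homeomorphism (fst c) (snd c ` fst c) (snd c) \<psi>)"

definition chart_inv :: "('a, 'e) chart \<Rightarrow> 'e \<Rightarrow> 'a" where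
  "chart_inv c = inv_into (fst c) (snd c)"

definition transition :: "('a, 'e) chart \<Rightarrow> ('a, 'e) chart \<Rightarrow> 'e \<Rightarrow> 'e" where
  "transition c c' = snd c' \<circ> chart_inv c"

definition smooth_atlas :: "('a::topological_space, 'e::euclidean_space) chart set \<Rightarrow> bool" where
  "smooth_atlas A \<longleftrightarrow>
     (\<forall>c\<in>A. is_chart c) \<and> (\<Union>c\<in>A. fst c) = UNIV \<and>
     (\<forall>c\<in>A. \<forall>c'\<in>A. smooth_on (snd c ` (fst c \<inter> fst c')) (transition c c'))"

text \<open>A Riemannian metric is given by its coordinate expressions: \<open>g c p\<close> is the inner product
  on the tangent space at \<open>p\<close>, where tangent vectors are identified with elements of \<open>'e\<close> via
  the chart \<open>c\<close>. The last conjunct is the transformation law of a covariant 2-tensor.\<close>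

type_synonym ('a, 'e) metric_tensor = "('a, 'e) chart \<Rightarrow> 'a \<Rightarrow> 'e \<Rightarrow> 'e \<Rightarrow> real"

definition riemannian_metric ::
    "('a::topological_space, 'e::euclidean_space) chart set \<Rightarrow> ('a, 'e) metric_tensor \<Rightarrow> bool" where
  "riemannian_metric A g \<longleftrightarrow>
     (\<forall>c\<in>A. \<forall>p\<in>fst c. bilinear (g c p) \<and> (\<forall>u v. g c p u v = g c p v u) \<and>
        (\<forall>v. v \<noteq> 0 \<longrightarrow> 0 < g c p v v)) \<and>
     (\<forall>c\<in>A. \<forall>u v. smooth_on (snd c ` fst c) (\<lambda>y. g c (chart_inv c y) u v)) \<and>
     (\<forall>c\<in>A. \<forall>c'\<in>A. \<forall>p\<in>fst c \<inter> fst c'. \<forall>u v.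
        g c p u v = g c' p (frechet_derivative (transition c c') (at (snd c p)) u)
                           (frechet_derivative (transition c c') (at (snd c p)) v))"

section \<open>Intrinsic distance\<close>

definition piecewise_C1_path ::
    "('a::topological_space, 'e::euclidean_space) chart set \<Rightarrow> (real \<Rightarrow> 'a) \<Rightarrow> bool" where
  "piecewise_C1_path A \<gamma> \<longleftrightarrow> path \<gamma> \<and>
     (\<exists>(n::nat) t. t 0 = 0 \<and> t n = 1 \<and>
        (\<forall>i<n. t i < t (Suc i) \<and>
           (\<exists>c\<in>A. \<gamma> ` {t i..t (Suc i)} \<subseteq> fst c \<and>
              (\<exists>D. continuous_on {t i..t (Suc i)} D \<and>
                 (\<forall>s\<in>{t i..t (Suc i)}.
                    ((snd c \<circ> \<gamma>) has_vector_derivative D s) (at s within {t i..t (Suc i)}))))))"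

text \<open>By the transformation law the speed does not depend on the chart picked. At the finitely
  many times where the two-sided derivative does not exist its value is arbitrary, which does not
  affect the length.\<close>

definition path_speed ::
    "('a::topological_space, 'e::euclidean_space) chart set \<Rightarrow> ('a, 'e) metric_tensor
      \<Rightarrow> (real \<Rightarrow> 'a) \<Rightarrow> real \<Rightarrow> real" where
  "path_speed A g \<gamma> s =
     (let c = (SOME c. c \<in> A \<and> \<gamma> s \<in> fst c);
          v = vector_derivative (snd c \<circ> \<gamma>) (at s)
      in sqrt (g c (\<gamma> s) v v))"

definition path_len ::
    "('a::topological_space, 'e::euclidean_space) chart set \<Rightarrow> ('a, 'e) metric_tensor
      \<Rightarrow> (real \<Rightarrow> 'a) \<Rightarrow> real" where
  "path_len A g \<gamma> = integral {0..1} (path_speed A g \<gamma>)"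

definition geodesic_dist ::
    "('a::topological_space, 'e::euclidean_space) chart set \<Rightarrow> ('a, 'e) metric_tensor
      \<Rightarrow> 'a \<Rightarrow> 'a \<Rightarrow> real" where
  "geodesic_dist A g x y =
     Inf {path_len A g \<gamma> |\<gamma>. piecewise_C1_path A \<gamma> \<and> pathstart \<gamma> = x \<and> pathfinish \<gamma> = y}"

text \<open>The metric space \<open>'a\<close> is compact and connected, and it is a smooth Riemannian manifold
  (for its metric topology) whose metric is the intrinsic one.\<close>

definition compact_connected_riemannian_manifold ::
    "('a::metric_space, 'e::euclidean_space) chart set \<Rightarrow> ('a, 'e) metric_tensor \<Rightarrow> bool" where
  "compact_connected_riemannian_manifold A g \<longleftrightarrow>
     compact (UNIV :: 'a set) \<and> connected (UNIV :: 'a set) \<and>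
     smooth_atlas A \<and> riemannian_metric A g \<and>
     (\<forall>x y. dist x y = geodesic_dist A g x y)"

section \<open>Measures and the transport constant\<close>

definition faithful_measure :: "'a::topological_space measure \<Rightarrow> bool" where
  "faithful_measure \<mu> \<longleftrightarrow> (\<forall>U. open U \<and> U \<noteq> {} \<longrightarrow> 0 < measure \<mu> U)"

definition diffuse_measure :: "'a measure \<Rightarrow> bool" where
  "diffuse_measure \<mu> \<longleftrightarrow>
     \<not> (\<exists>E\<in>sets \<mu>. 0 < measure \<mu> E \<and>
          (\<forall>F\<in>sets \<mu>. F \<subseteq> E \<longrightarrow> measure \<mu> F = 0 \<or> measure \<mu> F = measure \<mu> E))"

definition good_measures :: "'a::topological_space measure set" where
  "good_measures =
     {\<mu>. sets \<mu> = sets borel \<and> prob_space \<mu> \<and> faithful_measure \<mu> \<and> diffuse_measure \<mu>}"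

text \<open>The convention \<open>infdist x {} = 0\<close> is harmless here: \<open>U = {}\<close> imposes no constraint.\<close>

definition W_inf :: "'a::metric_space measure \<Rightarrow> 'a measure \<Rightarrow> real" where
  "W_inf \<mu> \<nu> =
     Inf {r. 0 < r \<and> (\<forall>U\<in>sets borel. measure \<mu> U \<le> measure \<nu> {x. infdist x U < r})}"

definition displacement :: "('a::metric_space \<Rightarrow> 'a) \<Rightarrow> real" where
  "displacement h = (SUP x. dist (h x) x)"

definition homeos_homotopic_id :: "('a::topological_space \<Rightarrow> 'a) set" where
  "homeos_homotopic_id =
     {h. (\<exists>k. homeomorphism UNIV UNIV h k) \<and>
         homotopic_with_canon (\<lambda>_. True) UNIV UNIV h id}"

definition H0 :: "'a::metric_space measure \<Rightarrow> 'a measure \<Rightarrow> real \<Rightarrow> ('a \<Rightarrow> 'a) set" where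
  "H0 \<nu> \<mu> \<epsilon> = {h \<in> homeos_homotopic_id. W_inf (distr \<nu> borel h) \<mu> < \<epsilon>}"

text \<open>Valued in the extended reals, so that an infimum over the empty set is \<open>\<infinity>\<close> and the
  suprema need not be finite.\<close>

definition transport_constant :: "'a::metric_space itself \<Rightarrow> ereal" where
  "transport_constant (_ :: 'a itself) =
     (SUP (\<nu>, \<mu>) \<in> {(\<nu>, \<mu>). \<nu> \<in> good_measures \<and> \<mu> \<in> good_measures \<and> \<nu> \<noteq> (\<mu> :: 'a measure)}.
        SUP \<epsilon>\<in>{0<..}. INF h\<in>H0 \<nu> \<mu> \<epsilon>. ereal (displacement h / W_inf \<mu> \<nu>))"

end

theory Submission
  imports Defs
begin

text \<open>Fix \<open>r\<close> slightly larger than \<open>W\<^sub>\<infinity>(\<mu>, \<nu>)\<close>. As \<open>\<mu>\<close> is faithful and \<open>X\<close> is connected, \<open>W\<^sub>\<infinity>(h\<^sub>*\<nu>, \<mu>)\<close> is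
  small as soon as \<open>h\<^sub>*\<nu>\<close> is close to \<open>\<mu>\<close> in the Levy-Prokhorov sense, so a small portion of the mass
  may be neglected. Up to such a portion, \<open>\<nu>\<close> lives on finitely many disjoint tiny coordinate cubes
  \<open>B\<close>, and \<open>\<mu>\<close> is described by its values on a finite partition into small pieces \<open>P\<^sub>j\<close>. The defining
  inequality of \<open>W\<^sub>\<infinity>\<close> is a Hall condition, so the cubes can be assigned to pieces at distance less
  than about \<open>r\<close> such that no piece is overloaded by much. In dimension at least three the centres of
  the cubes can be joined to points of the assigned pieces by pairwise disjoint arcs of diameter about
  \<open>r\<close>. Disjoint neighbourhoods of the arcs carry homeomorphisms that push the centres to their
  targets. Composing with homeomorphisms that first squeeze each cube towards its centre gives \<open>h\<close>.
  It is homotopic to the identity because it is built from homeomorphisms supported in convex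
  coordinate sets. The bound \<open>k\<^sub>X \<ge> 1\<close> is the triangle inequality for \<open>W\<^sub>\<infinity>\<close>.\<close>

section \<open>Homeomorphisms of Euclidean space\<close>

text \<open>Cubes are assigned whole, so the masses can be matched only approximately; since
  \<open>\<nu>\<close> is diffuse, the cubes can be made so light that the rounding is harmless.
  This dictates the order of the choices: the tolerated error depends on \<open>\<mu>\<close> and
  \<open>\<epsilon>\<close> alone, then comes the partition into \<open>n\<close> pieces, then a
  bound on the mass of a cube in terms of the error and \<open>n\<close>, and only then the cubes. A
  homeomorphism pushing a point along an arc carries along just some neighbourhood of that point, of
  unknown size, hence the squeezing of cubes beforehand. Many cubes may share one target, so arcs
  end near the targets and not at them. General position is replaced by a topological notion: closed
  sets whose removal never disconnects a connected open set. It is stable under finite unions, so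
  the arcs can be chosen one at a time. Beyond the charts, the Riemannian structure enters through a
  single consequence: two points at distance less than \<open>r\<close> lie in a connected set whose
  points are pairwise at distance less than \<open>r\<close>.\<close>

lemma connected_convex_minus_segment:
  fixes C :: "'e::euclidean_space set"
  assumes "3 \<le> DIM('e)" "convex C" "open C"
  shows "connected (C - closed_segment p q)"
proof -
  have "path_component (C - closed_segment p q) x y"
    if x: "x \<in> C - closed_segment p q" and y: "y \<in> C - closed_segment p q" for x y
  proof -
    have low: "closed (affine hull {p,q,u})" "interior (affine hull {p,q,u}) = {}" for u
    proof -
      have "aff_dim {p,q,u} \<le> int (card {p,q,u}) - 1"
        by (rule aff_dim_le_card) simp
      also have "\<dots> \<le> 2"
        by (simp add: card_insert_if)
      finally have "aff_dim (affine hull {p,q,u}) < int DIM('e)"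
        using assms(1) by simp
      then show "interior (affine hull {p,q,u}) = {}"
        by (intro low_dim_interior) linarith
    qed simp
    have "interior (affine hull {p,q,x} \<union> affine hull {p,q,y}) = {}"
      using low by (simp add: interior_closed_Un_empty_interior)
    \<comment> \<open>Two planes cannot fill an open set in dimension at least three. A point
      \<open>z\<close> off both planes sees \<open>x\<close> and \<open>y\<close> past the segment:
      if the segment from \<open>u\<close> to \<open>z\<close> met \<open>closed_segment p q\<close>
      in \<open>w\<close>, then \<open>z\<close> would lie on the line through \<open>u\<close> and
      \<open>w\<close>, hence in the plane of \<open>p\<close>, \<open>q\<close>,
      \<open>u\<close>.\<close>
    then have "\<not> C \<subseteq> affine hull {p,q,x} \<union> affine hull {p,q,y}"
      using x assms(3) interior_maximal by blast
    then obtain z where z: "z \<in> C" "z \<notin> affine hull {p,q,x}" "z \<notin> affine hull {p,q,y}"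
      by blast
    have seg: "closed_segment u z \<subseteq> C - closed_segment p q"
      if u: "u \<in> C - closed_segment p q" and zu: "z \<notin> affine hull {p,q,u}" for u
    proof -
      have "w \<notin> closed_segment p q" if w: "w \<in> closed_segment u z" for w
      proof
        assume wpq: "w \<in> closed_segment p q"
        obtain t where t: "w = (1 - t) *\<^sub>R u + t *\<^sub>R z"
          using w by (auto simp: closed_segment_def)
        have "t \<noteq> 0" using t u wpq by auto
        then have "z = (1 - 1/t) *\<^sub>R u + (1/t) *\<^sub>R w"
          by (simp add: t algebra_simps)
        moreover have "u \<in> affine hull {p,q,u}"
          by (simp add: hull_inc)
        moreover have "w \<in> affine hull {p,q,u}"
        proof -
          have "closed_segment p q \<subseteq> affine hull {p,q,u}"
            by (intro closed_segment_subset) (auto simp: hull_inc affine_imp_convex)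
          then show ?thesis using wpq by blast
        qed
        ultimately have "z \<in> affine hull {p,q,u}"
          by (simp add: mem_affine[OF affine_affine_hull])
        with zu show False by simp
      qed
      moreover have "closed_segment u z \<subseteq> C"
        using u z assms(2) by (simp add: closed_segment_subset)
      ultimately show ?thesis by blast
    qed
    have "path_component (C - closed_segment p q) u z"
      if "u \<in> C - closed_segment p q" "z \<notin> affine hull {p,q,u}" for u
      by (rule path_component_linepath[OF seg[OF that]])
    from this[OF x z(2)] path_component_sym[OF this[OF y z(3)]] show ?thesis
      by (rule path_component_trans)
  qed
  then have "path_connected (C - closed_segment p q)"
    by (simp add: path_connected_component)
  then show ?thesis by (rule path_connected_imp_connected)
qed

lemma compact_subset_open_uniform:
  fixes K :: "'a::metric_space set"
  assumes "compact K" "open G" "K \<subseteq> G"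
  obtains \<kappa> where "0 < \<kappa>" "\<And>x y. x \<in> K \<Longrightarrow> dist x y < \<kappa> \<Longrightarrow> y \<in> G"
proof -
  obtain e where e: "0 < e" "\<And>x. x \<in> K \<Longrightarrow> \<exists>H\<in>{G}. ball x e \<subseteq> H"
    using Heine_Borel_lemma[of K "{G}"] assms by auto
  have "y \<in> G" if "x \<in> K" "dist x y < e" for x y
  proof -
    have "ball x e \<subseteq> G" using e(2)[OF that(1)] by simp
    then show ?thesis using that(2) by (simp add: subset_iff)
  qed
  with e(1) show ?thesis by (rule that)
qed

lemma disjoint_compacts_separated:
  fixes K :: "'i \<Rightarrow> 'a::metric_space set"
  assumes fin: "finite I" and cpt: "\<And>i. i \<in> I \<Longrightarrow> compact (K i)"
    and dis: "disjoint_family_on K I"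
  obtains \<kappa> where "0 < \<kappa>"
    "\<And>i j x y. \<lbrakk>i \<in> I; j \<in> I; i \<noteq> j; x \<in> K i; y \<in> K j\<rbrakk> \<Longrightarrow> \<kappa> \<le> dist x y"
proof -
  have "\<exists>\<kappa>>0. \<forall>x\<in>K i. \<forall>y. dist x y < \<kappa> \<longrightarrow> y \<notin> (\<Union>j\<in>I-{i}. K j)" if i: "i \<in> I" for i
  proof -
    have "open (- (\<Union>j\<in>I-{i}. K j))"
      using fin cpt by (intro open_Compl closed_UN) (auto intro: compact_imp_closed)
    moreover have "K i \<subseteq> - (\<Union>j\<in>I-{i}. K j)"
      using dis i unfolding disjoint_family_on_def by fastforce
    ultimately obtain \<kappa> where "0 < \<kappa>"
      "\<And>x y. x \<in> K i \<Longrightarrow> dist x y < \<kappa> \<Longrightarrow> y \<in> - (\<Union>j\<in>I-{i}. K j)"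
      using compact_subset_open_uniform[OF cpt[OF i]] by metis
    then show ?thesis by (intro exI[of _ \<kappa>]) blast
  qed
  then obtain \<kappa> where \<kappa>: "\<And>i. i \<in> I \<Longrightarrow> \<kappa> i > 0"
    "\<And>i x y. \<lbrakk>i \<in> I; x \<in> K i; dist x y < \<kappa> i\<rbrakk> \<Longrightarrow> y \<notin> (\<Union>j\<in>I-{i}. K j)"
    by metis
  define \<kappa>0 where "\<kappa>0 = Min (insert 1 (\<kappa> ` I))"
  have pos: "\<kappa>0 > 0" using fin \<kappa>(1) by (simp add: \<kappa>0_def)
  have le: "\<kappa>0 \<le> \<kappa> i" if "i \<in> I" for i
    using fin that by (simp add: \<kappa>0_def)
  have "\<kappa>0 \<le> dist x y"
    if "i \<in> I" "j \<in> I" "i \<noteq> j" "x \<in> K i" "y \<in> K j" for i j x y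
  proof -
    have "\<not> dist x y < \<kappa> i" using \<kappa>(2)[of i x y] that by blast
    then show ?thesis using le[OF that(1)] by linarith
  qed
  with pos show ?thesis by (rule that)
qed

text \<open>The inverse at \<open>y\<close> is the fixed point of the contraction
  \<open>\<lambda>x. y - \<psi> x\<close>, and it is Lipschitz with constant
  \<open>1 / (1 - L)\<close>. Both Euclidean homeomorphisms below are obtained as such perturbations
  of the identity.\<close>

lemma homeomorphism_id_plus_lipschitz:
  fixes \<psi> :: "'e::euclidean_space \<Rightarrow> 'e"
  assumes L: "\<And>x y. norm (\<psi> x - \<psi> y) \<le> L * norm (x - y)" "0 \<le> L" "L < 1"
  shows "\<exists>k. homeomorphism UNIV UNIV (\<lambda>x. x + \<psi> x) k"
proof -
  have "\<exists>!x. y - \<psi> x = x" for y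
    by (rule banach_fix_type[OF L(2,3)])
      (use L(1) in \<open>auto simp: dist_norm norm_minus_commute\<close>)
  then obtain k where k: "\<And>y. y - \<psi> (k y) = k y" "\<And>y x. y - \<psi> x = x \<Longrightarrow> x = k y"
    by metis
  have kf: "k (x + \<psi> x) = x" for x
    using k(2)[of "x + \<psi> x" x] by simp
  have fk: "k y + \<psi> (k y) = y" for y
    using k(1)[of y] by (metis diff_add_cancel)
  have lk: "norm (k x - k y) \<le> (1 / (1 - L)) * norm (x - y)" for x y
  proof -
    have "k x - k y = (x - y) - (\<psi> (k x) - \<psi> (k y))"
      using fk[of x] fk[of y] by (metis add_diff_add add_diff_cancel_right' diff_add_eq diff_diff_eq2)
    then have "norm (k x - k y) \<le> norm (x - y) + L * norm (k x - k y)"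
      using L(1)[of "k x" "k y"] norm_triangle_ineq4[of "x - y" "\<psi> (k x) - \<psi> (k y)"] by simp
    then have "(1 - L) * norm (k x - k y) \<le> norm (x - y)" by (simp add: algebra_simps)
    then show ?thesis using L(3) by (simp add: field_simps)
  qed
  have "(1 / (1 - L))-lipschitz_on UNIV k"
    using lk L(3) by (intro lipschitz_onI) (auto simp: dist_norm)
  then have ck: "continuous_on UNIV k" by (rule lipschitz_on_continuous_on)
  have "L-lipschitz_on UNIV \<psi>"
    using L by (intro lipschitz_onI) (auto simp: dist_norm)
  then have cf: "continuous_on UNIV (\<lambda>x. x + \<psi> x)"
    by (intro continuous_intros lipschitz_on_continuous_on)
  have "homeomorphism UNIV UNIV (\<lambda>x. x + \<psi> x) k"
    using ck cf kf fk by (intro homeomorphismI) auto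
  then show ?thesis by blast
qed

text \<open>Add to the identity the vector \<open>q - p\<close> times a conical bump of height 1 and
  radius \<open>\<rho>\<close>. The Lipschitz constant is \<open>dist p q / \<rho>\<close>, which
  the hypothesis keeps below 1.\<close>

lemma homeomorphism_moving_centre:
  fixes p q :: "'e::euclidean_space"
  assumes "dist p q < \<rho>"
  shows "\<exists>f k. homeomorphism UNIV UNIV f k \<and> f p = q \<and> (\<forall>x. x \<notin> ball p \<rho> \<longrightarrow> f x = x)"
proof -
  have \<rho>: "\<rho> > 0" using assms zero_le_dist[of p q] by linarith
  define \<psi> where "\<psi> = (\<lambda>x. max 0 (1 - dist p x / \<rho>) *\<^sub>R (q - p))"
  have "norm (\<psi> x - \<psi> y) \<le> (dist p q / \<rho>) * norm (x - y)" for x y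
  proof -
    have "\<bar>max 0 (1 - dist p x / \<rho>) - max 0 (1 - dist p y / \<rho>)\<bar> \<le> \<bar>dist p x / \<rho> - dist p y / \<rho>\<bar>"
      by linarith
    also have "\<dots> = \<bar>dist p x - dist p y\<bar> / \<rho>"
      using \<rho> by (simp add: diff_divide_distrib[symmetric])
    also have "\<dots> \<le> norm (x - y) / \<rho>"
      using \<rho> norm_triangle_ineq3[of "p - x" "p - y"]
      by (intro divide_right_mono) (auto simp: dist_norm norm_minus_commute)
    finally have "\<bar>max 0 (1 - dist p x / \<rho>) - max 0 (1 - dist p y / \<rho>)\<bar> * norm (q - p) \<le> norm (x - y) / \<rho> * norm (q - p)"
      by (intro mult_right_mono) auto
    then show ?thesis
      by (simp add: \<psi>_def scaleR_left_diff_distrib[symmetric] dist_norm norm_minus_commute mult.commute)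
  qed
  moreover have "dist p q / \<rho> < 1" using assms \<rho> by simp
  ultimately obtain k where "homeomorphism UNIV UNIV (\<lambda>x. x + \<psi> x) k"
    using homeomorphism_id_plus_lipschitz[of \<psi> "dist p q / \<rho>"] \<rho> by auto
  moreover have "p + \<psi> p = q" by (simp add: \<psi>_def)
  moreover have "x + \<psi> x = x" if "x \<notin> ball p \<rho>" for x
    using that \<rho> by (simp add: \<psi>_def)
  ultimately show ?thesis by blast
qed

text \<open>The contraction has to be cut off within distance \<open>\<kappa>\<close> of
  \<open>B\<close> while staying close to the identity, so one application may shrink very little.
  Only \<open>t < 1\<close> is claimed; strong squeezing comes later from iterating
  \<open>f\<close>.\<close>

lemma homeomorphism_contracting_convex:
  fixes B :: "'e::euclidean_space set"
  assumes B: "compact B" "convex B" "p \<in> B" and \<kappa>: "0 < \<kappa>"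
  shows "\<exists>f k t. homeomorphism UNIV UNIV f k \<and> 0 < t \<and> t < (1::real)
    \<and> (\<forall>x\<in>B. f x = p + t *\<^sub>R (x - p)) \<and> (\<forall>x. \<kappa> \<le> infdist x B \<longrightarrow> f x = x)"
proof -
  obtain R where R: "\<And>x. x \<in> B \<Longrightarrow> dist p x \<le> R"
    using compact_imp_bounded[OF B(1)] bounded_any_center by blast
  have R0: "R \<ge> 0" using R[OF B(3)] by simp
  define \<beta> where "\<beta> = (\<lambda>x. max 0 (1 - infdist x B / \<kappa>))"
  have \<beta>01: "0 \<le> \<beta> x" "\<beta> x \<le> 1" for x
    using \<kappa> infdist_nonneg[of x B] by (auto simp: \<beta>_def)
  have \<beta>L: "\<bar>\<beta> x - \<beta> y\<bar> \<le> norm (x - y) / \<kappa>" for x y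
  proof -
    have "\<bar>\<beta> x - \<beta> y\<bar> \<le> \<bar>infdist x B / \<kappa> - infdist y B / \<kappa>\<bar>"
      unfolding \<beta>_def by linarith
    also have "\<dots> = \<bar>infdist x B - infdist y B\<bar> / \<kappa>"
      using \<kappa> by (simp add: diff_divide_distrib[symmetric])
    also have "\<dots> \<le> norm (x - y) / \<kappa>"
      using \<kappa> infdist_triangle_abs[of x B y] by (intro divide_right_mono) (auto simp: dist_norm)
    finally show ?thesis .
  qed
  have near: "norm (x - p) \<le> R + \<kappa>" if "\<beta> x \<noteq> 0" for x
  proof -
    have "infdist x B < \<kappa>" using that \<kappa> by (auto simp: \<beta>_def max_def field_simps split: if_splits)
    then obtain b where "b \<in> B" "dist x b < \<kappa>"
      using infdist_attains_inf[of B x] B compact_imp_closed by (metis empty_iff)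
    then show ?thesis using R[of b] dist_triangle[of x p b] by (simp add: dist_norm norm_minus_commute)
  qed
  \<comment> \<open>The product rule: the cut-off has slope \<open>1 / \<kappa>\<close> and
    multiplies a vector of length at most \<open>R + \<kappa>\<close>, while the vector itself has
    slope 1 and is multiplied by at most 1.\<close>
  define M where "M = (R + \<kappa>) / \<kappa> + 1"
  have M1: "M \<ge> 1" using R0 \<kappa> by (simp add: M_def)
  have "norm (\<beta> x *\<^sub>R (x - p) - \<beta> y *\<^sub>R (y - p)) \<le> M * norm (x - y)" for x y
  proof -
    have main: "norm (\<beta> x *\<^sub>R (x - p) - \<beta> y *\<^sub>R (y - p)) \<le> M * norm (x - y)" if "\<beta> x \<noteq> 0" for x y
    proof -
      have "\<beta> x *\<^sub>R (x - p) - \<beta> y *\<^sub>R (y - p) = (\<beta> x - \<beta> y) *\<^sub>R (x - p) + \<beta> y *\<^sub>R (x - y)"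
        by (simp add: algebra_simps)
      then have "norm (\<beta> x *\<^sub>R (x - p) - \<beta> y *\<^sub>R (y - p)) \<le> \<bar>\<beta> x - \<beta> y\<bar> * norm (x - p) + \<beta> y * norm (x - y)"
        using norm_triangle_ineq[of "(\<beta> x - \<beta> y) *\<^sub>R (x - p)" "\<beta> y *\<^sub>R (x - y)"] \<beta>01[of y] by simp
      also have "\<dots> \<le> norm (x - y) / \<kappa> * (R + \<kappa>) + 1 * norm (x - y)"
        using \<beta>L near[OF that] \<beta>01 \<kappa> by (intro add_mono mult_mono) auto
      also have "\<dots> = M * norm (x - y)" by (simp add: M_def algebra_simps)
      finally show ?thesis .
    qed
    show ?thesis
    proof (cases "\<beta> x = 0")
      case True
      then show ?thesis
        using main[of y x] M1 by (cases "\<beta> y = 0") (auto simp: norm_minus_commute)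
    qed (rule main)
  qed
  note lip = this
  define s where "s = 1 / (2 * M)"
  have s: "0 < s" "s < 1" "s * M < 1" using M1 by (auto simp: s_def)
  define \<psi> where "\<psi> = (\<lambda>x. - s *\<^sub>R (\<beta> x *\<^sub>R (x - p)))"
  have "norm (\<psi> x - \<psi> y) \<le> (s * M) * norm (x - y)" for x y
  proof -
    have "\<psi> x - \<psi> y = s *\<^sub>R (- (\<beta> x *\<^sub>R (x - p) - \<beta> y *\<^sub>R (y - p)))"
      by (simp add: \<psi>_def algebra_simps)
    then have "norm (\<psi> x - \<psi> y) = \<bar>s\<bar> * norm (\<beta> x *\<^sub>R (x - p) - \<beta> y *\<^sub>R (y - p))"
      by (metis norm_scaleR norm_minus_cancel)
    also have "\<dots> \<le> s * (M * norm (x - y))"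
      using lip[of x y] s by (intro mult_mono) auto
    finally show ?thesis by (simp add: mult.assoc)
  qed
  then obtain k where "homeomorphism UNIV UNIV (\<lambda>x. x + \<psi> x) k"
    using homeomorphism_id_plus_lipschitz[of \<psi> "s * M"] s M1 by auto
  moreover have "x + \<psi> x = p + (1 - s) *\<^sub>R (x - p)" if "x \<in> B" for x
    using that by (simp add: \<psi>_def \<beta>_def algebra_simps)
  moreover have "x + \<psi> x = x" if "\<kappa> \<le> infdist x B" for x
    using that \<kappa> by (simp add: \<psi>_def \<beta>_def max_def)
  ultimately show ?thesis
    using s by (intro exI[of _ "\<lambda>x. x + \<psi> x"] exI[of _ k] exI[of _ "1 - s"]) auto
qed

section \<open>Homeomorphisms homotopic to the identity\<close>

text \<open>Only the homeomorphism itself has to be the identity off \<open>S\<close>; the homotopy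
  to \<open>id\<close> may move points anywhere.\<close>

definition supported_homeos :: "'a::topological_space set \<Rightarrow> ('a \<Rightarrow> 'a) set" where
  "supported_homeos S = {h \<in> homeos_homotopic_id. \<forall>x. x \<notin> S \<longrightarrow> h x = x}"

lemma supported_homeosD:
  assumes "h \<in> supported_homeos S"
  shows "h \<in> homeos_homotopic_id" "x \<notin> S \<Longrightarrow> h x = x" "continuous_on UNIV h" "bij h"
proof -
  show 1: "h \<in> homeos_homotopic_id" and "x \<notin> S \<Longrightarrow> h x = x"
    using assms by (auto simp: supported_homeos_def)
  then obtain k where "homeomorphism UNIV UNIV h k"
    by (auto simp: homeos_homotopic_id_def)
  then show "continuous_on UNIV h" "bij h"
    by (auto simp: homeomorphism_def bij_def inj_def surj_def) metis+
qed

lemma supported_homeos_id: "id \<in> supported_homeos S"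
proof -
  have "homeomorphism UNIV UNIV (id :: 'a \<Rightarrow> 'a) id"
    by (simp add: homeomorphism_def)
  then show ?thesis
    by (auto simp: supported_homeos_def homeos_homotopic_id_def)
qed

lemma supported_homeos_mono: "S \<subseteq> T \<Longrightarrow> supported_homeos S \<subseteq> supported_homeos T"
  by (auto simp: supported_homeos_def)

lemma supported_homeos_comp:
  assumes "f \<in> supported_homeos S" "h \<in> supported_homeos S"
  shows "f \<circ> h \<in> supported_homeos S"
proof -
  obtain f' h' where hom: "homeomorphism UNIV UNIV f f'" "homeomorphism UNIV UNIV h h'"
    and ht: "homotopic_with_canon (\<lambda>_. True) UNIV UNIV f id" "homotopic_with_canon (\<lambda>_. True) UNIV UNIV h id"
    using assms by (auto simp: supported_homeos_def homeos_homotopic_id_def)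
  have "homeomorphism UNIV UNIV (f \<circ> h) (h' \<circ> f')"
    using hom homeomorphism_compose by blast
  moreover have "homotopic_with_canon (\<lambda>_. True) UNIV UNIV (f \<circ> h) id"
    using homotopic_compose[OF ht(2,1)] by simp
  ultimately show ?thesis
    using assms by (auto simp: supported_homeos_def homeos_homotopic_id_def)
qed

lemma supported_homeos_funpow:
  "f \<in> supported_homeos S \<Longrightarrow> (f ^^ n) \<in> supported_homeos S"
  by (induction n) (auto simp: supported_homeos_id supported_homeos_comp)

lemma supported_homeos_inverse:
  assumes "f \<in> supported_homeos S"
  obtains k where "k \<in> supported_homeos S" "\<And>x. k (f x) = x" "\<And>x. f (k x) = x"
proof -
  obtain k where k: "homeomorphism UNIV UNIV f k"
    and ht: "homotopic_with_canon (\<lambda>_. True) UNIV UNIV f id"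
    using assms by (auto simp: supported_homeos_def homeos_homotopic_id_def)
  have kf: "k (f x) = x" "f (k x) = x" for x
    using k by (auto simp: homeomorphism_def)
  have "homotopic_with_canon (\<lambda>_. True) UNIV UNIV (f \<circ> k) (id \<circ> k)"
    by (rule homotopic_with_compose_continuous_right[where X=UNIV])
      (use ht k in \<open>auto simp: homeomorphism_def\<close>)
  moreover have "f \<circ> k = id" using kf by auto
  ultimately have "homotopic_with_canon (\<lambda>_. True) UNIV UNIV k id"
    by (simp add: homotopic_with_sym)
  moreover have "k x = x" if "x \<notin> S" for x
    using supported_homeosD(2)[OF assms that] kf(1)[of x] by simp
  ultimately have "k \<in> supported_homeos S"
    using k homeomorphism_sym[of UNIV UNIV f k]
    by (auto simp: supported_homeos_def homeos_homotopic_id_def)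
  then show ?thesis using kf by (rule that)
qed

lemma supported_homeos_maps:
  assumes "f \<in> supported_homeos S" "x \<in> S"
  shows "f x \<in> S"
proof (rule ccontr)
  assume "f x \<notin> S"
  then have "f (f x) = f x" by (rule supported_homeosD(2)[OF assms(1)])
  then have "f x = x"
    using supported_homeosD(4)[OF assms(1)] by (simp add: bij_def inj_eq)
  with \<open>f x \<notin> S\<close> assms(2) show False by simp
qed

text \<open>The glued map is the composition of all \<open>f i\<close>. As the supports are disjoint
  and each \<open>f i\<close> preserves its own, at most one factor moves a given point. Composing
  also takes care of the homotopy to the identity.\<close>

lemma supported_homeos_glue:
  assumes "finite I" "disjoint_family_on S I" "\<And>i. i \<in> I \<Longrightarrow> f i \<in> supported_homeos (S i)"
  shows "\<exists>h\<in>supported_homeos (\<Union>i\<in>I. S i). \<forall>i\<in>I. \<forall>x\<in>S i. h x = f i x"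
  using assms
proof (induction I rule: finite_induct)
  case empty
  then show ?case using supported_homeos_id by blast
next
  case (insert j I)
  have "disjoint_family_on S I"
    using insert.prems(1) by (rule disjoint_family_on_mono[rotated]) auto
  then obtain h where h: "h \<in> supported_homeos (\<Union>i\<in>I. S i)" "\<forall>i\<in>I. \<forall>x\<in>S i. h x = f i x"
    using insert.IH insert.prems(2) by auto
  have fj: "f j \<in> supported_homeos (S j)" using insert.prems(2) by simp
  let ?U = "\<Union>i\<in>insert j I. S i"
  have "h \<in> supported_homeos ?U" "f j \<in> supported_homeos ?U"
    using h(1) fj supported_homeos_mono[of "S j" ?U] supported_homeos_mono[of "\<Union>i\<in>I. S i" ?U] by auto
  then have "f j \<circ> h \<in> supported_homeos ?U"
    by (intro supported_homeos_comp)
  moreover have "(f j \<circ> h) x = f i x" if i: "i \<in> insert j I" and x: "x \<in> S i" for i x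
  proof (cases "i = j")
    case True
    then have "x \<notin> (\<Union>i\<in>I. S i)"
      using x insert.hyps(2) insert.prems(1) by (fastforce simp: disjoint_family_on_def)
    then show ?thesis using supported_homeosD(2)[OF h(1)] True by simp
  next
    case False
    then have iI: "i \<in> I" using i by simp
    have "h x = f i x" using h(2) iI x by blast
    moreover have "f i x \<in> S i"
      using supported_homeos_maps[OF _ x] insert.prems(2) i by blast
    then have "f i x \<notin> S j"
      using insert.prems(1) i False by (fastforce simp: disjoint_family_on_def)
    ultimately show ?thesis using supported_homeosD(2)[OF fj] by simp
  qed
  ultimately show ?case by blast
qed

section \<open>Transferring sets and maps between charts and the manifold\<close>

lemma chart_homeomorphism:
  assumes "is_chart c"
  shows "homeomorphism (fst c) (snd c ` fst c) (snd c) (chart_inv c)"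
proof -
  obtain \<psi> where \<psi>: "homeomorphism (fst c) (snd c ` fst c) (snd c) \<psi>"
    using assms by (auto simp: is_chart_def)
  have inj: "inj_on (snd c) (fst c)"
    by (rule inj_on_inverseI[of _ \<psi>]) (use \<psi> in \<open>auto simp: homeomorphism_def\<close>)
  have "chart_inv c y = \<psi> y" if "y \<in> snd c ` fst c" for y
  proof -
    have "\<psi> y \<in> fst c" "snd c (\<psi> y) = y"
      using \<psi> that by (auto simp: homeomorphism_def)
    then show ?thesis
      unfolding chart_inv_def using inv_into_f_f[OF inj] by metis
  qed
  then show ?thesis by (intro homeomorphism_cong[OF \<psi>]) auto
qed

lemma chart_simps:
  assumes "is_chart c"
  shows "open (fst c)" "open (snd c ` fst c)" "continuous_on (fst c) (snd c)"
    "continuous_on (snd c ` fst c) (chart_inv c)"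
    "x \<in> fst c \<Longrightarrow> chart_inv c (snd c x) = x"
    "y \<in> snd c ` fst c \<Longrightarrow> snd c (chart_inv c y) = y"
    "y \<in> snd c ` fst c \<Longrightarrow> chart_inv c y \<in> fst c"
  using assms chart_homeomorphism[OF assms]
  by (auto simp: is_chart_def homeomorphism_def)

lemma chart_inv_image_eq:
  assumes "is_chart c" "S \<subseteq> snd c ` fst c"
  shows "chart_inv c ` S = {x \<in> fst c. snd c x \<in> S}"
proof safe
  fix y assume "y \<in> S"
  then have "y \<in> snd c ` fst c" using assms by auto
  with \<open>y \<in> S\<close> show "chart_inv c y \<in> fst c" "snd c (chart_inv c y) \<in> S"
    using chart_simps(6,7)[OF assms(1)] by auto
next
  fix x assume "x \<in> fst c" "snd c x \<in> S"
  then show "x \<in> chart_inv c ` S" using chart_simps(5)[OF assms(1)] by (metis imageI)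
qed

lemma open_chart_image:
  assumes "is_chart c" "open W" shows "open (snd c ` (fst c \<inter> W))"
proof -
  have "openin (top_of_set (snd c ` fst c)) (snd c ` (fst c \<inter> W))"
    using assms(2) by (intro homeomorphism_imp_open_map[OF chart_homeomorphism[OF assms(1)]] openin_open_Int)
  then show ?thesis using chart_simps(2)[OF assms(1)] openin_open_trans by blast
qed

lemma open_chart_inv_image:
  assumes "is_chart c" "open S" "S \<subseteq> snd c ` fst c" shows "open (chart_inv c ` S)"
proof -
  have "open (fst c \<inter> snd c -` S)"
    using chart_simps[OF assms(1)] assms(2) by (intro continuous_open_preimage) auto
  moreover have "fst c \<inter> snd c -` S = chart_inv c ` S"
    using chart_inv_image_eq[OF assms(1,3)] by auto
  ultimately show ?thesis by simp
qed

lemma chart_cball: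
  assumes "is_chart c" "open W" "a \<in> W" "a \<in> fst c"
  obtains \<rho> where "0 < \<rho>" "cball (snd c a) \<rho> \<subseteq> snd c ` (fst c \<inter> W)"
proof -
  have "snd c a \<in> snd c ` (fst c \<inter> W)" using assms(3,4) by blast
  then obtain \<rho> where "\<rho> > 0" "cball (snd c a) \<rho> \<subseteq> snd c ` (fst c \<inter> W)"
    using open_chart_image[OF assms(1,2)] unfolding open_contains_cball by blast
  then show ?thesis by (rule that)
qed

lemma compact_chart_inv_image:
  assumes "is_chart c" "compact S" "S \<subseteq> snd c ` fst c" shows "compact (chart_inv c ` S)"
  by (rule compact_continuous_image[OF continuous_on_subset[OF chart_simps(4)[OF assms(1)] assms(3)] assms(2)])

lemma connected_chart_inv_image:
  assumes "is_chart c" "connected S" "S \<subseteq> snd c ` fst c" shows "connected (chart_inv c ` S)"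
  by (rule connected_continuous_image[OF continuous_on_subset[OF chart_simps(4)[OF assms(1)] assms(3)] assms(2)])

text \<open>Two open sets cover the space: the chart domain, where the formula is continuous, and
  the complement of the compact image of \<open>C\<close>, where the map is the projection. The real
  parameter lets the lemma serve homotopies as well as single maps.\<close>

lemma chart_extension_continuous:
  fixes c :: "('a::t2_space, 'e::euclidean_space) chart" and f :: "real \<times> 'e \<Rightarrow> 'e"
  assumes c: "is_chart c" and C: "compact C" "C \<subseteq> snd c ` fst c"
    and f: "continuous_on UNIV f" "\<And>t y. y \<in> C \<Longrightarrow> f (t, y) \<in> C" "\<And>t y. y \<notin> C \<Longrightarrow> f (t, y) = y"
  shows "continuous_on UNIV (\<lambda>(t, x). if x \<in> fst c then chart_inv c (f (t, snd c x)) else x)"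
    (is "continuous_on UNIV ?h")
proof -
  have "closed (chart_inv c ` C)"
    by (rule compact_imp_closed[OF compact_chart_inv_image[OF c C]])
  then have "open (- (chart_inv c ` C))" by (rule open_Compl)
  have im: "f (t, y) \<in> snd c ` fst c" if "y \<in> snd c ` fst c" for t y
    using f(2,3)[of y t] C that by (cases "y \<in> C") auto
  have 1: "continuous_on (UNIV \<times> fst c) ?h"
  proof (rule continuous_on_eq)
    have "continuous_on (UNIV \<times> fst c) (\<lambda>z. (fst z :: real, snd c (snd z)))"
      by (intro continuous_intros continuous_on_compose2[OF chart_simps(3)[OF c]]) auto
    then have "continuous_on (UNIV \<times> fst c) (\<lambda>z. f (fst z, snd c (snd z)))"
      by (rule continuous_on_compose2[OF f(1)]) auto
    then show "continuous_on (UNIV \<times> fst c) (\<lambda>z. chart_inv c (f (fst z, snd c (snd z))))"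
      by (rule continuous_on_compose2[OF chart_simps(4)[OF c]]) (use im in auto)
  qed auto
  have 2: "continuous_on (UNIV \<times> (- (chart_inv c ` C))) ?h"
  proof (rule continuous_on_eq[of _ snd])
    fix z :: "real \<times> 'a" assume z: "z \<in> UNIV \<times> (- (chart_inv c ` C))"
    show "snd z = ?h z"
    proof (cases "snd z \<in> fst c")
      case True
      then have "snd c (snd z) \<notin> C"
        using z chart_simps(5)[OF c True] by (metis ComplD imageI mem_Times_iff)
      then show ?thesis using f(3) True chart_simps(5)[OF c True] by (simp add: case_prod_beta)
    qed (simp add: case_prod_beta)
  qed (intro continuous_intros)
  have "continuous_on ((UNIV \<times> fst c) \<union> (UNIV \<times> (- (chart_inv c ` C)))) ?h"
    using 1 2 \<open>open (- (chart_inv c ` C))\<close> chart_simps(1)[OF c]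
    by (intro continuous_on_open_Un open_Times) auto
  moreover have "(UNIV \<times> fst c) \<union> (UNIV \<times> (- (chart_inv c ` C))) = (UNIV :: (real \<times> 'a) set)"
    using C chart_simps(7)[OF c] by auto
  ultimately show ?thesis by simp
qed

text \<open>Inside a convex coordinate domain the straight-line homotopy connects the homeomorphism with
  the identity.\<close>

lemma chart_supported_homeo:
  fixes c :: "('a::t2_space, 'e::euclidean_space) chart" and f k :: "'e \<Rightarrow> 'e"
  assumes c: "is_chart c" and C: "compact C" "convex C" "C \<subseteq> snd c ` fst c"
    and f: "homeomorphism UNIV UNIV f k" "\<And>y. y \<notin> C \<Longrightarrow> f y = y"
  obtains F where "F \<in> supported_homeos (chart_inv c ` C)"
    "\<And>x. x \<in> fst c \<Longrightarrow> F x = chart_inv c (f (snd c x))"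
proof -
  have kf: "k (f y) = y" "f (k y) = y" for y using f(1) by (auto simp: homeomorphism_def)
  have k2: "k y = y" if "y \<notin> C" for y using f(2)[OF that] kf(1)[of y] by simp
  have fC: "f y \<in> C" if "y \<in> C" for y using f(2)[of "f y"] kf(1)[of "f y"] kf(1)[of y] that by metis
  have kC: "k y \<in> C" if "y \<in> C" for y using k2[of "k y"] kf(2)[of "k y"] kf(2)[of y] that by metis
  have cont: "continuous_on UNIV f" "continuous_on UNIV k" using f(1) by (auto simp: homeomorphism_def)
  define F where "F = (\<lambda>x. if x \<in> fst c then chart_inv c (f (snd c x)) else x)"
  define K where "K = (\<lambda>x. if x \<in> fst c then chart_inv c (k (snd c x)) else x)"
  \<comment> \<open>Time is clamped to \<open>{0..1}\<close> because
    \<open>chart_extension_continuous\<close> wants \<open>C\<close> preserved at every real time;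
    convexity of \<open>C\<close> then applies.\<close>
  define H where "H = (\<lambda>(t::real, x). if x \<in> fst c then
      chart_inv c ((1 - min 1 (max 0 t)) *\<^sub>R f (snd c x) + min 1 (max 0 t) *\<^sub>R snd c x) else x)"
  have "continuous_on UNIV H"
  proof -
    have "continuous_on UNIV (\<lambda>(t, x). if x \<in> fst c then
        chart_inv c ((\<lambda>z. (1 - min 1 (max 0 (fst z))) *\<^sub>R f (snd z) + min 1 (max 0 (fst z)) *\<^sub>R snd z) (t, snd c x)) else x)"
    proof (rule chart_extension_continuous[OF c C(1,3)])
      show "continuous_on UNIV (\<lambda>z. (1 - min 1 (max 0 (fst z))) *\<^sub>R f (snd z) + min 1 (max 0 (fst z)) *\<^sub>R snd z)"
        by (intro continuous_intros continuous_on_compose2[OF cont(1)]) auto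
    next
      fix t :: real and y assume "y \<in> C"
      then show "(1 - min 1 (max 0 (fst (t, y)))) *\<^sub>R f (snd (t, y)) + min 1 (max 0 (fst (t, y))) *\<^sub>R snd (t, y) \<in> C"
        unfolding fst_conv snd_conv by (intro convexD[OF C(2)] fC) (assumption | linarith)+
    next
      fix t :: real and y assume "y \<notin> C"
      then show "(1 - min 1 (max 0 (fst (t, y)))) *\<^sub>R f (snd (t, y)) + min 1 (max 0 (fst (t, y))) *\<^sub>R snd (t, y) = y"
        using f(2) by (simp add: scaleR_left_diff_distrib)
    qed
    then show ?thesis unfolding H_def fst_conv snd_conv .
  qed
  then have "continuous_on UNIV (\<lambda>x. H (0, x))"
    by (rule continuous_on_compose2[of UNIV]) (auto intro!: continuous_intros)
  moreover have "H (0, x) = F x" "H (1, x) = x" for x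
    using chart_simps(5)[OF c, of x] by (auto simp: H_def F_def)
  ultimately have cF: "continuous_on UNIV F" by simp
  have "continuous_on UNIV (\<lambda>(t::real, x). if x \<in> fst c then
        chart_inv c ((\<lambda>z. k (snd z)) (t, snd c x)) else x)" (is "continuous_on UNIV ?h")
    by (rule chart_extension_continuous[OF c C(1,3)])
      (use k2 kC in \<open>auto intro!: continuous_on_compose2[OF cont(2)] continuous_intros\<close>)
  then have "continuous_on UNIV (\<lambda>x. ?h (0::real, x))"
    by (rule continuous_on_compose2[of UNIV]) (auto intro!: continuous_intros)
  then have cK: "continuous_on UNIV K" unfolding K_def by (simp only: prod.case snd_conv)
  have im: "f y \<in> snd c ` fst c" "k y \<in> snd c ` fst c" if "y \<in> snd c ` fst c" for y
    by (atomize (full)) (use fC[of y] kC[of y] f(2)[of y] k2[of y] C(3) that in \<open>cases "y \<in> C"; auto\<close>)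
  have KF: "K (F x) = x" "F (K x) = x" for x
    using im[of "snd c x"] kf chart_simps(5)[OF c, of x] chart_simps(6,7)[OF c]
    by (cases "x \<in> fst c"; simp add: F_def K_def)+
  have "homeomorphism UNIV UNIV F K"
    using cF cK KF by (intro homeomorphismI) auto
  moreover have "homotopic_with_canon (\<lambda>_. True) UNIV UNIV F id"
  proof -
    have "continuous_on ({0..1} \<times> UNIV) H"
      using \<open>continuous_on UNIV H\<close> by (rule continuous_on_subset) simp
    then show ?thesis
      unfolding homotopic_with_def
      using \<open>\<And>x. H (0, x) = F x\<close> \<open>\<And>x. H (1, x) = x\<close>
      by (intro exI[of _ H]) (auto simp: prod_topology_subtopology subtopology_Times)
  qed
  moreover have "F x = x" if "x \<notin> chart_inv c ` C" for x
  proof (cases "x \<in> fst c")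
    case True
    then have "snd c x \<notin> C" using that chart_simps(5)[OF c True] by (metis imageI)
    then show ?thesis using f(2) True chart_simps(5)[OF c True] by (simp add: F_def)
  qed (simp add: F_def)
  ultimately have "F \<in> supported_homeos (chart_inv c ` C)"
    by (auto simp: supported_homeos_def homeos_homotopic_id_def)
  then show ?thesis by (rule that) (simp add: F_def)
qed

section \<open>Convex cells and thin sets\<close>

text \<open>The property of a coordinate cube that the transport argument exploits, with the chart
  hidden: homeomorphisms supported arbitrarily close to \<open>B\<close> squeeze it into arbitrarily
  small neighbourhoods of \<open>b\<close>.\<close>

definition convex_cell :: "'a::metric_space set \<Rightarrow> 'a \<Rightarrow> bool" where
  "convex_cell B b \<longleftrightarrow> compact B \<and> b \<in> B \<and>
     (\<forall>G N. open G \<and> B \<subseteq> G \<and> open N \<and> b \<in> N \<longrightarrow> (\<exists>s\<in>supported_homeos G. s ` B \<subseteq> N))"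

lemma chart_convex_cell:
  fixes c :: "('a::metric_space, 'e::euclidean_space) chart"
  assumes c: "is_chart c" and K: "compact K" "convex K" "K \<subseteq> snd c ` fst c" "p \<in> K"
  shows "convex_cell (chart_inv c ` K) (chart_inv c p)"
  unfolding convex_cell_def
proof (intro conjI allI impI)
  show "compact (chart_inv c ` K)" using c K by (intro compact_chart_inv_image)
  show "chart_inv c p \<in> chart_inv c ` K" using K by simp
  fix G N :: "'a set" assume GN: "open G \<and> chart_inv c ` K \<subseteq> G \<and> open N \<and> chart_inv c p \<in> N"
  have KO: "K \<subseteq> snd c ` (fst c \<inter> G)"
  proof
    fix y assume "y \<in> K"
    then have "y \<in> snd c ` fst c" "chart_inv c y \<in> G" using K GN by auto
    then show "y \<in> snd c ` (fst c \<inter> G)"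
      using chart_simps(6,7)[OF c] by (metis IntI imageI)
  qed
  obtain \<kappa> where \<kappa>: "0 < \<kappa>" "\<And>x y. x \<in> K \<Longrightarrow> dist x y < \<kappa> \<Longrightarrow> y \<in> snd c ` (fst c \<inter> G)"
    using compact_subset_open_uniform[OF K(1) open_chart_image[OF c] KO] GN by blast
  \<comment> \<open>The Minkowski sum of \<open>K\<close> with a small ball is a compact convex
    domain inside the part of the chart lying over \<open>G\<close>; the contraction is supported
    there.\<close>
  define C where "C = {x + y | x y. x \<in> K \<and> y \<in> cball 0 (\<kappa>/2)}"
  have C: "compact C" "convex C"
  proof -
    show "compact C" unfolding C_def by (rule compact_sums[OF K(1) compact_cball])
    have "C = (\<Union>x\<in>K. \<Union>y\<in>cball 0 (\<kappa>/2). {x + y})"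
      unfolding C_def by blast
    then show "convex C" using convex_sums[OF K(2) convex_cball] by metis
  qed
  have CG: "C \<subseteq> snd c ` (fst c \<inter> G)"
    using \<kappa> by (fastforce simp: C_def dist_norm)
  have C1: "C \<subseteq> snd c ` fst c" using CG by blast
  obtain f k t where f: "homeomorphism UNIV UNIV f k" "0 < t" "t < 1"
    "\<And>x. x \<in> K \<Longrightarrow> f x = p + t *\<^sub>R (x - p)" "\<And>x. \<kappa>/2 \<le> infdist x K \<Longrightarrow> f x = x"
    using homeomorphism_contracting_convex[OF K(1,2,4), of "\<kappa>/2"] \<kappa>(1) by auto
  have "f y = y" if y: "y \<notin> C" for y
  proof (rule f(5), rule ccontr)
    assume "\<not> \<kappa>/2 \<le> infdist y K"
    moreover obtain b where "b \<in> K" "infdist y K = dist y b"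
      using infdist_attains_inf[of K y] compact_imp_closed[OF K(1)] K(4) by blast
    ultimately have "b \<in> K" "y - b \<in> cball 0 (\<kappa>/2)" by (auto simp: dist_norm norm_minus_commute)
    then have "b + (y - b) \<in> C" unfolding C_def by blast
    with y show False by simp
  qed
  then obtain F where F: "F \<in> supported_homeos (chart_inv c ` C)"
    "\<And>x. x \<in> fst c \<Longrightarrow> F x = chart_inv c (f (snd c x))"
    using chart_supported_homeo[OF c C C1 f(1)] by metis
  have "chart_inv c ` C \<subseteq> G"
    using CG chart_simps(5)[OF c] by auto
  then have FG: "F \<in> supported_homeos G" using F(1) supported_homeos_mono by blast
  have stay: "p + t ^ n *\<^sub>R (x - p) \<in> K" if "x \<in> K" for x n
  proof -
    have "t ^ n \<le> 1" "0 \<le> t ^ n" using f(2,3) by (simp_all add: power_le_one)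
    then have "(1 - t ^ n) *\<^sub>R p + t ^ n *\<^sub>R x \<in> K"
      using that K(4) by (intro convexD[OF K(2)]) auto
    then show ?thesis by (simp add: algebra_simps)
  qed
  \<comment> \<open>Convexity keeps the shrunken copies of \<open>K\<close> inside \<open>K\<close>,
    where \<open>f\<close> is exactly the homothety of ratio \<open>t\<close>, so iteration
    multiplies the ratios.\<close>
  have iter: "(F ^^ n) (chart_inv c x) = chart_inv c (p + t ^ n *\<^sub>R (x - p))" if x: "x \<in> K" for x n
  proof (induction n)
    case (Suc n)
    let ?z = "p + t ^ n *\<^sub>R (x - p)"
    have z: "?z \<in> K" using stay[OF x] .
    then have zc: "?z \<in> snd c ` fst c" using K(3) by blast
    have "(F ^^ Suc n) (chart_inv c x) = F (chart_inv c ?z)" using Suc by simp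
    also have "\<dots> = chart_inv c (f ?z)"
      using F(2)[OF chart_simps(7)[OF c zc]] chart_simps(6)[OF c zc] by simp
    also have "f ?z = p + t ^ Suc n *\<^sub>R (x - p)" using f(4)[OF z] by simp
    finally show ?case .
  qed simp
  have p: "p \<in> snd c ` fst c" using K by blast
  obtain \<rho> where \<rho>: "0 < \<rho>" "cball (snd c (chart_inv c p)) \<rho> \<subseteq> snd c ` (fst c \<inter> N)"
    using chart_cball[OF c, of N "chart_inv c p"] GN chart_simps(7)[OF c p] by blast
  obtain R where R: "\<And>x. x \<in> K \<Longrightarrow> dist p x \<le> R"
    using compact_imp_bounded[OF K(1)] bounded_any_center by blast
  have "(\<lambda>n. t ^ n * R) \<longlonglongrightarrow> 0 * R"
    using f(2,3) by (intro tendsto_mult LIMSEQ_power_zero tendsto_const) auto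
  then have "\<forall>\<^sub>F n in sequentially. t ^ n * R < \<rho>"
    using \<rho>(1) by (auto dest: order_tendstoD)
  then obtain n where n: "t ^ n * R < \<rho>" by (auto simp: eventually_sequentially)
  have "(F ^^ n) ` chart_inv c ` K \<subseteq> N"
  proof clarify
    fix x assume x: "x \<in> K"
    have "norm (t ^ n *\<^sub>R (x - p)) \<le> t ^ n * R"
      using R[OF x] f(2) by (simp add: dist_norm norm_minus_commute mult_left_mono)
    then have "p + t ^ n *\<^sub>R (x - p) \<in> cball (snd c (chart_inv c p)) \<rho>"
      using n chart_simps(6)[OF c p] by (simp add: dist_norm)
    then obtain y where y: "y \<in> fst c" "y \<in> N" "p + t ^ n *\<^sub>R (x - p) = snd c y"
      using \<rho>(2) by blast
    then have "(F ^^ n) (chart_inv c x) = y"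
      using iter[OF x, of n] chart_simps(5)[OF c y(1)] by simp
    then show "(F ^^ n) (chart_inv c x) \<in> N" using y(2) by simp
  qed
  then show "\<exists>s\<in>supported_homeos G. s ` chart_inv c ` K \<subseteq> N"
    using supported_homeos_funpow[OF FG] by blast
qed

text \<open>Sets that separate no connected open set, not even locally. Removing one thin set from
  \<open>V\<close> leaves an open connected nonempty set to which the next can be applied, so finite
  unions stay thin. This is what allows arcs to be routed around earlier arcs.\<close>

definition thin :: "'a::topological_space set \<Rightarrow> bool" where
  "thin P \<longleftrightarrow> closed P \<and>
     (\<forall>V. open V \<and> connected V \<and> V \<noteq> {} \<longrightarrow> connected (V - P) \<and> V - P \<noteq> {})"

lemma thin_empty: "thin {}"
  by (simp add: thin_def)

lemma thin_Un:
  assumes "thin P" "thin Q" shows "thin (P \<union> Q)"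
proof -
  have "connected (V - (P \<union> Q)) \<and> V - (P \<union> Q) \<noteq> {}" if "open V" "connected V" "V \<noteq> {}" for V
  proof -
    have "open (V - P)" "connected (V - P)" "V - P \<noteq> {}"
      using assms(1) that by (simp_all add: thin_def open_Diff)
    then have "connected (V - P - Q) \<and> V - P - Q \<noteq> {}"
      using assms(2) by (simp add: thin_def)
    then show ?thesis by (simp add: Diff_Un Diff_eq Int_assoc)
  qed
  then show ?thesis using assms by (simp add: thin_def closed_Un)
qed

lemma thin_UN: "finite I \<Longrightarrow> (\<And>i. i \<in> I \<Longrightarrow> thin (P i)) \<Longrightarrow> thin (\<Union>i\<in>I. P i)"
  by (induction I rule: finite_induct) (simp_all add: thin_empty thin_Un)

text \<open>Not separating is a local property: a separation of \<open>V - P\<close> would extend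
  over \<open>P\<close> to a separation of \<open>V\<close>, because each small \<open>N - P\<close>
  is connected and so lies on one side.\<close>

lemma thinI:
  assumes P: "closed P"
    and loc: "\<And>W a. open W \<Longrightarrow> a \<in> W \<Longrightarrow>
      \<exists>N. open N \<and> a \<in> N \<and> N \<subseteq> W \<and> connected (N - P) \<and> N - P \<noteq> {}"
  shows "thin P"
proof -
  have ne: "W - P \<noteq> {}" if "open W" "a \<in> W" for W a
    using loc[OF that] by blast
  have "connected (V - P)" if V: "open V" "connected V" for V
  proof (rule ccontr)
    assume "\<not> connected (V - P)"
    then obtain A B where AB: "open A" "open B" "V - P \<subseteq> A \<union> B" "A \<inter> B \<inter> (V - P) = {}"
      "A \<inter> (V - P) \<noteq> {}" "B \<inter> (V - P) \<noteq> {}"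
      unfolding connected_def by blast
    \<comment> \<open>\<open>E S\<close> fills in the points of \<open>P\<close> around which
      everything off \<open>P\<close> belongs to \<open>S\<close>. The sets \<open>E A\<close> and
      \<open>E B\<close> are disjoint since no nonempty open set is contained in
      \<open>P\<close>.\<close>
    define E where "E = (\<lambda>S. \<Union>{N. open N \<and> N \<subseteq> V \<and> N - P \<subseteq> S})"
    have "V \<subseteq> E A \<union> E B"
    proof
      fix a assume "a \<in> V"
      then obtain N where N: "open N" "a \<in> N" "N \<subseteq> V" "connected (N - P)"
        using loc[OF V(1)] by blast
      have "N - P \<subseteq> A \<union> B" using N AB by blast
      moreover have "A \<inter> B \<inter> (N - P) = {}" using N AB by blast
      ultimately have "A \<inter> (N - P) = {} \<or> B \<inter> (N - P) = {}"
        using connectedD[OF N(4) AB(1,2)] by blast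
      then have "N - P \<subseteq> A \<or> N - P \<subseteq> B" using \<open>N - P \<subseteq> A \<union> B\<close> by blast
      then show "a \<in> E A \<union> E B" using N unfolding E_def by blast
    qed
    moreover have "open (E A)" "open (E B)" unfolding E_def by auto
    moreover have "E A \<inter> E B \<inter> V = {}"
    proof (rule ccontr)
      assume "E A \<inter> E B \<inter> V \<noteq> {}"
      then obtain a N1 N2 where a: "a \<in> N1" "a \<in> N2" "open N1" "open N2" "N1 \<subseteq> V" "N1 - P \<subseteq> A" "N2 - P \<subseteq> B"
        unfolding E_def by blast
      then have "(N1 \<inter> N2) - P \<noteq> {}" by (intro ne[of _ a]) auto
      then show False using a AB(4) by blast
    qed
    moreover have "E A \<inter> V \<noteq> {}"
    proof -
      have "open (A \<inter> (V - P))" using AB V P by (simp add: open_Int open_Diff)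
      then have "A \<inter> (V - P) \<subseteq> E A" unfolding E_def by blast
      then show ?thesis using AB(5) by blast
    qed
    moreover have "E B \<inter> V \<noteq> {}"
    proof -
      have "open (B \<inter> (V - P))" using AB V P by (simp add: open_Int open_Diff)
      then have "B \<inter> (V - P) \<subseteq> E B" unfolding E_def by blast
      then show ?thesis using AB(6) by blast
    qed
    ultimately show False using V(2) unfolding connected_def by blast
  qed
  then show ?thesis using P ne unfolding thin_def by blast
qed

section \<open>Point pushing and thin arcs in a manifold\<close>

locale manifold =
  fixes A :: "('a::metric_space, 'e::euclidean_space) chart set"
  assumes charts: "c \<in> A \<Longrightarrow> is_chart c" and charts_cover: "\<exists>c\<in>A. x \<in> fst c"
begin

text \<open>The orbits in \<open>T\<close> of the group \<open>supported_homeos T\<close> are open,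
  by moving the centre of a coordinate ball; a connected \<open>T\<close> is therefore a single
  orbit.\<close>

lemma supported_homeo_moving:
  fixes T :: "'a set"
  assumes T: "open T" "connected T" "x \<in> T" "y \<in> T"
  shows "\<exists>h\<in>supported_homeos T. h x = y"
proof (rule connected_equivalence_relation[OF T(2-4), where R = "\<lambda>x y. \<exists>h\<in>supported_homeos T. h x = y"])
  fix x y assume "\<exists>h\<in>supported_homeos T. h x = y"
  then show "\<exists>h\<in>supported_homeos T. h y = x" by (metis supported_homeos_inverse)
next
  fix x y z assume "\<exists>h\<in>supported_homeos T. h x = y" "\<exists>h\<in>supported_homeos T. h y = z"
  then show "\<exists>h\<in>supported_homeos T. h x = z" by (metis comp_apply supported_homeos_comp)
next
  fix a assume a: "a \<in> T"
  obtain c where "c \<in> A" and ac: "a \<in> fst c" using charts_cover by blast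
  then have c: "is_chart c" by (simp add: charts)
  obtain \<rho> where \<rho>: "0 < \<rho>" "cball (snd c a) \<rho> \<subseteq> snd c ` (fst c \<inter> T)"
    using chart_cball[OF c T(1) a ac] by blast
  have sub: "cball (snd c a) \<rho> \<subseteq> snd c ` fst c" using \<rho>(2) by blast
  then have bsub: "ball (snd c a) \<rho> \<subseteq> snd c ` fst c" using ball_subset_cball by blast
  have sT: "chart_inv c ` cball (snd c a) \<rho> \<subseteq> T"
    using \<rho>(2) chart_simps(5)[OF c] by auto
  define D where "D = chart_inv c ` ball (snd c a) \<rho>"
  have "open D" unfolding D_def by (rule open_chart_inv_image[OF c open_ball bsub])
  have DT: "D \<subseteq> T" using sT ball_subset_cball unfolding D_def by blast
  have "\<exists>h\<in>supported_homeos T. h a = y" if y: "y \<in> D" for y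
  proof -
    have yc: "y \<in> fst c" "dist (snd c a) (snd c y) < \<rho>"
      using y unfolding D_def chart_inv_image_eq[OF c bsub] by auto
    obtain f k where f: "homeomorphism UNIV UNIV f k" "f (snd c a) = snd c y"
      "\<And>x. x \<notin> ball (snd c a) \<rho> \<Longrightarrow> f x = x"
      using homeomorphism_moving_centre[OF yc(2)] by blast
    have "f x = x" if "x \<notin> cball (snd c a) \<rho>" for x using f(3)[of x] that by simp
    then obtain F where F: "F \<in> supported_homeos (chart_inv c ` cball (snd c a) \<rho>)"
      "\<And>x. x \<in> fst c \<Longrightarrow> F x = chart_inv c (f (snd c x))"
      using chart_supported_homeo[OF c compact_cball convex_cball sub f(1)] by metis
    have "F a = y" using F(2)[OF ac] f(2) chart_simps(5)[OF c yc(1)] by simp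
    moreover have "F \<in> supported_homeos T" using F(1) sT supported_homeos_mono by blast
    ultimately show ?thesis by blast
  qed
  moreover have "a \<in> D"
    unfolding D_def chart_inv_image_eq[OF c bsub] using ac \<rho>(1) by simp
  moreover have "openin (top_of_set T) D" using \<open>open D\<close> DT by (simp add: openin_open_eq T(1))
  ultimately show "\<exists>D. openin (top_of_set T) D \<and> a \<in> D \<and> (\<forall>x\<in>D. \<exists>h\<in>supported_homeos T. h a = x)"
    by blast
qed

lemma chart_segment_thin:
  fixes c :: "('a, 'e) chart"
  assumes dim: "3 \<le> DIM('e)" and c: "is_chart c" and pq: "closed_segment p q \<subseteq> snd c ` fst c"
  shows "thin (chart_inv c ` closed_segment p q)"
proof (rule thinI)
  let ?P = "chart_inv c ` closed_segment p q"
  show clP: "closed ?P"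
    by (rule compact_imp_closed[OF compact_chart_inv_image[OF c compact_segment pq]])
  \<comment> \<open>Covers both kinds of points: near the segment, \<open>d\<close> is the chart
    \<open>c\<close> and \<open>S\<close> the segment; away from it, \<open>d\<close> is any chart
    around the point and \<open>S\<close> is empty.\<close>
  have main: "\<exists>N. open N \<and> a \<in> N \<and> N \<subseteq> W \<and> connected (N - ?P) \<and> N - ?P \<noteq> {}"
    if d: "is_chart d" "a \<in> fst d" "open W" "a \<in> W"
      "\<And>x. x \<in> fst d \<Longrightarrow> x \<in> W \<Longrightarrow> x \<in> ?P \<longleftrightarrow> snd d x \<in> S" "S = {} \<or> S = closed_segment p q" for d a W S
  proof -
    obtain \<rho> where \<rho>: "0 < \<rho>" "cball (snd d a) \<rho> \<subseteq> snd d ` (fst d \<inter> W)"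
      using chart_cball[OF d(1,3,4,2)] by blast
    have bsub: "ball (snd d a) \<rho> \<subseteq> snd d ` (fst d \<inter> W)" using \<rho>(2) ball_subset_cball by blast
    then have bs: "ball (snd d a) \<rho> \<subseteq> snd d ` fst d" by blast
    define N where "N = chart_inv d ` ball (snd d a) \<rho>"
    have Neq: "N = {x \<in> fst d. snd d x \<in> ball (snd d a) \<rho>}"
      unfolding N_def by (rule chart_inv_image_eq[OF d(1) bs])
    have NW: "N \<subseteq> W"
      unfolding N_def using bsub chart_simps(5)[OF d(1)] by auto
    have bS: "ball (snd d a) \<rho> - S \<subseteq> snd d ` fst d" using bs by blast
    have NP: "N - ?P = chart_inv d ` (ball (snd d a) \<rho> - S)"
      unfolding chart_inv_image_eq[OF d(1) bS] using d(5) NW unfolding Neq by blast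
    have "interior S = {}" using d(6) interior_closed_segment_ge2[of p q] dim by auto
    then have "\<not> ball (snd d a) \<rho> \<subseteq> S"
      using \<rho>(1) by (metis centre_in_ball empty_iff interior_maximal open_ball subsetD)
    moreover have "connected (ball (snd d a) \<rho> - S)"
      using d(6) connected_convex_minus_segment[OF dim convex_ball open_ball] by auto
    ultimately have "connected (N - ?P)" "N - ?P \<noteq> {}"
      unfolding NP using connected_chart_inv_image[OF d(1) _ bS] by auto
    moreover have "open N" unfolding N_def by (rule open_chart_inv_image[OF d(1) open_ball bs])
    moreover have "a \<in> N" using \<rho>(1) d(2) by (simp add: Neq)
    ultimately show ?thesis using NW by blast
  qed
  fix W :: "'a set" and a assume W: "open W" "a \<in> W"
  show "\<exists>N. open N \<and> a \<in> N \<and> N \<subseteq> W \<and> connected (N - ?P) \<and> N - ?P \<noteq> {}"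
  proof (cases "a \<in> ?P")
    case True
    have "x \<in> ?P \<longleftrightarrow> snd c x \<in> closed_segment p q" if "x \<in> fst c" for x
      using that unfolding chart_inv_image_eq[OF c pq] by simp
    moreover have "a \<in> fst c" using True unfolding chart_inv_image_eq[OF c pq] by simp
    ultimately show ?thesis using main[OF c _ W, of "closed_segment p q"] by blast
  next
    case False
    obtain d where d: "d \<in> A" "a \<in> fst d" using charts_cover by blast
    have "open (W - ?P)" using W(1) clP by (rule open_Diff)
    then obtain N where "open N \<and> a \<in> N \<and> N \<subseteq> W - ?P \<and> connected (N - ?P) \<and> N - ?P \<noteq> {}"
      using main[OF charts[OF d(1)] d(2), of "W - ?P" "{}"] W(2) False by blast
    then show ?thesis by blast
  qed
qed

lemma thin_singleton:
  fixes a :: 'a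
  assumes "3 \<le> DIM('e)" shows "thin {a}"
proof -
  obtain c where c: "c \<in> A" "a \<in> fst c" using charts_cover by blast
  then have "thin (chart_inv c ` closed_segment (snd c a) (snd c a))"
    by (intro chart_segment_thin[OF assms charts]) auto
  then show ?thesis using chart_simps(5)[OF charts[OF c(1)] c(2)] by simp
qed

text \<open>Being joined inside \<open>V\<close> by such a set is an equivalence relation whose
  classes are open, since coordinate segments are thin. The arc is kept as a set: transitivity is
  just a union.\<close>

lemma thin_arc_exists:
  fixes V :: "'a set"
  assumes dim: "3 \<le> DIM('e)" and V: "open V" "connected V" "x \<in> V" "y \<in> V"
  shows "\<exists>P. compact P \<and> connected P \<and> thin P \<and> P \<subseteq> V \<and> x \<in> P \<and> y \<in> P"
proof (rule connected_equivalence_relation[OF V(2-4),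
      where R = "\<lambda>x y. \<exists>P. compact P \<and> connected P \<and> thin P \<and> P \<subseteq> V \<and> x \<in> P \<and> y \<in> P"])
  fix x y z
  assume "\<exists>P. compact P \<and> connected P \<and> thin P \<and> P \<subseteq> V \<and> x \<in> P \<and> y \<in> P"
    and "\<exists>P. compact P \<and> connected P \<and> thin P \<and> P \<subseteq> V \<and> y \<in> P \<and> z \<in> P"
  then obtain P Q where "compact P" "connected P" "thin P" "P \<subseteq> V" "x \<in> P" "y \<in> P"
    "compact Q" "connected Q" "thin Q" "Q \<subseteq> V" "y \<in> Q" "z \<in> Q" by blast
  then show "\<exists>P. compact P \<and> connected P \<and> thin P \<and> P \<subseteq> V \<and> x \<in> P \<and> z \<in> P"
    by (intro exI[of _ "P \<union> Q"]) (auto intro: compact_Un thin_Un connected_Un)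
next
  fix a assume a: "a \<in> V"
  obtain c where "c \<in> A" and ac: "a \<in> fst c" using charts_cover by blast
  then have c: "is_chart c" by (simp add: charts)
  obtain \<rho> where \<rho>: "0 < \<rho>" "cball (snd c a) \<rho> \<subseteq> snd c ` (fst c \<inter> V)"
    using chart_cball[OF c V(1) a ac] by blast
  then have bsub: "ball (snd c a) \<rho> \<subseteq> snd c ` fst c" using ball_subset_cball by blast
  have sV: "chart_inv c ` cball (snd c a) \<rho> \<subseteq> V"
    using \<rho>(2) chart_simps(5)[OF c] by auto
  define D where "D = chart_inv c ` ball (snd c a) \<rho>"
  have "open D" unfolding D_def by (rule open_chart_inv_image[OF c open_ball bsub])
  moreover have DV: "D \<subseteq> V" using sV ball_subset_cball unfolding D_def by blast
  moreover have "\<exists>P. compact P \<and> connected P \<and> thin P \<and> P \<subseteq> V \<and> a \<in> P \<and> y \<in> P" if y: "y \<in> D" for y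
  proof -
    have yc: "y \<in> fst c" "snd c y \<in> ball (snd c a) \<rho>"
      using y unfolding D_def chart_inv_image_eq[OF c bsub] by auto
    have seg: "closed_segment (snd c a) (snd c y) \<subseteq> ball (snd c a) \<rho>"
      using yc(2) \<rho>(1) by (intro closed_segment_subset) auto
    then have segc: "closed_segment (snd c a) (snd c y) \<subseteq> snd c ` fst c" using bsub by blast
    let ?P = "chart_inv c ` closed_segment (snd c a) (snd c y)"
    have "compact ?P" "connected ?P" "thin ?P"
      using compact_chart_inv_image[OF c compact_segment segc]
        connected_chart_inv_image[OF c connected_segment(1) segc] chart_segment_thin[OF dim c segc] by auto
    moreover have "?P \<subseteq> V" using seg DV unfolding D_def by blast
    moreover have "a \<in> ?P" using chart_simps(5)[OF c ac] ends_in_segment(1) by (metis imageI)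
    moreover have "y \<in> ?P" using chart_simps(5)[OF c yc(1)] ends_in_segment(2) by (metis imageI)
    ultimately show ?thesis by blast
  qed
  moreover have "a \<in> D"
    unfolding D_def chart_inv_image_eq[OF c bsub] using ac \<rho>(1) by simp
  moreover have "openin (top_of_set V) D" using \<open>open D\<close> DV by (simp add: openin_open_eq V(1))
  ultimately show "\<exists>D. openin (top_of_set V) D \<and> a \<in> D \<and>
      (\<forall>y\<in>D. \<exists>P. compact P \<and> connected P \<and> thin P \<and> P \<subseteq> V \<and> a \<in> P \<and> y \<in> P)"
    by blast
qed blast

end

section \<open>Riemannian manifolds as length spaces\<close>

definition C1_piece :: "('a, 'e::real_normed_vector) chart \<Rightarrow> (real \<Rightarrow> 'a) \<Rightarrow> real \<Rightarrow> real \<Rightarrow> (real \<Rightarrow> 'e) \<Rightarrow> bool" where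
  "C1_piece c \<gamma> a b D \<longleftrightarrow> \<gamma> ` {a..b} \<subseteq> fst c \<and> continuous_on {a..b} D \<and>
     (\<forall>s\<in>{a..b}. ((snd c \<circ> \<gamma>) has_vector_derivative D s) (at s within {a..b}))"

lemma C1_piece_affine:
  assumes "C1_piece c \<gamma> a b D" "0 < m" "a \<le> m * p + q" "m * p' + q \<le> b"
  shows "C1_piece c (\<lambda>s. \<gamma> (m * s + q)) p p' (\<lambda>s. m *\<^sub>R D (m * s + q))"
proof -
  have im: "m * s + q \<in> {a..b}" if "s \<in> {p..p'}" for s
  proof -
    have "m * p \<le> m * s" "m * s \<le> m * p'" using that assms(2) by auto
    then show ?thesis using assms(3,4) by auto
  qed
  have "((snd c \<circ> (\<lambda>s. \<gamma> (m * s + q))) has_vector_derivative m *\<^sub>R D (m * s + q)) (at s within {p..p'})"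
    if s: "s \<in> {p..p'}" for s
  proof -
    have "((\<lambda>s. m * s + q) has_vector_derivative m) (at s within {p..p'})"
      by (auto intro!: derivative_eq_intros simp: has_real_derivative_iff_has_vector_derivative[symmetric])
    moreover have "((snd c \<circ> \<gamma>) has_vector_derivative D (m * s + q)) (at (m * s + q) within (\<lambda>s. m * s + q) ` {p..p'})"
      using assms(1) im[OF s] im unfolding C1_piece_def
      by (meson has_vector_derivative_within_subset image_subsetI)
    ultimately have "((snd c \<circ> \<gamma>) \<circ> (\<lambda>s. m * s + q) has_vector_derivative m *\<^sub>R D (m * s + q)) (at s within {p..p'})"
      by (rule vector_diff_chain_within)
    then show ?thesis by (simp add: o_def)
  qed
  moreover have "continuous_on {p..p'} (\<lambda>s. m *\<^sub>R D (m * s + q))"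
  proof -
    have "continuous_on {a..b} D" using assms(1) unfolding C1_piece_def by blast
    moreover have "continuous_on {p..p'} (\<lambda>s. m * s + q)" by (intro continuous_intros)
    ultimately have "continuous_on {p..p'} (\<lambda>s. D (m * s + q))"
      by (rule continuous_on_compose2) (use im in blast)
    then show ?thesis by (intro continuous_intros)
  qed
  moreover have "(\<lambda>s. \<gamma> (m * s + q)) ` {p..p'} \<subseteq> fst c"
    using assms(1) im unfolding C1_piece_def by blast
  ultimately show ?thesis unfolding C1_piece_def by blast
qed

lemma C1_piece_cong:
  assumes "C1_piece c \<gamma> a b D" "\<And>s. s \<in> {a..b} \<Longrightarrow> \<gamma>' s = \<gamma> s"
  shows "C1_piece c \<gamma>' a b D"
proof -
  have "((snd c \<circ> \<gamma>') has_vector_derivative D s) (at s within {a..b})" if s: "s \<in> {a..b}" for s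
  proof (rule has_vector_derivative_transform[OF s])
    show "((snd c \<circ> \<gamma>) has_vector_derivative D s) (at s within {a..b})"
      using assms(1) s unfolding C1_piece_def by blast
  qed (simp add: assms(2))
  then show ?thesis using assms unfolding C1_piece_def by (auto simp: image_subset_iff)
qed

lemma piecewise_C1_path_iff:
  "piecewise_C1_path A \<gamma> \<longleftrightarrow> path \<gamma> \<and> (\<exists>n t. t 0 = 0 \<and> t n = 1 \<and>
     (\<forall>i<n. t i < t (Suc i) \<and> (\<exists>c\<in>A. \<exists>D. C1_piece c \<gamma> (t i) (t (Suc i)) D)))"
  unfolding piecewise_C1_path_def C1_piece_def by (simp add: bex_simps)

locale riemannian =
  fixes A :: "('a::metric_space, 'e::euclidean_space) chart set" and g :: "('a, 'e) metric_tensor"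
  assumes atlas: "smooth_atlas A" and metric: "riemannian_metric A g"
begin

lemma chart: "c \<in> A \<Longrightarrow> is_chart c" and chart_covers: "\<exists>c\<in>A. x \<in> fst c"
  using atlas unfolding smooth_atlas_def by blast+

lemma metric_nonneg:
  assumes "c \<in> A" "p \<in> fst c" shows "0 \<le> g c p v v"
proof (cases "v = 0")
  case True
  have "bilinear (g c p)" using metric assms unfolding riemannian_metric_def by blast
  then show ?thesis using True by (simp add: bilinear_lzero)
next
  case False
  then have "0 < g c p v v" using metric assms unfolding riemannian_metric_def by blast
  then show ?thesis by simp
qed

lemma path_speed_nonneg: "0 \<le> path_speed A g \<gamma> s"
proof -
  have "(SOME c. c \<in> A \<and> \<gamma> s \<in> fst c) \<in> A \<and> \<gamma> s \<in> fst (SOME c. c \<in> A \<and> \<gamma> s \<in> fst c)"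
    using chart_covers[of "\<gamma> s"] by (intro someI_ex[of "\<lambda>c. c \<in> A \<and> \<gamma> s \<in> fst c"]) blast
  then show ?thesis unfolding path_speed_def Let_def by (simp add: metric_nonneg)
qed

text \<open>\<open>path_speed\<close> picks some chart at each time, possibly another one at every
  \<open>s\<close>. The chain rule and the transformation law turn its value into the one in the
  fixed chart \<open>c\<close>. Endpoints are excluded because the two-sided derivative may fail to
  exist there.\<close>

lemma path_speed_eq:
  assumes c: "c \<in> A" and \<gamma>: "C1_piece c \<gamma> a b D" and s: "s \<in> {a<..<b}"
  shows "path_speed A g \<gamma> s = sqrt (g c (\<gamma> s) (D s) (D s))"
proof -
  define c' where "c' = (SOME c. c \<in> A \<and> \<gamma> s \<in> fst c)"
  have c': "c' \<in> A" "\<gamma> s \<in> fst c'"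
    using someI_ex[of "\<lambda>c. c \<in> A \<and> \<gamma> s \<in> fst c"] chart_covers[of "\<gamma> s"] unfolding c'_def by blast+
  have sc: "\<gamma> u \<in> fst c" if "u \<in> {a<..<b}" for u
    using \<gamma> that unfolding C1_piece_def by force
  let ?T = "transition c c'" and ?y = "snd c (\<gamma> s)"
  have "Ck_on (Suc 0) (snd c ` (fst c \<inter> fst c')) ?T"
    using atlas c c'(1) unfolding smooth_atlas_def smooth_on_def by blast
  moreover have "?y \<in> snd c ` (fst c \<inter> fst c')" using c'(2) sc[OF s] by blast
  ultimately have "?T differentiable (at ?y)" unfolding Ck_on.simps by blast
  then have T: "(?T has_derivative frechet_derivative ?T (at ?y)) (at ?y)"
    by (simp add: frechet_derivative_works)
  have "((snd c \<circ> \<gamma>) has_vector_derivative D s) (at s within {a..b})"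
    using \<gamma> s unfolding C1_piece_def by (simp add: less_imp_le)
  then have "((snd c \<circ> \<gamma>) has_derivative (\<lambda>h. h *\<^sub>R D s)) (at s)"
    using s at_within_Icc_at[of a s b] by (simp add: has_vector_derivative_def)
  then have "((\<lambda>u. ?T ((snd c \<circ> \<gamma>) u)) has_derivative (\<lambda>h. frechet_derivative ?T (at ?y) (h *\<^sub>R D s))) (at s)"
    by (rule has_derivative_compose) (use T in simp)
  moreover have "linear (frechet_derivative ?T (at ?y))"
    using T has_derivative_linear by blast
  ultimately have "((\<lambda>u. ?T ((snd c \<circ> \<gamma>) u)) has_vector_derivative frechet_derivative ?T (at ?y) (D s)) (at s)"
    unfolding has_vector_derivative_def by (simp add: linear_cmul)
  then have "((snd c' \<circ> \<gamma>) has_vector_derivative frechet_derivative ?T (at ?y) (D s)) (at s)"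
  proof (rule has_vector_derivative_transform_within_open[where S = "{a<..<b}"])
    fix u assume "u \<in> {a<..<b}"
    then show "?T ((snd c \<circ> \<gamma>) u) = (snd c' \<circ> \<gamma>) u"
      using chart_simps(5)[OF chart[OF c] sc] by (simp add: transition_def)
  qed (use s in auto)
  then have "vector_derivative (snd c' \<circ> \<gamma>) (at s) = frechet_derivative ?T (at ?y) (D s)"
    by (rule vector_derivative_at)
  moreover have "g c (\<gamma> s) (D s) (D s) =
      g c' (\<gamma> s) (frechet_derivative ?T (at ?y) (D s)) (frechet_derivative ?T (at ?y) (D s))"
    using metric c c' sc[OF s] unfolding riemannian_metric_def by blast
  ultimately show ?thesis unfolding path_speed_def Let_def c'_def[symmetric] by simp
qed

lemma continuous_on_piece_speed:
  assumes c: "c \<in> A" and \<gamma>: "C1_piece c \<gamma> a b D"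
  shows "continuous_on {a..b} (\<lambda>s. sqrt (g c (\<gamma> s) (D s) (D s)))"
proof -
  have sc: "\<gamma> s \<in> fst c" if "s \<in> {a..b}" for s using \<gamma> that unfolding C1_piece_def by blast
  have cD: "continuous_on {a..b} D" using \<gamma> unfolding C1_piece_def by blast
  have "continuous_on {a..b} (snd c \<circ> \<gamma>)"
    using \<gamma> unfolding C1_piece_def continuous_on_eq_continuous_within
    by (blast intro: has_vector_derivative_continuous)
  then have cu: "continuous_on {a..b} (\<lambda>s. snd c (\<gamma> s))" by (simp add: o_def)
  have coord: "continuous_on {a..b} (\<lambda>s. g c (\<gamma> s) u v)" for u v
  proof -
    have "Ck_on 0 (snd c ` fst c) (\<lambda>y. g c (chart_inv c y) u v)"
      using metric c unfolding riemannian_metric_def smooth_on_def by blast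
    then have "continuous_on {a..b} (\<lambda>s. g c (chart_inv c (snd c (\<gamma> s))) u v)"
      using sc by (intro continuous_on_compose2[OF _ cu, of "snd c ` fst c" "\<lambda>y. g c (chart_inv c y) u v"]) auto
    then show ?thesis
      by (rule continuous_on_eq) (simp add: chart_simps(5)[OF chart[OF c] sc])
  qed
  \<comment> \<open>Smoothness of the metric is given for fixed vectors \<open>u\<close> and
    \<open>v\<close> only; expanding \<open>D s\<close> in the basis reduces the varying vector to
    such entries.\<close>
  have expand: "g c (\<gamma> s) (D s) (D s) =
      (\<Sum>(i,j)\<in>Basis \<times> Basis. (D s \<bullet> i) * (D s \<bullet> j) * g c (\<gamma> s) i j)" if "s \<in> {a..b}" for s
  proof -
    have b: "bilinear (g c (\<gamma> s))"
      using metric c sc[OF that] unfolding riemannian_metric_def by blast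
    have "g c (\<gamma> s) (D s) (D s) = g c (\<gamma> s) (\<Sum>i\<in>Basis. (D s \<bullet> i) *\<^sub>R i) (\<Sum>j\<in>Basis. (D s \<bullet> j) *\<^sub>R j)"
      by (simp only: euclidean_representation)
    also have "\<dots> = (\<Sum>(i,j)\<in>Basis \<times> Basis. g c (\<gamma> s) ((D s \<bullet> i) *\<^sub>R i) ((D s \<bullet> j) *\<^sub>R j))"
      by (rule bilinear_sum[OF b])
    also have "\<dots> = (\<Sum>(i,j)\<in>Basis \<times> Basis. (D s \<bullet> i) * (D s \<bullet> j) * g c (\<gamma> s) i j)"
      by (intro sum.cong refl) (simp add: case_prod_beta bilinear_lmul[OF b] bilinear_rmul[OF b] mult_ac)
    finally show ?thesis .
  qed
  have "continuous_on {a..b} (\<lambda>s. \<Sum>(i,j)\<in>Basis \<times> Basis. (D s \<bullet> i) * (D s \<bullet> j) * g c (\<gamma> s) i j)"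
    unfolding case_prod_beta by (intro continuous_intros coord cD)
  then have "continuous_on {a..b} (\<lambda>s. g c (\<gamma> s) (D s) (D s))"
    by (rule continuous_on_eq) (rule expand[symmetric])
  then show ?thesis by (intro continuous_intros)
qed

lemma path_speed_piece_integral:
  assumes c: "c \<in> A" and \<gamma>: "C1_piece c \<gamma> a b D"
  shows "(path_speed A g \<gamma> has_integral integral {a..b} (\<lambda>s. sqrt (g c (\<gamma> s) (D s) (D s)))) {a..b}"
proof (rule has_integral_spike_finite[where S = "{a,b}"])
  show "((\<lambda>s. sqrt (g c (\<gamma> s) (D s) (D s))) has_integral
      integral {a..b} (\<lambda>s. sqrt (g c (\<gamma> s) (D s) (D s)))) {a..b}"
    using continuous_on_piece_speed[OF c \<gamma>] by (intro integrable_integral integrable_continuous_real)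
  fix s assume "s \<in> {a..b} - {a, b}"
  then show "path_speed A g \<gamma> s = sqrt (g c (\<gamma> s) (D s) (D s))"
    by (intro path_speed_eq[OF c \<gamma>]) auto
qed simp

text \<open>Bounds the lengths from below, so that the real infimum in \<open>geodesic_dist\<close>
  obeys its usual laws. A speed that is not integrable has integral 0 by convention.\<close>

lemma path_len_nonneg: "0 \<le> path_len A g \<gamma>"
proof (cases "path_speed A g \<gamma> integrable_on {0..1}")
  case True
  then show ?thesis unfolding path_len_def by (intro integral_nonneg) (auto simp: path_speed_nonneg)
qed (simp add: path_len_def not_integrable_integral)

lemma geodesic_dist_le:
  assumes "piecewise_C1_path A \<gamma>" "pathstart \<gamma> = x" "pathfinish \<gamma> = y"
  shows "geodesic_dist A g x y \<le> path_len A g \<gamma>"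
  unfolding geodesic_dist_def
proof (rule cInf_lower)
  show "bdd_below {path_len A g \<gamma> |\<gamma>. piecewise_C1_path A \<gamma> \<and> pathstart \<gamma> = x \<and> pathfinish \<gamma> = y}"
    by (rule bdd_belowI[of _ 0]) (auto simp: path_len_nonneg)
qed (use assms in blast)

lemma C1_piece_continuous:
  assumes c: "c \<in> A" and \<gamma>: "C1_piece c \<gamma> a b D"
  shows "continuous_on {a..b} \<gamma>"
proof -
  have sc: "\<gamma> s \<in> fst c" if "s \<in> {a..b}" for s using \<gamma> that unfolding C1_piece_def by blast
  have "continuous_on {a..b} (snd c \<circ> \<gamma>)"
    using \<gamma> unfolding C1_piece_def continuous_on_eq_continuous_within
    by (blast intro: has_vector_derivative_continuous)
  then have "continuous_on {a..b} (\<lambda>s. chart_inv c ((snd c \<circ> \<gamma>) s))"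
    using sc by (intro continuous_on_compose2[OF chart_simps(4)[OF chart[OF c]]]) auto
  then show ?thesis
    by (rule continuous_on_eq) (simp add: chart_simps(5)[OF chart[OF c] sc])
qed

lemma geodesic_dist_le_piece:
  assumes c: "c \<in> A" and \<gamma>: "C1_piece c \<gamma> a b D" and uv: "a \<le> u" "u < v" "v \<le> b"
  shows "geodesic_dist A g (\<gamma> u) (\<gamma> v) \<le> integral {u..v} (path_speed A g \<gamma>)"
proof -
  \<comment> \<open>\<open>geodesic_dist\<close> compares paths on \<open>{0..1}\<close>, so the
    part of \<open>\<gamma>\<close> over \<open>{u..v}\<close> is reparametrised affinely. The
    factor \<open>v - u\<close> gained by the speed cancels against the change of variables.\<close>
  define \<sigma> where "\<sigma> = (\<lambda>s. \<gamma> ((v - u) * s + u))"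
  define D' where "D' = (\<lambda>s. (v - u) *\<^sub>R D ((v - u) * s + u))"
  have \<sigma>: "C1_piece c \<sigma> 0 1 D'"
    unfolding \<sigma>_def D'_def using uv by (intro C1_piece_affine[OF \<gamma>]) auto
  have \<gamma>': "C1_piece c \<gamma> u v D"
    using C1_piece_affine[OF \<gamma>, of 1 u 0 v] uv by simp
  have "path \<sigma>" unfolding path_def by (rule C1_piece_continuous[OF c \<sigma>])
  then have "piecewise_C1_path A \<sigma>"
    unfolding piecewise_C1_path_iff using c \<sigma>
    by (intro conjI exI[of _ "Suc 0"] exI[of _ real]) auto
  then have "geodesic_dist A g (\<gamma> u) (\<gamma> v) \<le> path_len A g \<sigma>"
    by (rule geodesic_dist_le) (simp_all add: \<sigma>_def pathstart_def pathfinish_def)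
  also have "path_len A g \<sigma> = integral {0..1} (\<lambda>s. sqrt (g c (\<sigma> s) (D' s) (D' s)))"
    unfolding path_len_def using path_speed_piece_integral[OF c \<sigma>] by (rule integral_unique)
  also have "\<dots> = integral {0..1} (\<lambda>s. (v - u) * path_speed A g \<gamma> ((v - u) * s + u))"
  proof (rule integral_spike[where S = "{0,1}"])
    fix s :: real assume s: "s \<in> {0..1} - {0, 1}"
    have "(v - u) * s < (v - u) * 1" "0 < (v - u) * s"
      using s uv(2) by (auto intro!: mult_strict_left_mono)
    then have "(v - u) * s + u \<in> {u<..<v}" by simp
    then have "path_speed A g \<gamma> ((v - u) * s + u) = sqrt (g c (\<sigma> s) (D ((v - u) * s + u)) (D ((v - u) * s + u)))"
      unfolding \<sigma>_def by (rule path_speed_eq[OF c \<gamma>'])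
    moreover have "bilinear (g c (\<sigma> s))"
    proof -
      have "\<sigma> s \<in> fst c" using \<sigma> s unfolding C1_piece_def by auto
      then show ?thesis using metric c unfolding riemannian_metric_def by blast
    qed
    then have "g c (\<sigma> s) (D' s) (D' s) = (v - u)\<^sup>2 * g c (\<sigma> s) (D ((v - u) * s + u)) (D ((v - u) * s + u))"
      by (simp add: D'_def bilinear_lmul bilinear_rmul power2_eq_square)
    ultimately show "(v - u) * path_speed A g \<gamma> ((v - u) * s + u) = sqrt (g c (\<sigma> s) (D' s) (D' s))"
      using uv(2) by (simp add: real_sqrt_mult)
  qed simp
  also have "\<dots> = integral {u..v} (path_speed A g \<gamma>)"
  proof -
    have "(path_speed A g \<gamma> has_integral integral {u..v} (path_speed A g \<gamma>)) (cbox u v)"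
      using has_integral_integrable_integral path_speed_piece_integral[OF c \<gamma>'] by (auto simp: integral_unique)
    from has_integral_affinity[OF this, of "v - u" u]
    have "((\<lambda>s. path_speed A g \<gamma> ((v - u) * s + u)) has_integral (1 / (v - u)) * integral {u..v} (path_speed A g \<gamma>))
        ((\<lambda>s. (1 / (v - u)) * s + - ((1 / (v - u)) * u)) ` {u..v})"
      using uv(2) by simp
    moreover have "(\<lambda>s. (1 / (v - u)) * s + - ((1 / (v - u)) * u)) ` {u..v} = {0..1}"
    proof -
      have "{(1 / (v - u)) * u + - ((1 / (v - u)) * u) .. (1 / (v - u)) * v + - ((1 / (v - u)) * u)} = {0..1}"
        using uv(2) by (simp add: diff_divide_distrib[symmetric])
      then show ?thesis using uv(2) by (subst image_affinity_atLeastAtMost) auto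
    qed
    ultimately have "((\<lambda>s. path_speed A g \<gamma> ((v - u) * s + u)) has_integral
        (1 / (v - u)) * integral {u..v} (path_speed A g \<gamma>)) {0..1}" by simp
    from has_integral_mult_right[OF this, of "v - u"] show ?thesis
      using uv(2) by (intro integral_unique) simp
  qed
  finally show ?thesis .
qed

end

section \<open>Distances along paths and short connections\<close>

locale intrinsic_riemannian = riemannian A g
  for A :: "('a::metric_space, 'e::euclidean_space) chart set" and g :: "('a, 'e) metric_tensor" +
  assumes dist_eq: "dist x y = geodesic_dist A g x y" and connected_space: "connected (UNIV :: 'a set)"
begin

text \<open>An induction over the pieces: an interval crossing the breakpoint \<open>t k\<close> is
  split there, and the triangle inequality matches additivity of the integral. In this way only
  intervals within one C1 piece have to be treated as paths of their own.\<close>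

lemma dist_le_speed_integral:
  assumes \<gamma>: "piecewise_C1_path A \<gamma>"
  shows "path_speed A g \<gamma> integrable_on {0..1}"
    and "\<lbrakk>0 \<le> u; u \<le> v; v \<le> 1\<rbrakk> \<Longrightarrow> dist (\<gamma> u) (\<gamma> v) \<le> integral {u..v} (path_speed A g \<gamma>)"
proof -
  let ?f = "path_speed A g \<gamma>"
  obtain n and t :: "nat \<Rightarrow> real" where t: "t 0 = 0" "t n = 1"
    "\<And>i. i < n \<Longrightarrow> t i < t (Suc i)" "\<And>i. i < n \<Longrightarrow> \<exists>c\<in>A. \<exists>D. C1_piece c \<gamma> (t i) (t (Suc i)) D"
    using \<gamma> unfolding piecewise_C1_path_iff by blast
  have "k \<le> n \<Longrightarrow> 0 \<le> t k \<and> ?f integrable_on {0..t k} \<and>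
      (\<forall>u v. 0 \<le> u \<longrightarrow> u \<le> v \<longrightarrow> v \<le> t k \<longrightarrow> dist (\<gamma> u) (\<gamma> v) \<le> integral {u..v} ?f)" for k
  proof (induction k)
    case 0
    have "dist (\<gamma> u) (\<gamma> v) \<le> integral {u..v} ?f" if "0 \<le> u" "u \<le> v" "v \<le> 0" for u v :: real
    proof -
      have "u = v" using that by simp
      then show ?thesis by simp
    qed
    moreover have "?f integrable_on {0..0}"
      using integrable_on_refl[of ?f 0] by (simp only: box_real)
    ultimately show ?case unfolding t(1) by blast
  next
    case (Suc k)
    then have k: "k < n" and IH: "0 \<le> t k" "?f integrable_on {0..t k}"
      "\<And>u v. 0 \<le> u \<Longrightarrow> u \<le> v \<Longrightarrow> v \<le> t k \<Longrightarrow> dist (\<gamma> u) (\<gamma> v) \<le> integral {u..v} ?f" by auto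
    obtain c D where c: "c \<in> A" "C1_piece c \<gamma> (t k) (t (Suc k)) D" using t(4)[OF k] by blast
    have "?f integrable_on {t k..t (Suc k)}"
      using path_speed_piece_integral[OF c] by (rule has_integral_integrable)
    then have int: "?f integrable_on {0..t (Suc k)}"
      using t(3)[OF k] by (intro Henstock_Kurzweil_Integration.integrable_combine[OF IH(1) _ IH(2)]) auto
    have piece: "dist (\<gamma> u) (\<gamma> v) \<le> integral {u..v} ?f" if "t k \<le> u" "u \<le> v" "v \<le> t (Suc k)" for u v
    proof (cases "u = v")
      case False
      then show ?thesis using geodesic_dist_le_piece[OF c that(1) _ that(3)] that(2) by (simp add: dist_eq)
    qed simp
    have "dist (\<gamma> u) (\<gamma> v) \<le> integral {u..v} ?f" if uv: "0 \<le> u" "u \<le> v" "v \<le> t (Suc k)" for u v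
    proof -
      consider "v \<le> t k" | "t k \<le> u" | "u < t k" "t k < v" by linarith
      then show ?thesis
      proof cases
        case 1 then show ?thesis using IH(3) uv by blast
      next
        case 2 then show ?thesis using piece uv by blast
      next
        case 3
        have "dist (\<gamma> u) (\<gamma> v) \<le> dist (\<gamma> u) (\<gamma> (t k)) + dist (\<gamma> (t k)) (\<gamma> v)" by (rule dist_triangle)
        also have "\<dots> \<le> integral {u..t k} ?f + integral {t k..v} ?f"
          using 3 uv by (intro add_mono IH(3) piece) auto
        also have "\<dots> = integral {u..v} ?f"
        proof (rule Henstock_Kurzweil_Integration.integral_combine)
          show "?f integrable_on {u..v}" using uv by (intro integrable_on_subinterval[OF int]) auto
        qed (use 3 in auto)
        finally show ?thesis .
      qed
    qed
    moreover have "0 \<le> t (Suc k)" using IH(1) t(3)[OF k] by linarith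
    ultimately show ?case using int by blast
  qed
  from this[of n] show "?f integrable_on {0..1}"
    and "\<lbrakk>0 \<le> u; u \<le> v; v \<le> 1\<rbrakk> \<Longrightarrow> dist (\<gamma> u) (\<gamma> v) \<le> integral {u..v} ?f"
    using t(2) by auto
qed

lemma dist_on_path_le:
  assumes \<gamma>: "piecewise_C1_path A \<gamma>" and "p \<in> path_image \<gamma>" "q \<in> path_image \<gamma>"
  shows "dist p q \<le> path_len A g \<gamma>"
proof -
  have main: "dist (\<gamma> u) (\<gamma> v) \<le> path_len A g \<gamma>" if uv: "0 \<le> u" "u \<le> v" "v \<le> 1" for u v
  proof -
    note int = dist_le_speed_integral(1)[OF \<gamma>]
    have "dist (\<gamma> u) (\<gamma> v) \<le> integral {u..v} (path_speed A g \<gamma>)"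
      by (rule dist_le_speed_integral(2)[OF \<gamma> uv])
    also have "\<dots> \<le> integral {0..1} (path_speed A g \<gamma>)"
      using uv by (intro integral_subset_le integrable_on_subinterval[OF int] int) (auto simp: path_speed_nonneg)
    finally show ?thesis by (simp add: path_len_def)
  qed
  obtain u v where "u \<in> {0..1}" "v \<in> {0..1}" "p = \<gamma> u" "q = \<gamma> v"
    using assms(2,3) unfolding path_image_def by blast
  then show ?thesis using main[of u v] main[of v u] by (cases "u \<le> v") (auto simp: dist_commute)
qed

lemma piecewise_C1_path_append:
  assumes \<gamma>: "piecewise_C1_path A \<gamma>" "pathstart \<gamma> = x" "pathfinish \<gamma> = y"
    and c: "c \<in> A" and yz: "y \<in> fst c" "z \<in> fst c"
    and seg: "closed_segment (snd c y) (snd c z) \<subseteq> snd c ` fst c"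
  shows "\<exists>\<sigma>. piecewise_C1_path A \<sigma> \<and> pathstart \<sigma> = x \<and> pathfinish \<sigma> = z"
proof -
  note ch = chart[OF c]
  define l where "l = (\<lambda>s. chart_inv c (linepath (snd c y) (snd c z) s))"
  have lin: "linepath (snd c y) (snd c z) s \<in> snd c ` fst c" if "s \<in> {0..1}" for s
    using seg linepath_in_path[OF that] by blast
  have "((snd c \<circ> l) has_vector_derivative (snd c z - snd c y)) (at s within {0..1})" if s: "s \<in> {0..1}" for s
  proof (rule has_vector_derivative_transform[OF s])
    show "(linepath (snd c y) (snd c z) has_vector_derivative (snd c z - snd c y)) (at s within {0..1})"
      by (rule has_vector_derivative_linepath_within)
  qed (use chart_simps(6)[OF ch] lin in \<open>simp add: l_def\<close>)
  moreover have "l ` {0..1} \<subseteq> fst c" using lin chart_simps(7)[OF ch] unfolding l_def by blast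
  ultimately have l: "C1_piece c l 0 1 (\<lambda>s. snd c z - snd c y)"
    unfolding C1_piece_def by (auto intro: continuous_intros)
  have l01: "l 0 = y" "l 1 = z" using chart_simps(5)[OF ch] yz by (auto simp: l_def linepath_def)
  have "path l" unfolding path_def by (rule C1_piece_continuous[OF c l])
  define \<sigma> where "\<sigma> = \<gamma> +++ l"
  have "path \<sigma>"
    unfolding \<sigma>_def using \<gamma> \<open>path l\<close> l01
    by (intro path_join_imp) (auto simp: piecewise_C1_path_def pathstart_def)
  obtain n and t :: "nat \<Rightarrow> real" where t: "t 0 = 0" "t n = 1"
    "\<And>i. i < n \<Longrightarrow> t i < t (Suc i)" "\<And>i. i < n \<Longrightarrow> \<exists>c\<in>A. \<exists>D. C1_piece c \<gamma> (t i) (t (Suc i)) D"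
    using \<gamma>(1) unfolding piecewise_C1_path_iff by blast
  have tle: "t i \<le> 1" if "i \<le> n" for i
  proof -
    have "t i \<le> t n"
      using that by (induction rule: inc_induct) (use t(3) in \<open>auto intro: less_imp_le order_trans\<close>)
    then show ?thesis using t(2) by simp
  qed
  \<comment> \<open>\<open>+++\<close> runs through \<open>\<gamma>\<close> at double speed on the
    first half, so the old subdivision is halved; the one new piece is the second half.\<close>
  define t' where "t' = (\<lambda>i. if i \<le> n then t i / 2 else 1)"
  have "t' i < t' (Suc i) \<and> (\<exists>c\<in>A. \<exists>D. C1_piece c \<sigma> (t' i) (t' (Suc i)) D)" if i: "i < Suc n" for i
  proof (cases "i = n")
    case True
    have "C1_piece c (\<lambda>s. l (2 * s + (-1))) (1/2) 1 (\<lambda>s. 2 *\<^sub>R (snd c z - snd c y))"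
      by (rule C1_piece_affine[OF l]) auto
    then have "C1_piece c \<sigma> (1/2) 1 (\<lambda>s. 2 *\<^sub>R (snd c z - snd c y))"
    proof (rule C1_piece_cong)
      fix s :: real assume s: "s \<in> {1/2..1}"
      show "\<sigma> s = l (2 * s + (-1))"
      \<comment> \<open>At the junction \<open>+++\<close> takes its value from
        \<open>\<gamma>\<close>; it agrees with \<open>l 0\<close> because the ends meet.\<close>
      proof (cases "s = 1/2")
        case True
        then show ?thesis using \<gamma>(3) l01 unfolding True by (simp add: \<sigma>_def joinpaths_def pathfinish_def)
      next
        case False
        then show ?thesis using s by (simp add: \<sigma>_def joinpaths_def)
      qed
    qed
    then show ?thesis using True t(2) c by (auto simp: t'_def)
  next
    case False
    then have i: "i < n" using i by simp
    obtain d D where d: "d \<in> A" "C1_piece d \<gamma> (t i) (t (Suc i)) D" using t(4)[OF i] by blast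
    have "C1_piece d (\<lambda>s. \<gamma> (2 * s + 0)) (t i / 2) (t (Suc i) / 2) (\<lambda>s. 2 *\<^sub>R D (2 * s + 0))"
      by (rule C1_piece_affine[OF d(2)]) auto
    then have "C1_piece d \<sigma> (t i / 2) (t (Suc i) / 2) (\<lambda>s. 2 *\<^sub>R D (2 * s + 0))"
    proof (rule C1_piece_cong)
      fix s assume "s \<in> {t i / 2..t (Suc i) / 2}"
      then have "s \<le> 1/2" using tle[of "Suc i"] i by auto
      then show "\<sigma> s = \<gamma> (2 * s + 0)" by (simp add: \<sigma>_def joinpaths_def)
    qed
    then show ?thesis using i t(3)[OF i] d(1) by (auto simp: t'_def)
  qed
  moreover have "t' 0 = 0" "t' (Suc n) = 1" using t(1) by (auto simp: t'_def)
  ultimately have "piecewise_C1_path A \<sigma>"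
    unfolding piecewise_C1_path_iff using \<open>path \<sigma>\<close> by blast
  moreover have "pathstart \<sigma> = x" using \<gamma>(2) by (simp add: \<sigma>_def)
  moreover have "pathfinish l = z" using l01(2) by (simp add: pathfinish_def)
  then have "pathfinish \<sigma> = z" by (simp add: \<sigma>_def)
  ultimately show ?thesis by blast
qed

text \<open>Makes the infimum in \<open>geodesic_dist\<close> range over a nonempty set, without
  which a small distance would yield no path. Reachability from \<open>x\<close> spreads through
  coordinate balls, and the space is connected.\<close>

lemma piecewise_C1_path_exists:
  fixes x y :: 'a
  shows "\<exists>\<gamma>. piecewise_C1_path A \<gamma> \<and> pathstart \<gamma> = x \<and> pathfinish \<gamma> = y"
proof (rule connected_induction_simple[OF connected_space, where a = x and b = y])
  obtain c where c: "c \<in> A" "x \<in> fst c" using chart_covers by blast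
  have "C1_piece c (\<lambda>_. x) 0 1 (\<lambda>_. 0)" using c(2) by (auto simp: C1_piece_def o_def)
  then show "\<exists>\<gamma>. piecewise_C1_path A \<gamma> \<and> pathstart \<gamma> = x \<and> pathfinish \<gamma> = x"
    unfolding piecewise_C1_path_iff using c(1)
    by (intro exI[of _ "\<lambda>_. x"] conjI exI[of _ "Suc 0"] exI[of _ real]) (auto simp: path_def pathstart_def pathfinish_def)
next
  fix a :: 'a
  obtain c where c: "c \<in> A" "a \<in> fst c" using chart_covers by blast
  note ch = chart[OF c(1)]
  obtain \<rho> where \<rho>: "0 < \<rho>" "cball (snd c a) \<rho> \<subseteq> snd c ` (fst c \<inter> UNIV)"
    using chart_cball[OF ch open_UNIV UNIV_I c(2)] by blast
  have sub: "ball (snd c a) \<rho> \<subseteq> snd c ` fst c" using \<rho>(2) ball_subset_cball by auto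
  define T where "T = chart_inv c ` ball (snd c a) \<rho>"
  have T: "T = {x \<in> fst c. snd c x \<in> ball (snd c a) \<rho>}"
    unfolding T_def by (rule chart_inv_image_eq[OF ch sub])
  have link: "\<exists>\<gamma>. piecewise_C1_path A \<gamma> \<and> pathstart \<gamma> = x \<and> pathfinish \<gamma> = z"
    if y: "y \<in> T" and z: "z \<in> T" and ex: "\<exists>\<gamma>. piecewise_C1_path A \<gamma> \<and> pathstart \<gamma> = x \<and> pathfinish \<gamma> = y" for y z
  proof -
    have "closed_segment (snd c y) (snd c z) \<subseteq> ball (snd c a) \<rho>"
      using y z by (intro closed_segment_subset) (auto simp: T)
    then have seg: "closed_segment (snd c y) (snd c z) \<subseteq> snd c ` fst c" using sub by blast
    have yz: "y \<in> fst c" "z \<in> fst c" using y z by (auto simp: T)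
    obtain \<gamma> where "piecewise_C1_path A \<gamma>" "pathstart \<gamma> = x" "pathfinish \<gamma> = y" using ex by blast
    then show ?thesis by (rule piecewise_C1_path_append[OF _ _ _ c(1) yz seg])
  qed
  have "open T" unfolding T_def by (rule open_chart_inv_image[OF ch open_ball sub])
  then have opT: "openin (top_of_set UNIV) T" by simp
  have aT: "a \<in> T" using c(2) \<rho>(1) by (simp add: T)
  show "\<exists>T. openin (top_of_set UNIV) T \<and> a \<in> T \<and> (\<forall>y\<in>T. \<forall>z\<in>T.
      (\<exists>\<gamma>. piecewise_C1_path A \<gamma> \<and> pathstart \<gamma> = x \<and> pathfinish \<gamma> = y) \<longrightarrow>
      (\<exists>\<gamma>. piecewise_C1_path A \<gamma> \<and> pathstart \<gamma> = x \<and> pathfinish \<gamma> = z))"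
    by (intro exI[of _ T] conjI ballI impI opT aT) (rule link)
qed auto

text \<open>An almost shortest path does it: distances between its points are bounded by its length.
  After this the metric tensor is not consulted again.\<close>

lemma short_connected_set:
  fixes x y :: 'a
  assumes "dist x y < r"
  shows "\<exists>C. connected C \<and> x \<in> C \<and> y \<in> C \<and> (\<forall>p\<in>C. \<forall>q\<in>C. dist p q < r)"
proof -
  let ?S = "{path_len A g \<gamma> |\<gamma>. piecewise_C1_path A \<gamma> \<and> pathstart \<gamma> = x \<and> pathfinish \<gamma> = y}"
  have "?S \<noteq> {}" using piecewise_C1_path_exists[of x y] by blast
  moreover have "Inf ?S < r" using assms by (simp add: dist_eq geodesic_dist_def)
  ultimately have "\<exists>l\<in>?S. l < r" by (rule cInf_lessD)
  then obtain \<gamma> where \<gamma>: "piecewise_C1_path A \<gamma>" "pathstart \<gamma> = x" "pathfinish \<gamma> = y" "path_len A g \<gamma> < r"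
    by blast
  have "connected (path_image \<gamma>)"
    using \<gamma>(1) by (intro connected_path_image) (simp add: piecewise_C1_path_def)
  moreover have "x \<in> path_image \<gamma>" "y \<in> path_image \<gamma>" using \<gamma>(2,3) by auto
  moreover have "dist p q < r" if "p \<in> path_image \<gamma>" "q \<in> path_image \<gamma>" for p q
    using dist_on_path_le[OF \<gamma>(1) that] \<gamma>(4) by simp
  ultimately show ?thesis by blast
qed

end

section \<open>Moving cells along disjoint arcs\<close>

lemma disjoint_thickenings:
  fixes K :: "'i \<Rightarrow> 'a::metric_space set"
  assumes "finite I" "\<And>i. i \<in> I \<Longrightarrow> compact (K i)" "disjoint_family_on K I" and s: "0 < s"
  obtains \<kappa> where "0 < \<kappa>" "\<kappa> \<le> s" "disjoint_family_on (\<lambda>i. \<Union>x\<in>K i. ball x \<kappa>) I"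
proof -
  obtain \<kappa> where \<kappa>: "0 < \<kappa>"
    "\<And>i j x y. \<lbrakk>i \<in> I; j \<in> I; i \<noteq> j; x \<in> K i; y \<in> K j\<rbrakk> \<Longrightarrow> \<kappa> \<le> dist x y"
    using disjoint_compacts_separated[OF assms(1-3)] by blast
  let ?k = "min s (\<kappa>/2)"
  have "disjoint_family_on (\<lambda>i. \<Union>x\<in>K i. ball x ?k) I"
    unfolding disjoint_family_on_def
  proof (intro ballI impI)
    fix i j assume ij: "i \<in> I" "j \<in> I" "i \<noteq> j"
    have False if p: "x \<in> K i" "p \<in> ball x ?k" "y \<in> K j" "p \<in> ball y ?k" for x y p
    proof -
      have "dist x y < \<kappa>" using dist_triangle2[of x y p] p(2,4) by (simp add: min_def split: if_splits)
      then show False using \<kappa>(2)[OF ij p(1,3)] by simp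
    qed
    then show "(\<Union>x\<in>K i. ball x ?k) \<inter> (\<Union>x\<in>K j. ball x ?k) = {}" by blast
  qed
  then show ?thesis using that[of ?k] \<kappa>(1) s by simp
qed

lemma thickening_dist_less:
  assumes "\<And>x y. x \<in> K \<Longrightarrow> y \<in> K \<Longrightarrow> dist x y < d"
    and "p \<in> (\<Union>x\<in>K. ball x \<kappa>)" "q \<in> (\<Union>x\<in>K. ball x \<kappa>)"
  shows "dist p q < d + 2 * \<kappa>"
proof -
  obtain x y where xy: "x \<in> K" "y \<in> K" "dist x p < \<kappa>" "dist y q < \<kappa>" using assms(2,3) by auto
  have "dist p q \<le> dist x p + dist x y + dist y q"
    using dist_triangle[of p q x] dist_triangle[of x q y] by (simp add: dist_commute)
  then show ?thesis using assms(1)[OF xy(1,2)] xy(3,4) by simp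
qed

locale length_manifold = manifold A
  for A :: "('a::metric_space, 'e::euclidean_space) chart set" +
  assumes dim: "3 \<le> DIM('e)" and compact_space: "compact (UNIV :: 'a set)"
    and connected_space: "connected (UNIV :: 'a set)"
    and short_connected: "\<And>(x::'a) y r. dist x y < r \<Longrightarrow>
      \<exists>C. connected C \<and> x \<in> C \<and> y \<in> C \<and> (\<forall>p\<in>C. \<forall>q\<in>C. dist p q < r)"
begin

lemma connected_ball: "connected (ball (x::'a) r)"
proof -
  have "\<exists>C. connected C \<and> C \<subseteq> ball x r \<and> x \<in> C \<and> y \<in> C" if y: "y \<in> ball x r" for y
  proof -
    have "dist x y < r" using y by simp
    then obtain C where C: "connected C" "x \<in> C" "y \<in> C" "\<forall>p\<in>C. \<forall>q\<in>C. dist p q < r"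
      using short_connected by blast
    moreover have "C \<subseteq> ball x r" using C(2,4) by auto
    ultimately show ?thesis by blast
  qed
  then have "\<forall>y\<in>ball x r. connected_component (ball x r) x y"
    unfolding connected_component_def by blast
  then show ?thesis
    unfolding connected_iff_connected_component
    by (meson connected_component_sym connected_component_trans)
qed

lemma connected_thickening:
  fixes C :: "'a set"
  assumes C: "connected C" and \<kappa>: "0 < \<kappa>"
  shows "connected (\<Union>x\<in>C. ball x \<kappa>)"
proof (cases "C = {}")
  case False
  have "connected (\<Union>((\<lambda>x. ball x \<kappa> \<union> C) ` C))"
  proof (rule connected_Union)
    fix S assume "S \<in> (\<lambda>x. ball x \<kappa> \<union> C) ` C"
    then obtain x where x: "x \<in> C" "S = ball x \<kappa> \<union> C" by blast
    have "x \<in> ball x \<kappa> \<inter> C" using x(1) \<kappa> by simp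
    then show "connected S"
      unfolding x(2) by (intro connected_Un connected_ball C) blast
  qed (use False in blast)
  moreover have "\<Union>((\<lambda>x. ball x \<kappa> \<union> C) ` C) = (\<Union>x\<in>C. ball x \<kappa>)"
    using \<kappa> by (auto simp: Bex_def)
  ultimately show ?thesis by simp
qed simp

text \<open>Arcs are chosen one after the other. Each new arc lives in a thin neighbourhood of an almost
  shortest connection, from which the earlier arcs and the starting points of the others have been
  removed. What remains is connected because arcs are thin, which is where the dimension enters.\<close>

lemma disjoint_arcs:
  fixes b z :: "'i \<Rightarrow> 'a"
  assumes I: "finite I" "inj_on b I" and r: "\<And>i. i \<in> I \<Longrightarrow> dist (b i) (z i) < r" and \<eta>: "0 < \<eta>"
  shows "\<exists>p. (\<forall>i\<in>I. compact (p i) \<and> connected (p i) \<and> b i \<in> p i \<and>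
      p i \<inter> ball (z i) \<eta> \<noteq> {} \<and> (\<forall>x\<in>p i. \<forall>y\<in>p i. dist x y < r + \<eta>)) \<and>
    disjoint_family_on p I"
proof -
  \<comment> \<open>Besides the claim, the induction maintains thinness, so that later arcs can go
    around, and avoidance of the other starting points, including those whose arcs are still to
    come.\<close>
  let ?ok = "\<lambda>p i. compact (p i) \<and> connected (p i) \<and> thin (p i) \<and> b i \<in> p i \<and>
      p i \<inter> ball (z i) \<eta> \<noteq> {} \<and> (\<forall>x\<in>p i. \<forall>y\<in>p i. dist x y < r + \<eta>) \<and> (\<forall>j\<in>I-{i}. b j \<notin> p i)"
  have "\<exists>p. (\<forall>i\<in>J. ?ok p i) \<and> disjoint_family_on p J" if J: "J \<subseteq> I" for J
    using finite_subset[OF J I(1)] J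
  proof (induction J rule: finite_induct)
    case empty
    then show ?case by (simp add: disjoint_family_on_def)
  next
    case (insert j J)
    then obtain p where p: "\<forall>i\<in>J. ?ok p i" "disjoint_family_on p J" by auto
    have j: "j \<in> I" using insert.prems by simp
    obtain C where C: "connected C" "b j \<in> C" "z j \<in> C" "\<forall>x\<in>C. \<forall>y\<in>C. dist x y < r"
      using short_connected[OF r[OF j]] by blast
    define V where "V = (\<Union>x\<in>C. ball x (\<eta>/2))"
    define Z where "Z = (\<Union>i\<in>J. p i) \<union> (\<Union>i\<in>I-{j}. {b i})"
    have "thin Z"
      unfolding Z_def using p(1) insert.hyps(1) I(1) thin_singleton[OF dim]
      by (intro thin_Un thin_UN) auto
    then have clZ: "closed Z" unfolding thin_def by blast
    have V: "open V" "connected V"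
      unfolding V_def using connected_thickening[OF C(1)] \<eta> by auto
    have bV: "b j \<in> V" unfolding V_def using C(2) \<eta> by (intro UN_I[of "b j"]) auto
    have conV: "connected (V - Z)" and openV: "open (V - Z)"
      using \<open>thin Z\<close> V bV clZ unfolding thin_def by (blast, simp add: open_Diff)
    have bZ: "b j \<notin> Z"
    proof -
      have "b j \<notin> p i" if "i \<in> J" for i
        using p(1) that j insert.hyps(2) by (metis DiffI singletonD)
      moreover have "b j \<noteq> b i" if "i \<in> I - {j}" for i
        using I(2) j that by (auto dest: inj_onD)
      ultimately show ?thesis unfolding Z_def by blast
    qed
    \<comment> \<open>The target \<open>z j\<close> may itself lie on an earlier arc, in particular
      when targets coincide. A thin set cannot contain a ball, so a free endpoint \<open>y\<close>
      exists nearby.\<close>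
    have "ball (z j) (\<eta>/2) - Z \<noteq> {}"
    proof -
      have "z j \<in> ball (z j) (\<eta>/2)" using \<eta> by simp
      then show ?thesis
        using \<open>thin Z\<close> connected_ball[of "z j" "\<eta>/2"] unfolding thin_def by blast
    qed
    then obtain y where y: "y \<in> ball (z j) (\<eta>/2)" "y \<notin> Z" by blast
    then have yV: "y \<in> V - Z" "y \<in> ball (z j) \<eta>" using C(3) \<eta> unfolding V_def by auto
    obtain P where P: "compact P" "connected P" "thin P" "P \<subseteq> V - Z" "b j \<in> P" "y \<in> P"
      using thin_arc_exists[OF dim openV conV _ yV(1), of "b j"] bV bZ by blast
    have "dist x y < r + \<eta>" if "x \<in> P" "y \<in> P" for x y
    proof -
      have "x \<in> V" "y \<in> V" using that P(4) by auto
      then have "dist x y < r + 2 * (\<eta>/2)"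
        unfolding V_def by (rule thickening_dist_less[rotated]) (use C(4) in blast)
      then show ?thesis by simp
    qed
    then have new: "?ok (p(j := P)) j"
      using P yV(2) unfolding Z_def by auto
    have old: "?ok (p(j := P)) i" if "i \<in> J" for i
      using p(1) that insert.hyps(2) by (metis fun_upd_other)
    have "disjoint_family_on (p(j := P)) (insert j J)"
      unfolding disjoint_family_on_def
    proof (intro ballI impI)
      fix i k assume ik: "i \<in> insert j J" "k \<in> insert j J" "i \<noteq> k"
      have d: "P \<inter> p i = {}" if "i \<in> J" for i using P(4) that unfolding Z_def by blast
      have e: "p i \<inter> p k = {}" if "i \<in> J" "k \<in> J"
        using p(2) that ik(3) by (simp add: disjoint_family_on_def)
      show "(p(j := P)) i \<inter> (p(j := P)) k = {}"
        using ik d[of i] d[of k] e by (cases "i = j"; cases "k = j"; simp add: Int_commute)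
    qed
    then show ?case using new old by (intro exI[of _ "p(j := P)"]) blast
  qed
  from this[of I] obtain p where "\<forall>i\<in>I. ?ok p i" "disjoint_family_on p I" by blast
  then show ?thesis by blast
qed

text \<open>The map is \<open>h \<circ> q\<close>, where \<open>q\<close> squeezes every cell near
  its centre and \<open>h\<close> pushes the centres through disjoint tubes \<open>T i\<close>
  around the arcs. A tube may well cross foreign cells; by then \<open>q\<close> has moved those
  into their own tubes. The displacement is at most that of \<open>q\<close>, below
  \<open>d + 2 * \<eta>\<close>, plus that of \<open>h\<close>, below
  \<open>r + 3 * \<eta>\<close>.\<close>

lemma transport_cells:
  fixes B :: "'i \<Rightarrow> 'a set" and b z :: "'i \<Rightarrow> 'a"
  assumes I: "finite I" and cell: "\<And>i. i \<in> I \<Longrightarrow> convex_cell (B i) (b i)"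
    and dis: "disjoint_family_on B I"
    and d: "\<And>i x y. i \<in> I \<Longrightarrow> x \<in> B i \<Longrightarrow> y \<in> B i \<Longrightarrow> dist x y < d"
    and r: "\<And>i. i \<in> I \<Longrightarrow> dist (b i) (z i) < r" and pos: "0 < \<eta>" "0 \<le> d" "0 \<le> r"
  obtains h where "h \<in> homeos_homotopic_id" "\<And>i. i \<in> I \<Longrightarrow> h ` B i \<subseteq> ball (z i) \<eta>"
    "\<And>x. dist (h x) x < r + d + 5 * \<eta>"
proof -
  have bB: "b i \<in> B i" "compact (B i)" if "i \<in> I" for i
    using cell[OF that] by (auto simp: convex_cell_def)
  have inj: "inj_on b I"
  proof (rule inj_onI)
    fix i j assume ij: "i \<in> I" "j \<in> I" "b i = b j"
    then have "b i \<in> B i \<inter> B j" using bB(1)[OF ij(1)] bB(1)[OF ij(2)] by simp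
    then show "i = j" using dis ij by (auto simp: disjoint_family_on_def)
  qed
  obtain p where arcs: "\<forall>i\<in>I. compact (p i) \<and> connected (p i) \<and> b i \<in> p i \<and>
      p i \<inter> ball (z i) \<eta> \<noteq> {} \<and> (\<forall>x\<in>p i. \<forall>y\<in>p i. dist x y < r + \<eta>)"
    and disp: "disjoint_family_on p I"
    using disjoint_arcs[OF I inj r pos(1)] by blast
  note p = bspec[OF arcs]
  obtain \<kappa> where \<kappa>: "0 < \<kappa>" "\<kappa> \<le> \<eta>" "disjoint_family_on (\<lambda>i. \<Union>x\<in>p i. ball x \<kappa>) I"
    using disjoint_thickenings[OF I _ disp pos(1)] p(1) by blast
  define T where "T = (\<lambda>i. \<Union>x\<in>p i. ball x \<kappa>)"
  have T: "open (T i)" "connected (T i)" "p i \<subseteq> T i" if "i \<in> I" for i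
    unfolding T_def using connected_thickening[of "p i" \<kappa>] p(1)[OF that] \<kappa>(1) by auto
  have "\<exists>f\<in>supported_homeos (T i). f (b i) \<in> ball (z i) \<eta>" if i: "i \<in> I" for i
  proof -
    obtain y where y: "y \<in> p i" "y \<in> ball (z i) \<eta>" using p(1)[OF i] by blast
    then show ?thesis
      using supported_homeo_moving[OF T(1,2)[OF i], of "b i" y] T(3)[OF i] p(1)[OF i] by blast
  qed
  then obtain f where f: "\<And>i. i \<in> I \<Longrightarrow> f i \<in> supported_homeos (T i)"
    "\<And>i. i \<in> I \<Longrightarrow> f i (b i) \<in> ball (z i) \<eta>" by metis
  obtain h where h: "h \<in> supported_homeos (\<Union>i\<in>I. T i)" "\<forall>i\<in>I. \<forall>x\<in>T i. h x = f i x"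
    using supported_homeos_glue[of I T f] I \<kappa>(3) f(1) unfolding T_def by blast
  obtain \<kappa>' where \<kappa>': "0 < \<kappa>'" "\<kappa>' \<le> \<eta>" "disjoint_family_on (\<lambda>i. \<Union>x\<in>B i. ball x \<kappa>') I"
    using disjoint_thickenings[OF I _ dis pos(1)] bB(2) by blast
  define G where "G = (\<lambda>i. \<Union>x\<in>B i. ball x \<kappa>')"
  \<comment> \<open>The pushes \<open>f\<close> are fixed before the squeezing: by continuity a
    whole neighbourhood of \<open>b i\<close> follows \<open>b i\<close> into the target ball, and
    the cell is squeezed into it.\<close>
  have "\<exists>s\<in>supported_homeos (G i). s ` B i \<subseteq> T i \<inter> f i -` ball (z i) \<eta>" if i: "i \<in> I" for i
  proof -
    have "open (f i -` ball (z i) \<eta>)"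
      using supported_homeosD(3)[OF f(1)[OF i]] by (intro open_vimage) auto
    then have "open (T i \<inter> f i -` ball (z i) \<eta>)" using T(1)[OF i] by auto
    moreover have "b i \<in> T i \<inter> f i -` ball (z i) \<eta>" using f(2)[OF i] T(3)[OF i] p(1)[OF i] by auto
    moreover have "open (G i)" "B i \<subseteq> G i" unfolding G_def using \<kappa>'(1) by auto
    ultimately show ?thesis using cell[OF i] unfolding convex_cell_def by blast
  qed
  then obtain s where s: "\<And>i. i \<in> I \<Longrightarrow> s i \<in> supported_homeos (G i)"
    "\<And>i. i \<in> I \<Longrightarrow> s i ` B i \<subseteq> T i \<inter> f i -` ball (z i) \<eta>" by metis
  obtain q where q: "q \<in> supported_homeos (\<Union>i\<in>I. G i)" "\<forall>i\<in>I. \<forall>x\<in>G i. q x = s i x"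
    using supported_homeos_glue[of I G s] I \<kappa>'(3) s(1) unfolding G_def by blast
  have "q \<in> supported_homeos UNIV" "h \<in> supported_homeos UNIV"
    using h(1) q(1) supported_homeos_mono[OF subset_UNIV] by blast+
  then have 1: "h \<circ> q \<in> homeos_homotopic_id"
    using supported_homeos_comp supported_homeosD(1) by blast
  have 2: "(h \<circ> q) ` B i \<subseteq> ball (z i) \<eta>" if i: "i \<in> I" for i
  proof clarify
    fix x assume x: "x \<in> B i"
    then have "x \<in> G i" unfolding G_def using \<kappa>'(1) by force
    then have "q x \<in> T i" "f i (q x) \<in> ball (z i) \<eta>" using q(2) i s(2)[OF i] x by auto
    then show "(h \<circ> q) x \<in> ball (z i) \<eta>" using h(2) i by simp
  qed
  have dq: "dist (q x) x < d + 2 * \<eta>" for x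
  proof (cases "x \<in> (\<Union>i\<in>I. G i)")
    case True
    then obtain i where i: "i \<in> I" "x \<in> G i" by blast
    then have "q x \<in> G i" using q(2) supported_homeos_maps[OF s(1)] by metis
    then have "dist (q x) x < d + 2 * \<kappa>'"
      using thickening_dist_less[of "B i" d "q x" \<kappa>' x] d[OF i(1)] i(2) unfolding G_def by blast
    then show ?thesis using \<kappa>'(2) by simp
  next
    case False
    then show ?thesis using supported_homeosD(2)[OF q(1)] pos by simp
  qed
  have dh: "dist (h x) x < r + 3 * \<eta>" for x
  proof (cases "x \<in> (\<Union>i\<in>I. T i)")
    case True
    then obtain i where i: "i \<in> I" "x \<in> T i" by blast
    then have "h x \<in> T i" using h(2) supported_homeos_maps[OF f(1)] by metis
    then have "dist (h x) x < (r + \<eta>) + 2 * \<kappa>"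
      using thickening_dist_less[of "p i" "r + \<eta>" "h x" \<kappa> x] p(1)[OF i(1)] i(2) unfolding T_def by blast
    then show ?thesis using \<kappa>(2) by simp
  next
    case False
    then show ?thesis using supported_homeosD(2)[OF h(1)] pos by simp
  qed
  have 3: "dist ((h \<circ> q) x) x < r + d + 5 * \<eta>" for x
    using dist_triangle[of "h (q x)" x "q x"] dh[of "q x"] dq[of x] by simp
  show ?thesis using 1 2 3 by (rule that)
qed

end

section \<open>Balanced assignments\<close>

text \<open>An assignment minimizing the sum of the squared excesses works: an overloaded bin \<open>j\<^sub>0\<close> would
  force every bin reachable from it by reassigning items to be overloaded as well, which contradicts
  the Hall condition.\<close>

lemma balanced_assignment:
  fixes w :: "'k \<Rightarrow> real" and m :: "'j \<Rightarrow> real" and N :: "'k \<Rightarrow> 'j set" and \<tau> :: real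
  assumes fin: "finite K" "finite J"
    and w: "\<And>k. k \<in> K \<Longrightarrow> 0 \<le> w k" "\<And>k. k \<in> K \<Longrightarrow> w k \<le> \<tau>" and \<tau>: "0 \<le> \<tau>"
    and m: "\<And>j. j \<in> J \<Longrightarrow> 0 \<le> m j"
    and N: "\<And>k. k \<in> K \<Longrightarrow> N k \<subseteq> J" "\<And>k. k \<in> K \<Longrightarrow> N k \<noteq> {}"
    and Hall: "\<And>S. S \<subseteq> K \<Longrightarrow> sum w S \<le> sum m (\<Union>k\<in>S. N k)"
  obtains f where "\<And>k. k \<in> K \<Longrightarrow> f k \<in> N k"
    "\<And>j. j \<in> J \<Longrightarrow> sum w {k\<in>K. f k = j} \<le> m j + card J * \<tau>"
proof -
  define ex where "ex = (\<lambda>f j. sum w {k\<in>K. f k = j} - m j)"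
  define \<Phi> where "\<Phi> = (\<lambda>f. \<Sum>j\<in>J. (ex f j)\<^sup>2)"
  have "finite (Pi\<^sub>E K N)" "Pi\<^sub>E K N \<noteq> {}"
    using fin N by (auto intro!: finite_PiE simp: PiE_eq_empty_iff intro: finite_subset)
  note opt = arg_min_if_finite[OF this, of \<Phi>]
  define f where "f = arg_min_on \<Phi> (Pi\<^sub>E K N)"
  have f: "f \<in> Pi\<^sub>E K N" using opt(1) by (simp add: f_def)
  have min: "\<Phi> f \<le> \<Phi> f'" if "f' \<in> Pi\<^sub>E K N" for f'
    using opt(2) that unfolding f_def by (meson not_less)
  \<comment> \<open>Reassigning \<open>k\<close> to \<open>j'\<close> cannot lower
    \<open>\<Phi>\<close>. Expanding the squares and dividing by \<open>2 * w k\<close> gives the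
    inequality, whence the restriction to positive weights.\<close>
  have exchange: "ex f (f k) - \<tau> \<le> ex f j'" if k: "k \<in> K" "w k > 0" and j': "j' \<in> N k" for k j'
  proof (cases "j' = f k")
    case True then show ?thesis using \<tau> by simp
  next
    case False
    let ?j = "f k" and ?f' = "f(k := j')"
    have J: "?j \<in> J" "j' \<in> J" using f k j' N(1) by auto
    have "?f' \<in> Pi\<^sub>E K N" using f k j' by (auto simp: PiE_iff extensional_def)
    then have "\<Phi> f \<le> \<Phi> ?f'" by (rule min)
    moreover have "\<Phi> g = (ex g ?j)\<^sup>2 + ((ex g j')\<^sup>2 + (\<Sum>j\<in>J - {?j} - {j'}. (ex g j)\<^sup>2))" for g
      unfolding \<Phi>_def using J False fin(2)
      by (subst sum.remove[of J ?j], simp, simp, subst sum.remove[of "J - {f k}" j']) auto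
    moreover have "ex ?f' j = ex f j" if "j \<in> J - {?j} - {j'}" for j
    proof -
      have "{i\<in>K. ?f' i = j} = {i\<in>K. f i = j}" using that by auto
      then show ?thesis unfolding ex_def by simp
    qed
    moreover have "ex ?f' ?j = ex f ?j - w k"
    proof -
      have "{i\<in>K. ?f' i = ?j} = {i\<in>K. f i = ?j} - {k}" using False by auto
      moreover have "sum w ({i\<in>K. f i = ?j} - {k}) = sum w {i\<in>K. f i = ?j} - w k"
        using fin(1) k by (simp add: sum_diff1)
      ultimately show ?thesis unfolding ex_def by simp
    qed
    moreover have "ex ?f' j' = ex f j' + w k"
    proof -
      have "{i\<in>K. ?f' i = j'} = insert k {i\<in>K. f i = j'}" using k by auto
      then show ?thesis unfolding ex_def using fin(1) False by auto
    qed
    ultimately have "(ex f ?j)\<^sup>2 + (ex f j')\<^sup>2 \<le> (ex f ?j - w k)\<^sup>2 + (ex f j' + w k)\<^sup>2"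
      by simp
    then have "0 \<le> (2 * w k) * (ex f j' - ex f ?j + w k)"
      by (simp add: power2_eq_square algebra_simps)
    then have "0 \<le> ex f j' - ex f ?j + w k"
      using k(2) by (simp add: zero_le_mult_iff)
    then show ?thesis using w(2)[OF k(1)] by linarith
  qed
  have "ex f j0 \<le> card J * \<tau>" if j0: "j0 \<in> J" for j0
  proof (rule ccontr)
    assume over: "\<not> ex f j0 \<le> card J * \<tau>"
    \<comment> \<open>Levels of bins whose excess is at most \<open>i * \<tau>\<close> below that of
      \<open>j0\<close>. An increasing chain of nonempty subsets of \<open>J\<close> must stall
      before step \<open>card J\<close>, which is the origin of the bound
      \<open>card J * \<tau>\<close>.\<close>
    define L where "L = (\<lambda>i::nat. {j\<in>J. ex f j0 - i * \<tau> \<le> ex f j})"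
    have finL: "finite (L i)" for i using fin(2) by (simp add: L_def)
    have mono: "L i \<subseteq> L (Suc i)" for i
      using \<tau> by (auto simp: L_def algebra_simps)
    have "\<exists>i<card J. L i = L (Suc i)"
    proof (rule ccontr)
      assume neg: "\<not> (\<exists>i<card J. L i = L (Suc i))"
      have "i \<le> card J \<Longrightarrow> Suc i \<le> card (L i)" for i
      proof (induction i)
        case 0
        have "j0 \<in> L 0" using j0 by (simp add: L_def)
        then show ?case using finL[of 0] by (auto simp: Suc_le_eq card_gt_0_iff)
      next
        case (Suc i)
        then have "L i \<subset> L (Suc i)" using neg mono[of i] by auto
        then have "card (L i) < card (L (Suc i))" using finL by (simp add: psubset_card_mono)
        then show ?case using Suc by simp
      qed
      then have "Suc (card J) \<le> card (L (card J))" by simp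
      also have "\<dots> \<le> card J" using fin(2) by (intro card_mono) (auto simp: L_def)
      finally show False by simp
    qed
    then obtain i where i: "i < card J" "L i = L (Suc i)" by blast
    let ?L = "L i"
    have LJ: "?L \<subseteq> J" by (auto simp: L_def)
    have j0L: "j0 \<in> ?L" using j0 \<tau> by (simp add: L_def)
    \<comment> \<open>Items of weight 0 are left out because \<open>exchange\<close> says nothing
      about them; they do not affect the sums.\<close>
    define S where "S = {k\<in>K. f k \<in> ?L \<and> 0 < w k}"
    have "(\<Union>k\<in>S. N k) \<subseteq> ?L"
    proof clarify
      fix k j' assume "k \<in> S" and j': "j' \<in> N k"
      then have k: "k \<in> K" "f k \<in> ?L" "0 < w k" by (auto simp: S_def)
      have "ex f (f k) - \<tau> \<le> ex f j'" by (rule exchange[OF k(1,3) j'])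
      moreover have "ex f j0 - i * \<tau> \<le> ex f (f k)" using k(2) by (simp add: L_def)
      ultimately have "ex f j0 - Suc i * \<tau> \<le> ex f j'" by (simp add: algebra_simps)
      then have "j' \<in> L (Suc i)" using N(1)[OF k(1)] j' by (auto simp: L_def)
      then show "j' \<in> ?L" using i(2) by simp
    qed
    then have "sum m (\<Union>k\<in>S. N k) \<le> sum m ?L"
      using finL m LJ by (intro sum_mono2) auto
    moreover have "sum w S \<le> sum m (\<Union>k\<in>S. N k)" by (rule Hall) (auto simp: S_def)
    moreover have "sum w S = sum w {k\<in>K. f k \<in> ?L}"
      using fin(1) w(1) by (intro sum.mono_neutral_left) (force simp: S_def)+
    moreover have "sum w {k\<in>K. f k \<in> ?L} = (\<Sum>j\<in>?L. sum w {k\<in>K. f k = j})"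
    proof -
      have "(\<Sum>j\<in>?L. sum w {k \<in> {k\<in>K. f k \<in> ?L}. f k = j}) = sum w {k\<in>K. f k \<in> ?L}"
        using fin(1) finL by (intro sum.group) auto
      moreover have "{k \<in> {k\<in>K. f k \<in> ?L}. f k = j} = {k\<in>K. f k = j}" if "j \<in> ?L" for j
        using that by auto
      ultimately show ?thesis by simp
    qed
    ultimately have "(\<Sum>j\<in>?L. ex f j) \<le> 0"
      by (simp add: ex_def sum_subtractf)
    \<comment> \<open>Since \<open>i < card J\<close>, a bin in the level \<open>?L\<close> still
      has positive excess; the Hall condition made the total excess there nonpositive.\<close>
    moreover have "0 < (\<Sum>j\<in>?L. ex f j)"
    proof (rule sum_pos)
      fix j assume "j \<in> ?L"
      have "i * \<tau> \<le> card J * \<tau>" using i(1) \<tau> by (intro mult_right_mono) auto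
      then show "0 < ex f j" using \<open>j \<in> ?L\<close> over by (simp add: L_def)
    qed (use finL j0L in auto)
    ultimately show False by simp
  qed
  then have "\<And>j. j \<in> J \<Longrightarrow> sum w {k\<in>K. f k = j} \<le> m j + card J * \<tau>"
    by (fastforce simp: ex_def)
  moreover have "\<And>k. k \<in> K \<Longrightarrow> f k \<in> N k" using f by auto
  ultimately show ?thesis by (rule that[rotated])
qed

section \<open>The Wasserstein distance of order infinity\<close>

lemma infdist_lessE:
  assumes "infdist x U < r" "U \<noteq> {}"
  obtains u where "u \<in> U" "dist x u < r"
proof -
  have "(INF u\<in>U. dist x u) < r" using assms by (simp add: infdist_def)
  then have "\<exists>y\<in>dist x ` U. y < r" using assms(2) by (intro cInf_lessD) auto
  then show ?thesis using that by blast
qed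

lemma infdist_less: "u \<in> U \<Longrightarrow> dist x u < r \<Longrightarrow> infdist x U < r"
  using infdist_le[of u U x] by linarith

lemma open_infdist_less: "open {x. infdist x U < r}"
  by (intro open_Collect_less continuous_intros)

lemma prob_space_measure_UNIV:
  assumes "sets \<mu> = sets borel" "prob_space \<mu>" shows "measure \<mu> UNIV = 1"
proof -
  have "space \<mu> = UNIV" using sets_eq_imp_space_eq[OF assms(1)] by simp
  then show ?thesis using prob_space.prob_space[OF assms(2)] by simp
qed

lemma W_inf_le:
  assumes "0 < r" "\<And>U. U \<in> sets borel \<Longrightarrow> measure \<mu> U \<le> measure \<nu> {x. infdist x U < r}"
  shows "W_inf \<mu> \<nu> \<le> r"
  unfolding W_inf_def
proof (rule cInf_lower)
  show "bdd_below {r. 0 < r \<and> (\<forall>U\<in>sets borel. measure \<mu> U \<le> measure \<nu> {x. infdist x U < r})}"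
    by (rule bdd_belowI[of _ 0]) auto
qed (use assms in auto)

lemma compact_UNIV_dist_bound:
  assumes "compact (UNIV :: 'a::metric_space set)"
  obtains D where "\<And>x y :: 'a::metric_space. dist x y \<le> D"
  using compact_imp_bounded[OF assms] unfolding bounded_two_points by auto

text \<open>A real infimum over an empty set would be an arbitrary value; here every radius
  exceeding the diameter qualifies.\<close>

lemma W_inf_set_nonempty:
  fixes \<mu> \<nu> :: "'a::metric_space measure"
  assumes cpt: "compact (UNIV :: 'a set)"
    and \<mu>: "sets \<mu> = sets borel" "prob_space \<mu>" and \<nu>: "sets \<nu> = sets borel" "prob_space \<nu>"
  shows "{r. 0 < r \<and> (\<forall>U\<in>sets borel. measure \<mu> U \<le> measure \<nu> {x. infdist x U < r})} \<noteq> {}"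
proof -
  obtain D where D: "\<And>x y :: 'a. dist x y \<le> D" using compact_UNIV_dist_bound[OF cpt] by blast
  have D0: "0 \<le> D" using D[of undefined undefined] by simp
  have "infdist x U < D + 1" for x :: 'a and U
  proof (cases "U = {}")
    case True then show ?thesis using D0 by (simp add: infdist_def)
  next
    case False
    then obtain u where u: "u \<in> U" by blast
    have "dist x u < D + 1" using D[of x u] by simp
    with u show ?thesis by (rule infdist_less)
  qed
  then have eq: "{x :: 'a. infdist x U < D + 1} = UNIV" for U by auto
  have "measure \<mu> U \<le> measure \<nu> {x. infdist x U < D + 1}" for U
    unfolding eq prob_space_measure_UNIV[OF \<nu>] using prob_space.prob_le_1[OF \<mu>(2)] .
  moreover have "0 < D + 1" using D0 by simp
  ultimately show ?thesis by blast
qed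

lemma W_inf_nonneg:
  fixes \<mu> \<nu> :: "'a::metric_space measure"
  assumes "compact (UNIV :: 'a set)"
    "sets \<mu> = sets borel" "prob_space \<mu>" "sets \<nu> = sets borel" "prob_space \<nu>"
  shows "0 \<le> W_inf \<mu> \<nu>"
  unfolding W_inf_def by (rule cInf_greatest[OF W_inf_set_nonempty[OF assms]]) auto

lemma W_inf_lessE:
  fixes \<mu> \<nu> :: "'a::metric_space measure"
  assumes "compact (UNIV :: 'a set)"
    "sets \<mu> = sets borel" "prob_space \<mu>" "sets \<nu> = sets borel" "prob_space \<nu>" and "W_inf \<mu> \<nu> < s"
  obtains r where "0 < r" "r < s" "\<And>U. U \<in> sets borel \<Longrightarrow> measure \<mu> U \<le> measure \<nu> {x. infdist x U < r}"
proof -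
  obtain r where "r < s" "0 < r \<and> (\<forall>U\<in>sets borel. measure \<mu> U \<le> measure \<nu> {x. infdist x U < r})"
    using cInf_lessD[OF W_inf_set_nonempty[OF assms(1-5)] assms(6)[unfolded W_inf_def]] by blast
  then show ?thesis by (intro that[of r]) blast+
qed

text \<open>Symmetry of the distance, radius by radius. Take for \<open>U\<close> the complement of
  the \<open>r\<close>-neighbourhood of \<open>V\<close>: then \<open>V\<close> misses the
  \<open>r\<close>-neighbourhood of \<open>U\<close>, and passing to complements reverses the
  inequality.\<close>

lemma W_inf_bound_swap:
  fixes \<mu> \<nu> :: "'a::metric_space measure"
  assumes \<mu>: "sets \<mu> = sets borel" "prob_space \<mu>" and \<nu>: "sets \<nu> = sets borel" "prob_space \<nu>"
    and le: "\<And>U. U \<in> sets borel \<Longrightarrow> measure \<mu> U \<le> measure \<nu> {x. infdist x U < r}"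
    and V: "V \<in> sets borel"
  shows "measure \<nu> V \<le> measure \<mu> {x. infdist x V < r}"
proof -
  define U where "U = - {x. infdist x V < r}"
  have oV: "open {x. infdist x V < r}" by (rule open_infdist_less)
  have U: "U \<in> sets borel" unfolding U_def using oV by (intro borel_closed) auto
  have cU: "measure \<mu> U = 1 - measure \<mu> {x. infdist x V < r}"
  proof -
    have "measure \<mu> (space \<mu> - {x. infdist x V < r}) = 1 - measure \<mu> {x. infdist x V < r}"
      using oV \<mu> by (intro prob_space.prob_compl) auto
    moreover have "space \<mu> = UNIV" using sets_eq_imp_space_eq[OF \<mu>(1)] by simp
    ultimately show ?thesis by (simp add: U_def Compl_eq_Diff_UNIV)
  qed
  show ?thesis
  \<comment> \<open>Treated apart because \<open>infdist x {} = 0\<close> makes every point near the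
    empty set.\<close>
  proof (cases "U = {}")
    case True
    then show ?thesis using cU prob_space.prob_le_1[OF \<nu>(2), of V] by simp
  next
    case False
    have "V \<subseteq> - {x. infdist x U < r}"
    proof clarify
      fix x assume x: "x \<in> V" "infdist x U < r"
      obtain u where u: "u \<in> U" "dist x u < r" using infdist_lessE[OF x(2) False] .
      then have "infdist u V < r" using x(1) by (intro infdist_less[of x]) (auto simp: dist_commute)
      with u(1) show False by (simp add: U_def)
    qed
    then have "measure \<nu> V \<le> measure \<nu> (space \<nu> - {x. infdist x U < r})"
      using sets_eq_imp_space_eq[OF \<nu>(1)] \<nu> V open_infdist_less[of U r]
      by (intro finite_measure.finite_measure_mono prob_space.finite_measure) auto
    also have "\<dots> = 1 - measure \<nu> {x. infdist x U < r}"
      using \<nu> open_infdist_less[of U r] by (intro prob_space.prob_compl) auto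
    also have "\<dots> \<le> 1 - measure \<mu> U" using le[OF U] by simp
    finally show ?thesis using cU by simp
  qed
qed

section \<open>Finite nets, small partitions and uniform lower bounds\<close>

lemma compact_UNIV_finite_net:
  assumes "compact (UNIV :: 'a::metric_space set)" "0 < d"
  obtains f :: "nat \<Rightarrow> 'a::metric_space" and n where "(\<Union>i<n. ball (f i) d) = UNIV"
proof -
  obtain C where C: "finite C" "UNIV \<subseteq> (\<Union>x\<in>C. ball (x::'a) d)"
  proof (rule compactE_image[OF assms(1), of UNIV "\<lambda>x. ball x d"])
    have "x \<in> ball x d" for x :: 'a using assms(2) by simp
    then show "UNIV \<subseteq> (\<Union>x\<in>UNIV. ball (x::'a) d)" by blast
  qed auto
  obtain f and n :: nat where "C = f ` {..<n}"
    using finite_imp_nat_seg_image_inj_on[OF C(1)] unfolding lessThan_def by blast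
  then have "(\<Union>i<n. ball (f i) d) = UNIV" using C(2) by auto
  then show ?thesis by (rule that)
qed

lemma finite_small_partition:
  assumes "compact (UNIV :: 'a::metric_space set)" "0 < d"
  obtains P :: "nat \<Rightarrow> 'a::metric_space set" and z n where
    "\<And>i. P i \<in> sets borel" "\<And>i. P i \<subseteq> ball (z i) d"
    "disjoint_family P" "(\<Union>i<n. P i) = UNIV"
proof -
  obtain z :: "nat \<Rightarrow> 'a" and n where z: "(\<Union>i<n. ball (z i) d) = UNIV"
    using compact_UNIV_finite_net[OF assms] by blast
  define P where "P = disjointed (\<lambda>i. ball (z i) d)"
  have "P i \<in> sets borel" for i unfolding P_def disjointed_def by auto
  moreover have "P i \<subseteq> ball (z i) d" for i unfolding P_def by (rule disjointed_subset)
  moreover have "disjoint_family P" unfolding P_def by (rule disjoint_family_disjointed)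
  moreover have "(\<Union>i<n. P i) = UNIV"
    using finite_UN_disjointed_eq[of "\<lambda>i. ball (z i) d" n] z by (simp add: P_def lessThan_atLeast0)
  ultimately show ?thesis by (rule that)
qed

text \<open>Every ball of radius \<open>d\<close> contains a ball of half the radius around a point
  of a finite net, and finitely many positive masses have a positive minimum.\<close>

lemma faithful_ball_bound:
  fixes \<mu> :: "'a::metric_space measure"
  assumes cpt: "compact (UNIV :: 'a set)" and \<mu>: "sets \<mu> = sets borel" "prob_space \<mu>" "faithful_measure \<mu>"
    and d: "0 < d"
  obtains c where "0 < c" "\<And>x. c \<le> measure \<mu> (ball x d)"
proof -
  obtain z :: "nat \<Rightarrow> 'a" and n where z: "(\<Union>i<n. ball (z i) (d/2)) = UNIV"
    using compact_UNIV_finite_net[OF cpt, of "d/2"] d by auto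
  have "n \<noteq> 0" using z by auto
  define c where "c = Min ((\<lambda>i. measure \<mu> (ball (z i) (d/2))) ` {..<n})"
  have "0 < c"
    unfolding c_def using \<open>n \<noteq> 0\<close> \<mu>(3) d by (subst Min_gr_iff) (auto simp: faithful_measure_def)
  moreover have "c \<le> measure \<mu> (ball x d)" for x
  proof -
    obtain i where i: "i < n" "x \<in> ball (z i) (d/2)" using z by blast
    have "c \<le> measure \<mu> (ball (z i) (d/2))" unfolding c_def using i(1) by (intro Min_le) auto
    also have "ball (z i) (d/2) \<subseteq> ball x d"
    proof
      fix y assume "y \<in> ball (z i) (d/2)"
      then show "y \<in> ball x d"
        using i(2) dist_triangle2[of x y "z i"] by (simp add: dist_commute)
    qed
    then have "measure \<mu> (ball (z i) (d/2)) \<le> measure \<mu> (ball x d)"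
      using \<mu> by (intro finite_measure.finite_measure_mono prob_space.finite_measure) auto
    finally show ?thesis .
  qed
  ultimately show ?thesis by (rule that)
qed

text \<open>On a connected space the shell between the \<open>\<delta>/2\<close>- and the \<open>\<delta>\<close>-neighbourhood of \<open>U\<close> contains a
  ball, unless the larger neighbourhood is everything. Its mass pays for a uniformly small error.\<close>

lemma W_inf_le_of_approx:
  fixes \<mu> :: "'a::metric_space measure"
  assumes cpt: "compact (UNIV :: 'a set)" and conn: "connected (UNIV :: 'a set)"
    and \<mu>: "sets \<mu> = sets borel" "prob_space \<mu>" "faithful_measure \<mu>" and \<delta>: "0 < \<delta>"
  obtains c where "0 < c" "\<And>\<nu>. \<lbrakk>prob_space \<nu>;
    \<And>U. U \<in> sets borel \<Longrightarrow> measure \<nu> U \<le> measure \<mu> {x. infdist x U < \<delta>/2} + c\<rbrakk> \<Longrightarrow> W_inf \<nu> \<mu> \<le> \<delta>"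
proof -
  obtain c where c: "0 < c" "\<And>x. c \<le> measure \<mu> (ball x (\<delta>/4))"
    using faithful_ball_bound[OF cpt \<mu>, of "\<delta>/4"] \<delta> by auto
  have "W_inf \<nu> \<mu> \<le> \<delta>" if \<nu>: "prob_space \<nu>"
    and le: "\<And>U. U \<in> sets borel \<Longrightarrow> measure \<nu> U \<le> measure \<mu> {x. infdist x U < \<delta>/2} + c" for \<nu>
  proof (rule W_inf_le[OF \<delta>])
    fix U :: "'a set" assume U: "U \<in> sets borel"
    show "measure \<nu> U \<le> measure \<mu> {x. infdist x U < \<delta>}"
    proof (cases "U = {} \<or> {x. infdist x U < \<delta>} = UNIV")
      case True
      then show ?thesis
        using prob_space.prob_le_1[OF \<nu>, of U] prob_space_measure_UNIV[OF \<mu>(1,2)] by auto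
    next
      case False
      then obtain u where u: "u \<in> U" by blast
      from False obtain v where v: "\<delta> \<le> infdist v U" using not_less by blast
      \<comment> \<open>By the intermediate value theorem some \<open>x\<close> is at distance
        \<open>3/4 * \<delta>\<close> from \<open>U\<close>; its ball of radius
        \<open>\<delta>/4\<close> then fits in the shell.\<close>
      have "connected ((\<lambda>x. infdist x U) ` UNIV)"
        by (intro connected_continuous_image conn continuous_intros)
      moreover have "infdist u U = 0" using u by simp
      ultimately have "3/4 * \<delta> \<in> (\<lambda>x. infdist x U) ` UNIV"
        using connected_contains_Icc[of "(\<lambda>x. infdist x U) ` UNIV" "infdist u U" "infdist v U"] v \<delta>
        by (force simp: subset_iff)
      then obtain x where x: "infdist x U = 3/4 * \<delta>" by force
      have near: "\<delta>/2 \<le> infdist y U \<and> infdist y U < \<delta>" if "y \<in> ball x (\<delta>/4)" for y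
        using infdist_triangle_abs[of x U y] that x by (auto simp: abs_le_iff)
      have "measure \<nu> U \<le> measure \<mu> {x. infdist x U < \<delta>/2} + measure \<mu> (ball x (\<delta>/4))"
        using le[OF U] c(2)[of x] by simp
      also have "\<dots> = measure \<mu> ({x. infdist x U < \<delta>/2} \<union> ball x (\<delta>/4))"
        using \<mu> near open_infdist_less[of U "\<delta>/2"]
        by (intro finite_measure.finite_measure_Union[symmetric] prob_space.finite_measure) force+
      also have "\<dots> \<le> measure \<mu> {x. infdist x U < \<delta>}"
        using \<mu> near \<delta> open_infdist_less[of U \<delta>]
        by (intro finite_measure.finite_measure_mono prob_space.finite_measure) force+
      finally show ?thesis .
    qed
  qed
  with c(1) show ?thesis by (rule that)
qed

section \<open>Measures without atoms\<close>

lemma diffuse_measure_singleton: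
  fixes \<nu> :: "'a::t1_space measure"
  assumes "sets \<nu> = sets borel" "diffuse_measure \<nu>"
  shows "measure \<nu> {x} = 0"
proof (rule ccontr)
  assume "measure \<nu> {x} \<noteq> 0"
  then have "0 < measure \<nu> {x}" using measure_nonneg[of \<nu> "{x}"] by linarith
  moreover have "{x} \<in> sets \<nu>" using assms(1) by simp
  moreover have "measure \<nu> F = 0 \<or> measure \<nu> F = measure \<nu> {x}" if "F \<subseteq> {x}" for F
    using that by (auto simp: subset_singleton_iff)
  ultimately show False using assms(2) unfolding diffuse_measure_def by blast
qed

text \<open>\<open>d\<close> is a Lebesgue number of a cover by balls of mass below
  \<open>\<tau>\<close>, which exist because the masses of balls shrinking to a point tend to
  0.\<close>

lemma small_sets_small_measure:
  fixes \<nu> :: "'a::metric_space measure"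
  assumes cpt: "compact (UNIV :: 'a set)" and \<nu>: "sets \<nu> = sets borel" "finite_measure \<nu>"
    and null: "\<And>x. measure \<nu> {x} = 0" and \<tau>: "0 < \<tau>"
  obtains d where "0 < d"
    "\<And>B. \<lbrakk>B \<in> sets borel; \<And>x y. x \<in> B \<Longrightarrow> y \<in> B \<Longrightarrow> dist x y < d\<rbrakk> \<Longrightarrow> measure \<nu> B \<le> \<tau>"
proof -
  have "\<exists>r>0. measure \<nu> (ball x r) < \<tau>" for x
  proof -
    have "(\<lambda>n. measure \<nu> (ball x (1 / Suc n))) \<longlonglongrightarrow> measure \<nu> (\<Inter>n. ball x (1 / Suc n))"
    proof (rule finite_measure.finite_Lim_measure_decseq[OF \<nu>(2)])
      show "decseq (\<lambda>n. ball x (1 / Suc n))"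
        by (intro decseq_SucI subset_ball frac_le) auto
      show "range (\<lambda>n. ball x (1 / Suc n)) \<subseteq> sets \<nu>"
        unfolding \<nu>(1) by (intro image_subsetI borel_open open_ball)
    qed
    moreover have "(\<Inter>n. ball x (1 / Suc n)) = {x}"
    proof safe
      fix y assume y: "y \<in> (\<Inter>n. ball x (1 / Suc n))"
      show "y = x"
      proof (rule ccontr)
        assume "y \<noteq> x"
        then obtain n where "1 / Suc n < dist x y"
          using reals_Archimedean[of "dist x y"] by (auto simp: inverse_eq_divide)
        moreover have "dist x y < 1 / Suc n" using y by auto
        ultimately show False by simp
      qed
    qed auto
    ultimately have "(\<lambda>n. measure \<nu> (ball x (1 / Suc n))) \<longlonglongrightarrow> 0" using null by simp
    then have "\<forall>\<^sub>F n in sequentially. measure \<nu> (ball x (1 / Suc n)) < \<tau>"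
      using \<tau> by (rule order_tendstoD)
    then obtain n where "measure \<nu> (ball x (1 / Suc n)) < \<tau>" by (auto simp: eventually_sequentially)
    then show ?thesis by (intro exI[of _ "1 / Suc n"]) simp
  qed
  then obtain r where r: "\<And>x. 0 < r x" "\<And>x. measure \<nu> (ball x (r x)) < \<tau>" by metis
  obtain e where e: "0 < e" "\<And>x. x \<in> (UNIV :: 'a set) \<Longrightarrow> \<exists>G\<in>range (\<lambda>x. ball x (r x)). ball x e \<subseteq> G"
  proof (rule Heine_Borel_lemma[OF cpt, of "range (\<lambda>x. ball x (r x))"])
    have "x \<in> ball x (r x)" for x using r(1) by simp
    then show "UNIV \<subseteq> \<Union> (range (\<lambda>x. ball x (r x)))" by blast
  qed auto
  have "measure \<nu> B \<le> \<tau>" if B: "B \<in> sets borel" "\<And>x y. x \<in> B \<Longrightarrow> y \<in> B \<Longrightarrow> dist x y < e" for B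
  proof (cases "B = {}")
    case False
    then obtain x where x: "x \<in> B" by blast
    obtain y where "ball x e \<subseteq> ball y (r y)" using e(2)[of x] by auto
    then have "B \<subseteq> ball y (r y)" using B(2)[OF x] by auto
    then have "measure \<nu> B \<le> measure \<nu> (ball y (r y))"
      using \<nu> by (intro finite_measure.finite_measure_mono) auto
    then show ?thesis using r(2)[of y] by simp
  qed (use \<tau> in simp)
  with e(1) show ?thesis by (rule that)
qed

text \<open>A partition into sets of at most half the mass of an alleged atom cuts it into null
  sets. This converts control of single points, which constructions offer, into the definition by
  atoms.\<close>

lemma diffuse_measureI:
  fixes \<nu> :: "'a::metric_space measure"
  assumes cpt: "compact (UNIV :: 'a set)" and \<nu>: "sets \<nu> = sets borel" "finite_measure \<nu>"
    and null: "\<And>x. measure \<nu> {x} = 0"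
  shows "diffuse_measure \<nu>"
  unfolding diffuse_measure_def
proof
  assume "\<exists>E\<in>sets \<nu>. 0 < measure \<nu> E \<and> (\<forall>F\<in>sets \<nu>. F \<subseteq> E \<longrightarrow> measure \<nu> F = 0 \<or> measure \<nu> F = measure \<nu> E)"
  then obtain E where E: "E \<in> sets \<nu>" "0 < measure \<nu> E"
    "\<And>F. F \<in> sets \<nu> \<Longrightarrow> F \<subseteq> E \<Longrightarrow> measure \<nu> F = 0 \<or> measure \<nu> F = measure \<nu> E" by blast
  obtain d where d: "0 < d" "\<And>B. \<lbrakk>B \<in> sets borel; \<And>x y. x \<in> B \<Longrightarrow> y \<in> B \<Longrightarrow> dist x y < d\<rbrakk>
      \<Longrightarrow> measure \<nu> B \<le> measure \<nu> E / 2"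
    using small_sets_small_measure[OF cpt \<nu> null, of "measure \<nu> E / 2"] E(2) by auto
  obtain P :: "nat \<Rightarrow> 'a set" and z n where P: "\<And>i. P i \<in> sets borel" "\<And>i. P i \<subseteq> ball (z i) (d/2)"
    "(\<Union>i<n. P i) = UNIV"
    using finite_small_partition[OF cpt, of "d/2"] d(1) by (metis half_gt_zero)
  have "measure \<nu> (P i \<inter> E) = 0" for i
  proof -
    have s: "P i \<inter> E \<in> sets \<nu>" using P(1)[of i] E(1) \<nu>(1) by auto
    have "measure \<nu> (P i \<inter> E) \<le> measure \<nu> E / 2"
    proof (rule d(2))
      show "P i \<inter> E \<in> sets borel" using s \<nu>(1) by simp
      fix x y assume "x \<in> P i \<inter> E" "y \<in> P i \<inter> E"
      then have "dist (z i) x < d/2" "dist (z i) y < d/2" using P(2)[of i] by auto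
      then show "dist x y < d" using dist_triangle3[of x y "z i"] by simp
    qed
    then show ?thesis using E(3)[OF s] E(2) by auto
  qed
  then have "measure \<nu> (\<Union>i<n. P i \<inter> E) \<le> (\<Sum>i<n. 0)"
    using finite_measure.finite_measure_subadditive_finite[OF \<nu>(2), of "{..<n}" "\<lambda>i. P i \<inter> E"] P(1) E(1) \<nu>(1)
    by (metis (no_types, lifting) finite_lessThan image_subsetI sets.Int sum.cong)
  moreover have "(\<Union>i<n. P i \<inter> E) = E" using P(3) by auto
  ultimately show False using E(2) by simp
qed

section \<open>Exhausting a measure by convex cells\<close>

text \<open>The integers congruent to \<open>j\<close> modulo \<open>N\<close> are the gaps of the
  grid; \<open>n\<close> lies strictly between the consecutive gaps \<open>N * k + j\<close> and
  \<open>N * (k + 1) + j\<close>.\<close>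

lemma mod_gap_bounds:
  fixes n j k :: int and N :: int
  assumes "0 \<le> j" "j < N" "n mod N \<noteq> j" "k = (n - j - 1) div N"
  shows "N * k + j + 1 \<le> n" "n \<le> N * k + j + N - 1"
proof -
  have N: "0 < N" using assms by simp
  define r where "r = (n - j - 1) mod N"
  have n: "n = N * k + j + 1 + r"
    using mult_div_mod_eq[of N "n - j - 1"] by (simp add: r_def assms(4))
  have r: "0 \<le> r" "r < N" using N by (simp_all add: r_def)
  have "r \<noteq> N - 1"
  proof
    assume "r = N - 1"
    then have "n = j + N * (k + 1)" using n by (simp add: algebra_simps)
    then have "n mod N = j" using assms(1,2) by simp
    with assms(3) show False by simp
  qed
  then show "N * k + j + 1 \<le> n" "n \<le> N * k + j + N - 1" using n r by auto
qed

text \<open>Cubes of side \<open>(N - 1) u\<close> separated by gaps of width \<open>u\<close>. Among the \<open>N\<close> translates of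
  the grid there is one whose gaps have small measure.\<close>

lemma disjoint_convex_cover_up_to:
  fixes M :: "'e::euclidean_space measure"
  assumes M: "finite_measure M" "sets M = sets borel" and L: "compact L" and \<delta>: "0 < \<delta>" and \<epsilon>: "0 < \<epsilon>"
  obtains \<B> where "finite \<B>" "disjoint_family_on (\<lambda>B. B) \<B>"
    "\<And>B. B \<in> \<B> \<Longrightarrow> compact B \<and> convex B \<and> B \<inter> L \<noteq> {} \<and> (\<forall>x\<in>B. \<forall>y\<in>B. dist x y < \<delta>)"
    "measure M (L - \<Union>\<B>) \<le> \<epsilon>"
proof -
  let ?D = "real DIM('e)"
  \<comment> \<open>Large enough that the mass of the gaps, averaged over the \<open>N\<close>
    translates and summed over all coordinate directions, is below
    \<open>\<epsilon>\<close>.\<close>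
  obtain N :: nat where N: "?D * measure M UNIV / \<epsilon> < N" using reals_Archimedean2 by blast
  have "0 \<le> ?D * measure M UNIV / \<epsilon>" using \<epsilon> by simp
  then have N0: "0 < N" using N by linarith
  \<comment> \<open>Cubes of side at most \<open>N * u\<close> have diameter at most
    \<open>\<delta> / 2\<close> when the norm is bounded by the sum of the coordinates.\<close>
  define u where "u = \<delta> / (2 * ?D * N)"
  have u: "0 < u" using \<delta> N0 by (simp add: u_def)
  define bad where "bad = (\<lambda>i j. {x::'e. \<lfloor>x \<bullet> i / u\<rfloor> mod int N = int j})"
  have bad_sets: "bad i j \<in> sets M" for i j
  proof -
    have "(\<lambda>x::'e. \<lfloor>x \<bullet> i / u\<rfloor>) \<in> borel \<rightarrow>\<^sub>M count_space UNIV"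
      by measurable
    then have "(\<lambda>x::'e. \<lfloor>x \<bullet> i / u\<rfloor>) -` {n. n mod int N = int j} \<inter> space borel \<in> sets borel"
      by (rule measurable_sets) simp
    then show ?thesis unfolding bad_def M(2) by (simp add: vimage_def)
  qed
  have slab: "(\<Sum>j<N. measure M (bad i j)) = measure M UNIV" for i
  proof -
    have "measure M (\<Union>j<N. bad i j) = (\<Sum>j<N. measure M (bad i j))"
      using bad_sets by (intro finite_measure.finite_measure_finite_Union[OF M(1)])
        (auto simp: disjoint_family_on_def bad_def)
    moreover have "(\<Union>j<N. bad i j) = UNIV"
    proof (intro equalityI subset_UNIV subsetI)
      fix x
      have "nat (\<lfloor>x \<bullet> i / u\<rfloor> mod int N) < N" "\<lfloor>x \<bullet> i / u\<rfloor> mod int N = int (nat (\<lfloor>x \<bullet> i / u\<rfloor> mod int N))"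
        using N0 by (simp_all add: nat_less_iff)
      then show "x \<in> (\<Union>j<N. bad i j)" unfolding bad_def by blast
    qed
    ultimately show ?thesis by simp
  qed
  \<comment> \<open>Pigeonhole: in each direction the \<open>N\<close> families of slabs partition
    the space, so their masses sum to \<open>measure M UNIV\<close>.\<close>
  have "\<exists>j<N. (\<Sum>i\<in>Basis. measure M (bad i j)) \<le> \<epsilon>"
  proof (rule ccontr)
    assume "\<not> (\<exists>j<N. (\<Sum>i\<in>Basis. measure M (bad i j)) \<le> \<epsilon>)"
    then have "(\<Sum>j<N. \<epsilon>) \<le> (\<Sum>j<N. \<Sum>i\<in>Basis. measure M (bad i j))"
      by (intro sum_mono) (auto simp: not_le less_imp_le)
    also have "\<dots> = (\<Sum>i\<in>(Basis::'e set). measure M UNIV)"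
      by (subst sum.swap) (simp add: slab)
    finally have "N * \<epsilon> \<le> ?D * measure M UNIV" by simp
    then show False using N \<epsilon> by (simp add: field_simps)
  qed
  then obtain j where j: "j < N" "(\<Sum>i\<in>Basis. measure M (bad i j)) \<le> \<epsilon>" by blast
  define Bad where "Bad = (\<Union>i\<in>Basis. bad i j)"
  define Q where "Q = (\<lambda>a::'e \<Rightarrow> int. cbox (\<Sum>i\<in>Basis. ((int N * a i + j + 1) * u) *\<^sub>R i) (\<Sum>i\<in>Basis. ((int N * a i + j + N) * u) *\<^sub>R i))"
  define ix where "ix = (\<lambda>x. \<lambda>i\<in>(Basis::'e set). (\<lfloor>x \<bullet> i / u\<rfloor> - int j - 1) div int N)"
  have Q: "x \<in> Q a \<longleftrightarrow> (\<forall>i\<in>Basis. (int N * a i + j + 1) * u \<le> x \<bullet> i \<and> x \<bullet> i \<le> (int N * a i + j + N) * u)" for x a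
    by (auto simp: Q_def mem_box)
  have xQ: "x \<in> Q (ix x)" if x: "x \<notin> Bad" for x
    unfolding Q
  proof (intro ballI)
    fix i :: 'e assume i: "i \<in> Basis"
    let ?n = "\<lfloor>x \<bullet> i / u\<rfloor>"
    have "?n mod int N \<noteq> int j" using x i unfolding Bad_def bad_def by blast
    then have n: "int N * ix x i + j + 1 \<le> ?n" "?n \<le> int N * ix x i + j + N - 1"
      using mod_gap_bounds[of "int j" "int N" ?n "ix x i"] j(1) i by (auto simp: ix_def)
    have "real_of_int (int N * ix x i + j + 1) \<le> x \<bullet> i / u" using n(1) by linarith
    moreover have "x \<bullet> i / u \<le> real_of_int (int N * ix x i + j + N)" using n(2) by linarith
    ultimately show "(int N * ix x i + j + 1) * u \<le> x \<bullet> i \<and> x \<bullet> i \<le> (int N * ix x i + j + N) * u"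
      using u by (simp add: pos_le_divide_eq pos_divide_le_eq)
  qed
  define \<B> where "\<B> = Q ` ix ` (L - Bad)"
  have "finite (ix ` L)"
  proof -
    obtain R where R: "\<And>x. x \<in> L \<Longrightarrow> norm x \<le> R" using compact_imp_bounded[OF L] bounded_iff by blast
    let ?S = "(\<lambda>n. (n - int j - 1) div int N) ` {\<lfloor>- R / u\<rfloor>..\<lfloor>R / u\<rfloor>}"
    have "ix ` L \<subseteq> Pi\<^sub>E Basis (\<lambda>_. ?S)"
    proof (intro image_subsetI PiE_I)
      fix x i :: 'e assume x: "x \<in> L" and i: "i \<in> Basis"
      have "\<bar>x \<bullet> i\<bar> \<le> R" using R[OF x] Basis_le_norm[OF i, of x] by simp
      then have "- R / u \<le> x \<bullet> i / u" "x \<bullet> i / u \<le> R / u"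
        using u divide_right_mono[of "- R" "x \<bullet> i" u] divide_right_mono[of "x \<bullet> i" R u] by auto
      then have "\<lfloor>x \<bullet> i / u\<rfloor> \<in> {\<lfloor>- R / u\<rfloor>..\<lfloor>R / u\<rfloor>}" by (simp add: floor_mono)
      then show "ix x i \<in> ?S" using i by (auto simp: ix_def)
    qed (simp add: ix_def)
    then show ?thesis by (rule finite_subset) (intro finite_PiE finite_Basis finite_imageI finite_atLeastAtMost_int)
  qed
  then have "finite (ix ` (L - Bad))" by (rule rev_finite_subset) blast
  then have fin: "finite \<B>" unfolding \<B>_def by (rule finite_imageI)
  have "Q (ix x) \<inter> Q (ix y) = {}" if "Q (ix x) \<noteq> Q (ix y)" for x y
  proof -
    have "ix x \<noteq> ix y" using that by metis
    moreover have "ix x = ix y" if "\<forall>i\<in>Basis. ix x i = ix y i"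
      using that by (auto simp: ix_def fun_eq_iff)
    ultimately obtain i where i: "i \<in> Basis" "ix x i \<noteq> ix y i" by blast
    \<comment> \<open>One unit of width \<open>u\<close> separates the upper face
      \<open>N * a + j + N\<close> of a cube from the lower face \<open>N * (a + 1) + j + 1\<close>
      of the next.\<close>
    have sep: False if "ix x i < ix y i" "w \<in> Q (ix x)" "w \<in> Q (ix y)" for x y w
    proof -
      have "(int N * ix y i + j + 1) * u \<le> w \<bullet> i" "w \<bullet> i \<le> (int N * ix x i + j + N) * u"
        using that(2,3) i(1) unfolding Q by auto
      then have "real_of_int (int N * ix y i + j + 1) * u \<le> real_of_int (int N * ix x i + j + N) * u" by simp
      then have "real_of_int (int N * ix y i + j + 1) \<le> real_of_int (int N * ix x i + j + N)"
        using u by (rule mult_right_le_imp_le)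
      then have "int N * ix y i + j + 1 \<le> int N * ix x i + j + N" by (simp only: of_int_le_iff)
      moreover have "int N * (ix x i + 1) \<le> int N * ix y i" using that(1) by (intro mult_left_mono) auto
      ultimately show False by (simp add: algebra_simps)
    qed
    show ?thesis
    proof (cases "ix x i < ix y i")
      case True then show ?thesis using sep[of x y] by blast
    next
      case False
      then have "ix y i < ix x i" using i(2) by simp
      then show ?thesis using sep[of y x] by blast
    qed
  qed
  then have dis: "disjoint_family_on (\<lambda>B. B) \<B>"
    unfolding disjoint_family_on_def \<B>_def by blast
  have cells: "compact B \<and> convex B \<and> B \<inter> L \<noteq> {} \<and> (\<forall>x\<in>B. \<forall>y\<in>B. dist x y < \<delta>)" if B: "B \<in> \<B>" for B
  proof -
    obtain x where x: "x \<in> L" "x \<notin> Bad" "B = Q (ix x)" using B unfolding \<B>_def by blast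
    have "dist y z < \<delta>" if yz: "y \<in> B" "z \<in> B" for y z
    proof -
      have "\<bar>(y - z) \<bullet> i\<bar> \<le> N * u" if i: "i \<in> Basis" for i
      proof -
        have "(int N * ix x i + j + 1) * u \<le> y \<bullet> i" "y \<bullet> i \<le> (int N * ix x i + j + N) * u"
          "(int N * ix x i + j + 1) * u \<le> z \<bullet> i" "z \<bullet> i \<le> (int N * ix x i + j + N) * u"
          using yz i unfolding x(3) Q by auto
        then show ?thesis using u by (simp add: inner_diff_left abs_le_iff algebra_simps)
      qed
      then have "(\<Sum>i\<in>Basis. \<bar>(y - z) \<bullet> i\<bar>) \<le> (\<Sum>i\<in>(Basis::'e set). N * u)" by (intro sum_mono) auto
      then have "norm (y - z) \<le> ?D * (N * u)" using norm_le_l1[of "y - z"] by simp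
      also have "\<dots> = \<delta> / 2" using N0 by (simp add: u_def)
      finally show ?thesis using \<delta> by (simp add: dist_norm)
    qed
    moreover have "x \<in> B" using xQ x by simp
    ultimately show ?thesis using x by (auto simp: Q_def)
  qed
  have "L - \<Union>\<B> \<subseteq> Bad" using xQ unfolding \<B>_def by blast
  then have "measure M (L - \<Union>\<B>) \<le> measure M Bad"
    using bad_sets unfolding Bad_def by (intro finite_measure.finite_measure_mono[OF M(1)]) auto
  also have "\<dots> \<le> (\<Sum>i\<in>Basis. measure M (bad i j))"
    unfolding Bad_def using bad_sets
    by (intro finite_measure.finite_measure_subadditive_finite[OF M(1)]) auto
  finally have "measure M (L - \<Union>\<B>) \<le> \<epsilon>" using j(2) by simp
  with fin dis cells show ?thesis by (intro that[of \<B>])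
qed

lemma inner_regular_open:
  fixes \<nu> :: "'a::metric_space measure"
  assumes cpt: "compact (UNIV :: 'a set)" and \<nu>: "finite_measure \<nu>" "sets \<nu> = sets borel"
    and R: "open R" and \<epsilon>: "0 < \<epsilon>"
  obtains L where "compact L" "L \<subseteq> R" "measure \<nu> (R - L) \<le> \<epsilon>"
proof (cases "R = UNIV")
  \<comment> \<open>With an empty complement \<open>infdist\<close> would be constantly 0 and every
    \<open>L n\<close> below would be empty.\<close>
  case True
  then show ?thesis using that[of UNIV] cpt \<epsilon> by simp
next
  case False
  define L where "L = (\<lambda>n. {x. 1 / Suc n \<le> infdist x (- R)})"
  have clL: "closed (L n)" for n
    unfolding L_def by (intro closed_Collect_le continuous_intros)
  have LR: "L n \<subseteq> R" for n
  proof
    fix x assume x: "x \<in> L n"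
    show "x \<in> R"
    proof (rule ccontr)
      assume "x \<notin> R"
      then have "infdist x (- R) = 0" by simp
      moreover have "0 < 1 / real (Suc n)" by simp
      ultimately show False using x by (simp add: L_def)
    qed
  qed
  have inter: "(\<Inter>n. R - L n) = {}"
  proof -
    have "\<exists>n. x \<in> L n" if "x \<in> R" for x
    proof -
      have "infdist x (- R) \<noteq> 0"
        using that R False in_closed_iff_infdist_zero[of "- R" x] by auto
      then have "0 < infdist x (- R)" using infdist_nonneg[of x "- R"] by linarith
      then obtain n where "inverse (real (Suc n)) < infdist x (- R)" using reals_Archimedean by blast
      then show ?thesis by (intro exI[of _ n]) (simp add: L_def inverse_eq_divide)
    qed
    then show ?thesis by blast
  qed
  have "(\<lambda>n. measure \<nu> (R - L n)) \<longlonglongrightarrow> measure \<nu> (\<Inter>n. R - L n)"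
  proof (rule finite_measure.finite_Lim_measure_decseq[OF \<nu>(1)])
    show "range (\<lambda>n. R - L n) \<subseteq> sets \<nu>"
      unfolding \<nu>(2) using R clL by (intro image_subsetI borel_open open_Diff)
    show "decseq (\<lambda>n. R - L n)"
    proof (rule decseq_SucI)
      fix n
      have "1 / real (Suc (Suc n)) \<le> 1 / real (Suc n)" by (intro frac_le) auto
      then show "R - L (Suc n) \<subseteq> R - L n" by (force simp: L_def)
    qed
  qed
  then have "(\<lambda>n. measure \<nu> (R - L n)) \<longlonglongrightarrow> 0" by (simp only: inter measure_empty)
  then have "\<forall>\<^sub>F n in sequentially. measure \<nu> (R - L n) < \<epsilon>" using \<epsilon> by (rule order_tendstoD)
  then obtain n where "measure \<nu> (R - L n) < \<epsilon>" by (auto simp: eventually_sequentially)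
  moreover have "compact (L n)" using compact_Int_closed[OF cpt clL[of n]] by simp
  ultimately show ?thesis using LR[of n] by (intro that[of "L n"]) auto
qed

text \<open>The measure is pushed forward to Euclidean space and the cubes are cut there. The closed
  set \<open>F\<close> stands for cells already chosen in other charts; avoiding it keeps the whole
  family disjoint.\<close>

lemma chart_cells:
  fixes c :: "('a::metric_space, 'e::euclidean_space) chart" and \<nu> :: "'a measure"
  assumes cpt: "compact (UNIV :: 'a set)" and c: "is_chart c"
    and \<nu>: "finite_measure \<nu>" "sets \<nu> = sets borel" and F: "closed F" and d: "0 < d" and \<epsilon>: "0 < \<epsilon>"
  obtains \<B> where "finite \<B>" "disjoint_family_on (\<lambda>B. B) \<B>"
    "\<And>B. B \<in> \<B> \<Longrightarrow> (\<exists>b. convex_cell B b) \<and> B \<inter> F = {} \<and> (\<forall>x\<in>B. \<forall>y\<in>B. dist x y < d)"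
    "measure \<nu> ((fst c - F) - \<Union>\<B>) \<le> \<epsilon>"
proof -
  define R where "R = fst c - F"
  have R: "open R" unfolding R_def using chart_simps(1)[OF c] F by (rule open_Diff)
  obtain L where L: "compact L" "L \<subseteq> R" "measure \<nu> (R - L) \<le> \<epsilon>/2"
    using inner_regular_open[OF cpt \<nu> R half_gt_zero[OF \<epsilon>]] by blast
  define K where "K = snd c ` L"
  have Lc: "L \<subseteq> fst c" using L(2) unfolding R_def by blast
  have K: "compact K"
    unfolding K_def by (rule compact_continuous_image[OF continuous_on_subset[OF chart_simps(3)[OF c] Lc] L(1)])
  \<comment> \<open>The mass outside the chart is sent to 0. This can only enlarge
    \<open>measure M (K - \<Union>\<C>)\<close>, which is used as an upper bound.\<close>
  define \<phi> where "\<phi> = (\<lambda>x. if x \<in> fst c then snd c x else 0)"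
  have \<phi>: "\<phi> \<in> \<nu> \<rightarrow>\<^sub>M borel"
  proof -
    have "\<phi> \<in> borel_measurable borel"
      unfolding \<phi>_def using chart_simps(1,3)[OF c]
      by (intro borel_measurable_continuous_on_if) auto
    then show ?thesis using measurable_cong_sets[OF \<nu>(2) refl] by blast
  qed
  define M where "M = distr \<nu> borel \<phi>"
  have M: "finite_measure M" "sets M = sets borel"
    unfolding M_def using finite_measure.finite_measure_distr[OF \<nu>(1) \<phi>] by auto
  \<comment> \<open>A Lebesgue number of this cover turns smallness in the chart into smallness in
    the manifold: a cube of diameter below it that meets \<open>K\<close> comes from a ball of
    radius \<open>d/2\<close>, inside the chart domain and off \<open>F\<close>.\<close>
  have "K \<subseteq> \<Union> (range (\<lambda>x. snd c ` (fst c \<inter> (- F \<inter> ball x (d/2)))))"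
  proof
    fix y assume "y \<in> K"
    then obtain x where x: "x \<in> L" "y = snd c x" unfolding K_def by blast
    then have "x \<in> fst c \<inter> (- F \<inter> ball x (d/2))" using L(2) d unfolding R_def by auto
    then show "y \<in> \<Union> (range (\<lambda>x. snd c ` (fst c \<inter> (- F \<inter> ball x (d/2)))))" using x(2) by blast
  qed
  moreover have "open S" if "S \<in> range (\<lambda>x. snd c ` (fst c \<inter> (- F \<inter> ball x (d/2))))" for S
    using that F open_chart_image[OF c] by (auto simp: open_Compl open_Int)
  ultimately obtain \<delta> where \<delta>: "0 < \<delta>"
    "\<And>y. y \<in> K \<Longrightarrow> \<exists>S\<in>range (\<lambda>x. snd c ` (fst c \<inter> (- F \<inter> ball x (d/2)))). ball y \<delta> \<subseteq> S"
    using Heine_Borel_lemma[OF K] by metis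
  obtain \<C> where \<C>: "finite \<C>" "disjoint_family_on (\<lambda>B. B) \<C>"
    "\<And>B. B \<in> \<C> \<Longrightarrow> compact B \<and> convex B \<and> B \<inter> K \<noteq> {} \<and> (\<forall>x\<in>B. \<forall>y\<in>B. dist x y < \<delta>)"
    "measure M (K - \<Union>\<C>) \<le> \<epsilon>/2"
    using disjoint_convex_cover_up_to[OF M K \<delta>(1), of "\<epsilon>/2"] \<epsilon> by (metis half_gt_zero)
  have sub: "\<exists>x. C \<subseteq> snd c ` (fst c \<inter> (- F \<inter> ball x (d/2)))" if C: "C \<in> \<C>" for C
  proof -
    obtain y where y: "y \<in> C" "y \<in> K" using \<C>(3)[OF C] by blast
    then have "C \<subseteq> ball y \<delta>" using \<C>(3)[OF C] by auto
    then show ?thesis using \<delta>(2)[OF y(2)] by blast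
  qed
  then have subc: "C \<subseteq> snd c ` fst c" if "C \<in> \<C>" for C using that by blast
  define \<B> where "\<B> = (\<lambda>C. chart_inv c ` C) ` \<C>"
  have eqB: "chart_inv c ` C = {x \<in> fst c. snd c x \<in> C}" if "C \<in> \<C>" for C
    by (rule chart_inv_image_eq[OF c subc[OF that]])
  have 1: "finite \<B>" unfolding \<B>_def using \<C>(1) by simp
  have 2: "disjoint_family_on (\<lambda>B. B) \<B>"
    unfolding disjoint_family_on_def
  proof (intro ballI impI)
    fix B B' assume "B \<in> \<B>" "B' \<in> \<B>" "B \<noteq> B'"
    then obtain C C' where C: "C \<in> \<C>" "C' \<in> \<C>" "B = chart_inv c ` C" "B' = chart_inv c ` C'" "C \<noteq> C'"
      unfolding \<B>_def by blast
    then have "C \<inter> C' = {}" using \<C>(2) by (simp add: disjoint_family_on_def)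
    then show "B \<inter> B' = {}" unfolding C(3,4) eqB[OF C(1)] eqB[OF C(2)] by blast
  qed
  have 3: "(\<exists>b. convex_cell B b) \<and> B \<inter> F = {} \<and> (\<forall>x\<in>B. \<forall>y\<in>B. dist x y < d)" if B: "B \<in> \<B>" for B
  proof -
    obtain C where C: "C \<in> \<C>" "B = chart_inv c ` C" using B unfolding \<B>_def by blast
    obtain p where p: "p \<in> C" using \<C>(3)[OF C(1)] by blast
    have "convex_cell B (chart_inv c p)"
      unfolding C(2) using \<C>(3)[OF C(1)] p by (intro chart_convex_cell[OF c _ _ subc[OF C(1)]]) auto
    moreover obtain x where x: "C \<subseteq> snd c ` (fst c \<inter> (- F \<inter> ball x (d/2)))" using sub[OF C(1)] by blast
    then have BF: "B \<subseteq> - F \<inter> ball x (d/2)"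
      unfolding C(2) using chart_simps(5)[OF c] by fastforce
    moreover have "dist y z < d" if "y \<in> B" "z \<in> B" for y z
    proof -
      have "dist x y < d/2" "dist x z < d/2" using BF that by auto
      then show ?thesis using dist_triangle3[of y z x] by simp
    qed
    ultimately show ?thesis by blast
  qed
  have closedB: "closed (chart_inv c ` C)" if "C \<in> \<C>" for C
  proof -
    have "compact C" using \<C>(3)[OF that] by blast
    from compact_chart_inv_image[OF c this subc[OF that]] show ?thesis by (rule compact_imp_closed)
  qed
  have UB: "\<Union>\<B> \<in> sets borel"
    unfolding \<B>_def using closedB \<C>(1) by (intro borel_closed closed_Union) auto
  have KC: "K - \<Union>\<C> \<in> sets borel"
  proof -
    have "closed (\<Union>\<C>)" using \<C>(1,3) compact_imp_closed by (intro closed_Union) auto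
    then show ?thesis using compact_imp_closed[OF K] by auto
  qed
  have "R - \<Union>\<B> \<subseteq> (R - L) \<union> (\<phi> -` (K - \<Union>\<C>) \<inter> space \<nu>)"
  proof
    fix x assume x: "x \<in> R - \<Union>\<B>"
    show "x \<in> (R - L) \<union> (\<phi> -` (K - \<Union>\<C>) \<inter> space \<nu>)"
    proof (cases "x \<in> L")
      case True
      then have xc: "x \<in> fst c" using Lc by blast
      have "snd c x \<notin> C" if "C \<in> \<C>" for C
        using x eqB[OF that] xc that unfolding \<B>_def by blast
      moreover have "space \<nu> = UNIV" using sets_eq_imp_space_eq[OF \<nu>(2)] by simp
      ultimately show ?thesis using xc True by (simp add: \<phi>_def K_def)
    qed (use x in blast)
  qed
  then have "measure \<nu> (R - \<Union>\<B>) \<le> measure \<nu> ((R - L) \<union> (\<phi> -` (K - \<Union>\<C>) \<inter> space \<nu>))"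
    using R compact_imp_closed[OF L(1)] measurable_sets[OF \<phi> KC] \<nu>(2)
    by (intro finite_measure.finite_measure_mono[OF \<nu>(1)]) (auto simp: borel_open open_Diff)
  also have "\<dots> \<le> measure \<nu> (R - L) + measure \<nu> (\<phi> -` (K - \<Union>\<C>) \<inter> space \<nu>)"
    using R compact_imp_closed[OF L(1)] measurable_sets[OF \<phi> KC] \<nu>(2)
    by (intro measure_Un_le) (auto simp: borel_open open_Diff)
  also have "measure \<nu> (\<phi> -` (K - \<Union>\<C>) \<inter> space \<nu>) = measure M (K - \<Union>\<C>)"
    unfolding M_def by (rule measure_distr[OF \<phi> KC, symmetric])
  also have "measure \<nu> (R - L) + measure M (K - \<Union>\<C>) \<le> \<epsilon>"
    using L(3) \<C>(4) by simp
  finally have 4: "measure \<nu> ((fst c - F) - \<Union>\<B>) \<le> \<epsilon>" unfolding R_def .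
  show ?thesis using 1 2 3 4 by (rule that)
qed

context manifold
begin

text \<open>Finitely many charts are treated one by one, each filling up to a small error what the
  closed union of the earlier cells has left over. The errors add up.\<close>

lemma cell_decomposition:
  fixes \<nu> :: "'a measure"
  assumes cpt: "compact (UNIV :: 'a set)" and \<nu>: "finite_measure \<nu>" "sets \<nu> = sets borel"
    and d: "0 < d" and \<epsilon>: "0 < \<epsilon>"
  obtains \<B> where "finite \<B>" "disjoint_family_on (\<lambda>B. B) \<B>"
    "\<And>B. B \<in> \<B> \<Longrightarrow> (\<exists>b. convex_cell B b) \<and> (\<forall>x\<in>B. \<forall>y\<in>B. dist x y < d)"
    "measure \<nu> (- \<Union>\<B>) \<le> \<epsilon>"
proof -
  obtain C where C: "finite C" "C \<subseteq> A" "UNIV \<subseteq> (\<Union>c\<in>C. fst c)"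
  proof (rule compactE_image[OF cpt, of A fst])
    show "UNIV \<subseteq> (\<Union>c\<in>A. fst c)" using charts_cover by blast
  qed (use charts chart_simps(1) in blast)+
  have main: "\<exists>\<B>. finite \<B> \<and> disjoint_family_on (\<lambda>B. B) \<B> \<and>
      (\<forall>B\<in>\<B>. (\<exists>b. convex_cell B b) \<and> (\<forall>x\<in>B. \<forall>y\<in>B. dist x y < d)) \<and>
      measure \<nu> ((\<Union>c\<in>C. fst c) - \<Union>\<B>) \<le> card C * e" if e: "0 < e" and "C \<subseteq> A" "finite C" for C and e :: real
    using that(3,2)
  proof (induction C rule: finite_induct)
    case empty
    then show ?case by (intro exI[of _ "{}"]) (simp add: disjoint_family_on_def)
  next
    case (insert c C)
    then obtain \<B> where \<B>: "finite \<B>" "disjoint_family_on (\<lambda>B. B) \<B>"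
      "\<And>B. B \<in> \<B> \<Longrightarrow> (\<exists>b. convex_cell B b) \<and> (\<forall>x\<in>B. \<forall>y\<in>B. dist x y < d)"
      "measure \<nu> ((\<Union>c\<in>C. fst c) - \<Union>\<B>) \<le> card C * e" by auto
    have clB: "closed B" if "B \<in> \<B>" for B
      using \<B>(3)[OF that] by (auto simp: convex_cell_def compact_imp_closed)
    then have clU: "closed (\<Union>\<B>)" using \<B>(1) by (intro closed_Union) auto
    have c: "is_chart c" using insert.prems charts by simp
    obtain \<C> where \<C>: "finite \<C>" "disjoint_family_on (\<lambda>B. B) \<C>"
      "\<And>B. B \<in> \<C> \<Longrightarrow> (\<exists>b. convex_cell B b) \<and> B \<inter> \<Union>\<B> = {} \<and> (\<forall>x\<in>B. \<forall>y\<in>B. dist x y < d)"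
      "measure \<nu> ((fst c - \<Union>\<B>) - \<Union>\<C>) \<le> e"
      using chart_cells[OF cpt c \<nu> clU d e] by blast
    have clC: "closed B" if "B \<in> \<C>" for B
      using \<C>(3)[OF that] by (auto simp: convex_cell_def compact_imp_closed)
    then have clUC: "closed (\<Union>\<C>)" using \<C>(1) by (intro closed_Union) auto
    have dis: "disjoint_family_on (\<lambda>B. B) (\<B> \<union> \<C>)"
      unfolding disjoint_family_on_def
    proof (intro ballI impI)
      fix S S' assume S: "S \<in> \<B> \<union> \<C>" "S' \<in> \<B> \<union> \<C>" "S \<noteq> S'"
      then consider "S \<in> \<B>" "S' \<in> \<B>" | "S \<in> \<C>" "S' \<in> \<C>" | "S \<in> \<B>" "S' \<in> \<C>" | "S \<in> \<C>" "S' \<in> \<B>"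
        by blast
      then show "S \<inter> S' = {}"
      proof cases
        case 1 then show ?thesis using \<B>(2) S(3) by (simp add: disjoint_family_on_def)
      next
        case 2 then show ?thesis using \<C>(2) S(3) by (simp add: disjoint_family_on_def)
      next
        case 3 then show ?thesis using \<C>(3)[of S'] by blast
      next
        case 4 then show ?thesis using \<C>(3)[of S] by blast
      qed
    qed
    have opC: "open (\<Union>c\<in>C. fst c)" "open (fst c)"
      using insert.prems charts chart_simps(1) by (blast intro: open_UN)+
    have "(\<Union>c\<in>insert c C. fst c) - \<Union>(\<B> \<union> \<C>) \<subseteq> ((\<Union>c\<in>C. fst c) - \<Union>\<B>) \<union> ((fst c - \<Union>\<B>) - \<Union>\<C>)"
      by blast
    then have "measure \<nu> ((\<Union>c\<in>insert c C. fst c) - \<Union>(\<B> \<union> \<C>)) \<le>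
        measure \<nu> (((\<Union>c\<in>C. fst c) - \<Union>\<B>) \<union> ((fst c - \<Union>\<B>) - \<Union>\<C>))"
      using opC clU clUC
      by (intro finite_measure.finite_measure_mono[OF \<nu>(1)]) (simp_all add: \<nu>(2) borel_open open_Diff open_Un)
    also have "\<dots> \<le> measure \<nu> ((\<Union>c\<in>C. fst c) - \<Union>\<B>) + measure \<nu> ((fst c - \<Union>\<B>) - \<Union>\<C>)"
      using opC clU clUC by (intro measure_Un_le) (simp_all add: \<nu>(2) borel_open open_Diff)
    also have "\<dots> \<le> card (insert c C) * e"
      using \<B>(4) \<C>(4) insert.hyps by (simp add: algebra_simps)
    finally have le: "measure \<nu> ((\<Union>c\<in>insert c C. fst c) - \<Union>(\<B> \<union> \<C>)) \<le> card (insert c C) * e" .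
    have "\<forall>B\<in>\<B> \<union> \<C>. (\<exists>b. convex_cell B b) \<and> (\<forall>x\<in>B. \<forall>y\<in>B. dist x y < d)"
      using \<B>(3) \<C>(3) by blast
    then show ?case using \<B>(1) \<C>(1) dis le by (intro exI[of _ "\<B> \<union> \<C>"]) simp
  qed
  define e where "e = \<epsilon> / (card C + 1)"
  have "0 < e" using \<epsilon> by (simp add: e_def)
  from main[OF this C(2,1)] obtain \<B> where \<B>: "finite \<B>" "disjoint_family_on (\<lambda>B. B) \<B>"
    "\<And>B. B \<in> \<B> \<Longrightarrow> (\<exists>b. convex_cell B b) \<and> (\<forall>x\<in>B. \<forall>y\<in>B. dist x y < d)"
    "measure \<nu> ((\<Union>c\<in>C. fst c) - \<Union>\<B>) \<le> card C * e" by blast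
  have "(\<Union>c\<in>C. fst c) - \<Union>\<B> = - \<Union>\<B>" using C(3) by blast
  moreover have "card C * e \<le> \<epsilon>" using \<epsilon> by (simp add: e_def field_simps)
  ultimately have "measure \<nu> (- \<Union>\<B>) \<le> \<epsilon>" using \<B>(4) by simp
  with \<B>(1-3) show ?thesis by (rule that)
qed

end

section \<open>Faithful diffuse measures and the transport constant\<close>

lemma good_measuresD:
  fixes \<mu> :: "'a::metric_space measure"
  assumes "\<mu> \<in> good_measures"
  shows "sets \<mu> = sets borel" "prob_space \<mu>" "finite_measure \<mu>" "faithful_measure \<mu>" "measure \<mu> {x} = 0"
  using assms diffuse_measure_singleton[of \<mu>] unfolding good_measures_def
  by (auto intro: prob_space.finite_measure)

text \<open>A countable pi-base, so that a measure is faithful as soon as it charges each of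
  countably many sets.\<close>

lemma countable_open_refinement:
  assumes cpt: "compact (UNIV :: 'a::metric_space set)"
  obtains U :: "nat \<Rightarrow> 'a::metric_space set" where "\<And>n. open (U n)" "\<And>n. U n \<noteq> {}"
    "\<And>V. open V \<Longrightarrow> V \<noteq> {} \<Longrightarrow> \<exists>n. U n \<subseteq> V"
proof -
  have "\<exists>f. \<exists>n::nat. (\<Union>i<n. ball (f i) (1 / Suc k)) = (UNIV :: 'a set)" for k
    using compact_UNIV_finite_net[OF cpt, of "1 / Suc k"] by (metis of_nat_0_less_iff zero_less_Suc zero_less_divide_1_iff)
  then obtain f :: "nat \<Rightarrow> nat \<Rightarrow> 'a" and m where f: "\<And>k. (\<Union>i<m k. ball (f k i) (1 / Suc k)) = UNIV"
    by metis
  define U where "U = (\<lambda>n. case prod_decode n of (k, i) \<Rightarrow> ball (f k i) (1 / Suc k))"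
  have "\<exists>n. U n \<subseteq> V" if V: "open V" "V \<noteq> {}" for V
  proof -
    obtain x e where x: "0 < e" "ball x e \<subseteq> V" using V by (metis ex_in_conv open_contains_ball)
    obtain k where k: "inverse (real (Suc k)) < e / 2" using reals_Archimedean[of "e/2"] x(1) by auto
    obtain i where i: "x \<in> ball (f k i) (1 / Suc k)" using f[of k] by blast
    have "ball (f k i) (1 / Suc k) \<subseteq> ball x e"
    proof
      fix y assume "y \<in> ball (f k i) (1 / Suc k)"
      then have "dist x y < 1 / Suc k + 1 / Suc k" using i dist_triangle3[of x y "f k i"] by simp
      then show "y \<in> ball x e" using k by (simp add: inverse_eq_divide)
    qed
    then show ?thesis using x(2) by (intro exI[of _ "prod_encode (k, i)"]) (auto simp: U_def)
  qed
  moreover have "open (U n)" "U n \<noteq> {}" for n by (simp_all add: U_def case_prod_beta)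
  ultimately show ?thesis by (intro that[of U])
qed

context manifold
begin

text \<open>Uniform measure on a coordinate segment inside \<open>V\<close>. The segment is
  parametrised injectively, so points are null.\<close>

lemma null_prob_measure_on_open:
  fixes V :: "'a set"
  assumes V: "open V" "V \<noteq> {}"
  shows "\<exists>\<kappa>. sets \<kappa> = sets borel \<and> prob_space \<kappa> \<and> (\<forall>x. measure \<kappa> {x} = 0) \<and> measure \<kappa> V = 1"
proof -
  obtain a where a: "a \<in> V" using V(2) by blast
  obtain c where cA: "c \<in> A" "a \<in> fst c" using charts_cover by blast
  note c = charts[OF cA(1)]
  obtain \<rho> where \<rho>: "0 < \<rho>" "cball (snd c a) \<rho> \<subseteq> snd c ` (fst c \<inter> V)"
    using chart_cball[OF c V(1) a cA(2)] by blast
  obtain e :: 'e where e: "e \<in> Basis" using nonempty_Basis by blast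
  define l where "l = (\<lambda>t::real. snd c a + (\<rho> * min 1 (max 0 t)) *\<^sub>R e)"
  define \<gamma> where "\<gamma> = (\<lambda>t. chart_inv c (l t))"
  have lc: "l t \<in> cball (snd c a) \<rho>" for t
    using \<rho>(1) e by (auto simp: l_def dist_norm abs_mult mult_le_cancel_left1)
  then have lV: "l t \<in> snd c ` (fst c \<inter> V)" for t using \<rho>(2) by blast
  then have lfst: "l t \<in> snd c ` fst c" for t by blast
  have "continuous_on UNIV l" unfolding l_def by (intro continuous_intros)
  then have "continuous_on UNIV \<gamma>"
    unfolding \<gamma>_def by (rule continuous_on_compose2[OF chart_simps(4)[OF c]]) (use lfst in blast)
  then have meas: "\<gamma> \<in> borel \<rightarrow>\<^sub>M borel" by (rule borel_measurable_continuous_onI)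
  define I :: "real measure" where "I = uniform_measure lborel {0..1}"
  have I: "prob_space I" unfolding I_def by (intro prob_space_uniform_measure) auto
  have sI: "sets I = sets borel" unfolding I_def by simp
  have spI: "space I = UNIV" unfolding I_def by simp
  have \<gamma>: "\<gamma> \<in> I \<rightarrow>\<^sub>M borel" using meas measurable_cong_sets[OF sI refl] by blast
  define \<kappa> where "\<kappa> = distr I borel \<gamma>"
  have "sets \<kappa> = sets borel" unfolding \<kappa>_def by simp
  moreover have "prob_space \<kappa>" unfolding \<kappa>_def by (rule prob_space.prob_space_distr[OF I \<gamma>])
  moreover have "measure \<kappa> V = 1"
  proof -
    have "\<gamma> t \<in> V" for t
      unfolding \<gamma>_def using lV[of t] chart_simps(5)[OF c] by auto
    then have "\<gamma> -` V \<inter> space I = space I" by auto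
    then show ?thesis
      unfolding \<kappa>_def using measure_distr[OF \<gamma>, of V] V(1) prob_space.prob_space[OF I] by simp
  qed
  moreover have "measure \<kappa> {x} = 0" for x
  proof -
    have inj: "s = t" if "s \<in> {0..1} \<inter> \<gamma> -` {x}" "t \<in> {0..1} \<inter> \<gamma> -` {x}" for s t
    proof -
      have "\<gamma> s = \<gamma> t" using that by simp
      then have "l s = l t" using chart_simps(6)[OF c lfst] unfolding \<gamma>_def by metis
      then show ?thesis using that \<rho>(1) nonzero_Basis[OF e] by (simp add: l_def)
    qed
    have "finite ({0..1} \<inter> \<gamma> -` {x})"
    proof (cases "{0..1} \<inter> \<gamma> -` {x} = {}")
      case False
      then obtain s where s: "s \<in> {0..1} \<inter> \<gamma> -` {x}" by blast
      then have "{0..1} \<inter> \<gamma> -` {x} \<subseteq> {s}" using inj by blast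
      then show ?thesis by (rule finite_subset) simp
    qed simp
    then have "measure lborel ({0..1} \<inter> \<gamma> -` {x}) = 0"
      using finite_imp_null_set_lborel measure_eq_0_null_sets by blast
    moreover have "\<gamma> -` {x} \<in> sets lborel" using measurable_sets[OF meas, of "{x}"] by simp
    ultimately have "measure I (\<gamma> -` {x}) = 0"
      unfolding I_def by (subst measure_uniform_measure) auto
    then show ?thesis unfolding \<kappa>_def using measure_distr[OF \<gamma>, of "{x}"] spI by simp
  qed
  ultimately show ?thesis by blast
qed

text \<open>A countable mixture of measures with null points, one living on \<open>V\<close> and one
  on each member of a pi-base. It supplies the pair of measures for the lower bound on the transport
  constant.\<close>

lemma good_measure_concentrated:
  fixes V :: "'a set"
  assumes cpt: "compact (UNIV :: 'a set)" and V: "open V" "V \<noteq> {}"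
  shows "\<exists>\<kappa>\<in>good_measures. 3/4 \<le> measure \<kappa> V"
proof -
  obtain U :: "nat \<Rightarrow> 'a set" where U: "\<And>n. open (U n)" "\<And>n. U n \<noteq> {}"
    "\<And>V. open V \<Longrightarrow> V \<noteq> {} \<Longrightarrow> \<exists>n. U n \<subseteq> V"
    using countable_open_refinement[OF cpt] by metis
  define U' where "U' = (\<lambda>n. case n of 0 \<Rightarrow> V | Suc n \<Rightarrow> U n)"
  have "\<exists>\<kappa>. sets \<kappa> = sets borel \<and> prob_space \<kappa> \<and> (\<forall>x. measure \<kappa> {x} = 0) \<and> measure \<kappa> (U' n) = 1" for n
    unfolding U'_def using V U(1,2) by (cases n) (auto intro!: null_prob_measure_on_open)
  then obtain L where L: "\<And>n. sets (L n) = sets borel" "\<And>n. prob_space (L n)"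
    "\<And>n x. measure (L n) {x} = 0" "\<And>n. measure (L n) (U' n) = 1" by metis
  \<comment> \<open>Index 0, which belongs to \<open>V\<close>, gets weight \<open>3/4\<close>; all
    other weights are positive, which gives full support.\<close>
  define G where "G = geometric_pmf (3/4)"
  have pmfG: "pmf G n = (1/4) ^ n * (3/4)" for n unfolding G_def by simp
  have Lm: "L \<in> measure_pmf G \<rightarrow>\<^sub>M subprob_algebra borel"
    using L(1,2) by (auto simp: space_subprob_algebra measurable_def prob_space_imp_subprob_space)
  define \<kappa> where "\<kappa> = measure_pmf G \<bind> L"
  have sets: "sets \<kappa> = sets borel" unfolding \<kappa>_def by (rule sets_bind) (use L(1) in auto)
  have prob: "prob_space \<kappa>"
    unfolding \<kappa>_def by (rule prob_space.prob_space_bind[OF prob_space_measure_pmf _ Lm]) (simp add: L(2))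
  have em: "emeasure \<kappa> S = (\<integral>\<^sup>+ n. emeasure (L n) S \<partial>measure_pmf G)" if "S \<in> sets borel" for S
    unfolding \<kappa>_def by (rule emeasure_bind[OF _ Lm that]) simp
  have ge: "pmf G n * measure (L n) S \<le> measure \<kappa> S" if S: "S \<in> sets borel" for n S
  proof -
    have "ennreal (pmf G n * measure (L n) S) = emeasure (L n) S * emeasure (measure_pmf G) {n}"
      using L(2)[of n] by (simp add: emeasure_pmf_single finite_measure.emeasure_eq_measure
          prob_space.finite_measure ennreal_mult mult.commute)
    also have "\<dots> = (\<integral>\<^sup>+ i. emeasure (L n) S * indicator {n} i \<partial>measure_pmf G)"
      by (simp add: nn_integral_cmult_indicator)
    also have "\<dots> \<le> (\<integral>\<^sup>+ i. emeasure (L i) S \<partial>measure_pmf G)"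
      by (intro nn_integral_mono) (auto simp: indicator_def)
    also have "\<dots> = ennreal (measure \<kappa> S)"
      using em[OF S] prob by (simp add: finite_measure.emeasure_eq_measure prob_space.finite_measure)
    finally show ?thesis by (simp add: ennreal_le_iff)
  qed
  have "measure \<kappa> {x} = 0" for x
  proof -
    have "emeasure (L n) {x} = 0" for n
      using L(2,3)[of n] by (simp add: finite_measure.emeasure_eq_measure prob_space.finite_measure)
    then have "emeasure \<kappa> {x} = 0" by (simp add: em)
    then show ?thesis by (simp add: measure_def)
  qed
  then have "diffuse_measure \<kappa>"
    using prob by (intro diffuse_measureI[OF cpt sets] prob_space.finite_measure)
  moreover have "faithful_measure \<kappa>"
    unfolding faithful_measure_def
  proof (intro allI impI)
    fix W :: "'a set" assume W: "open W \<and> W \<noteq> {}"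
    then obtain n where n: "U n \<subseteq> W" using U(3) by blast
    have "measure (L (Suc n)) (U' (Suc n)) \<le> measure (L (Suc n)) W"
      using n W L(1,2) by (intro finite_measure.finite_measure_mono prob_space.finite_measure) (auto simp: U'_def)
    then have "1 \<le> measure (L (Suc n)) W" by (simp add: L(4))
    moreover have "pmf G (Suc n) * measure (L (Suc n)) W \<le> measure \<kappa> W" using W by (intro ge) auto
    moreover have "0 < pmf G (Suc n)" by (simp add: pmfG)
    ultimately show "0 < measure \<kappa> W"
      by (smt (verit) mult_pos_pos)
  qed
  ultimately have "\<kappa> \<in> good_measures" using sets prob by (simp add: good_measures_def)
  moreover have "3/4 \<le> measure \<kappa> V"
    using ge[of V 0] V(1) L(4)[of 0] by (simp add: pmfG U'_def)
  ultimately show ?thesis by blast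
qed

end

section \<open>The lower bound for displacements\<close>

lemma distr_homeo:
  fixes \<nu> :: "'a::metric_space measure"
  assumes \<nu>: "sets \<nu> = sets borel" "prob_space \<nu>" and h: "h \<in> homeos_homotopic_id"
  shows "prob_space (distr \<nu> borel h)" "sets (distr \<nu> borel h) = sets borel"
    "U \<in> sets borel \<Longrightarrow> measure (distr \<nu> borel h) U = measure \<nu> (h -` U)"
    "U \<in> sets borel \<Longrightarrow> h -` U \<in> sets borel"
proof -
  have "continuous_on UNIV h" using h by (auto simp: homeos_homotopic_id_def homeomorphism_def)
  then have hb: "h \<in> borel \<rightarrow>\<^sub>M borel" by (rule borel_measurable_continuous_onI)
  then have hm: "h \<in> \<nu> \<rightarrow>\<^sub>M borel" using measurable_cong_sets[OF \<nu>(1) refl] by blast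
  show "prob_space (distr \<nu> borel h)" by (rule prob_space.prob_space_distr[OF \<nu>(2) hm])
  show "sets (distr \<nu> borel h) = sets borel" by simp
  have sp: "space \<nu> = UNIV" using sets_eq_imp_space_eq[OF \<nu>(1)] by simp
  show "measure (distr \<nu> borel h) U = measure \<nu> (h -` U)" if "U \<in> sets borel"
    using measure_distr[OF hm that] sp by simp
  show "h -` U \<in> sets borel" if "U \<in> sets borel"
    using measurable_sets[OF hb that] by simp
qed

lemma dist_le_displacement:
  fixes h :: "'a::metric_space \<Rightarrow> 'a"
  assumes cpt: "compact (UNIV :: 'a set)"
  shows "dist (h x) x \<le> displacement h"
proof -
  obtain D where "\<And>x y :: 'a. dist x y \<le> D" using compact_UNIV_dist_bound[OF cpt] by blast
  then have "bdd_above (range (\<lambda>x. dist (h x) x))" by (intro bdd_aboveI[of _ D]) auto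
  then show ?thesis unfolding displacement_def by (rule cSUP_upper[OF UNIV_I])
qed

text \<open>Pass from \<open>\<mu>\<close> to the image measure at cost \<open>r\<close>, after
  swapping the two measures, and from there to \<open>\<nu>\<close> at cost
  \<open>displacement h\<close>, since points whose images are within \<open>r\<close> of
  \<open>V\<close> are within \<open>r + displacement h\<close> of \<open>V\<close>.\<close>

lemma W_inf_le_displacement:
  fixes \<mu> \<nu> :: "'a::metric_space measure"
  assumes cpt: "compact (UNIV :: 'a set)" and \<mu>: "\<mu> \<in> good_measures" and \<nu>: "\<nu> \<in> good_measures"
    and h: "h \<in> H0 \<nu> \<mu> \<epsilon>"
  shows "W_inf \<mu> \<nu> \<le> displacement h + \<epsilon>"
proof -
  have hh: "h \<in> homeos_homotopic_id" and W: "W_inf (distr \<nu> borel h) \<mu> < \<epsilon>"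
    using h by (auto simp: H0_def)
  note \<mu>' = good_measuresD(1,2)[OF \<mu>] and \<nu>' = good_measuresD(1,2)[OF \<nu>]
  note dh = distr_homeo[OF \<nu>' hh]
  let ?\<nu>h = "distr \<nu> borel h"
  obtain r where r: "0 < r" "r < \<epsilon>"
    "\<And>U. U \<in> sets borel \<Longrightarrow> measure ?\<nu>h U \<le> measure \<mu> {x. infdist x U < r}"
    by (rule W_inf_lessE[OF cpt dh(2,1) \<mu>' W]) blast
  have D0: "0 \<le> displacement h"
    using dist_le_displacement[OF cpt, of h undefined] zero_le_dist order_trans by blast
  have "W_inf \<mu> \<nu> \<le> r + displacement h"
  proof (rule W_inf_le)
    show "0 < r + displacement h" using r(1) D0 by simp
    fix V :: "'a set" assume V: "V \<in> sets borel"
    have oV: "{x. infdist x V < s} \<in> sets borel" for s by (intro borel_open open_infdist_less)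
    have "measure \<mu> V \<le> measure ?\<nu>h {x. infdist x V < r}"
      by (rule W_inf_bound_swap[OF dh(2,1) \<mu>' r(3) V])
    also have "\<dots> = measure \<nu> (h -` {x. infdist x V < r})" by (rule dh(3)[OF oV])
    also have "\<dots> \<le> measure \<nu> {x. infdist x V < r + displacement h}"
    proof (rule finite_measure.finite_measure_mono[OF good_measuresD(3)[OF \<nu>]])
      show "{x. infdist x V < r + displacement h} \<in> sets \<nu>" using oV \<nu>'(1) by simp
      have "infdist x V < r + displacement h" if "infdist (h x) V < r" for x
        using infdist_triangle[of x V "h x"] dist_le_displacement[OF cpt, of h x] that
        by (simp add: dist_commute)
      then show "h -` {x. infdist x V < r} \<subseteq> {x. infdist x V < r + displacement h}" by auto
    qed
    finally show "measure \<mu> V \<le> measure \<nu> {x. infdist x V < r + displacement h}" .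
  qed
  then show ?thesis using r(2) by simp
qed

section \<open>Approximate transport and the value of the constant\<close>

context length_manifold
begin

lemma approximate_transport:
  fixes \<mu> \<nu> :: "'a measure"
  assumes \<mu>: "\<mu> \<in> good_measures" and \<nu>: "\<nu> \<in> good_measures" and \<epsilon>: "0 < \<epsilon>"
  shows "\<exists>h\<in>H0 \<nu> \<mu> \<epsilon>. displacement h < W_inf \<mu> \<nu> + \<epsilon>"
proof -
  note \<mu>' = good_measuresD[OF \<mu>] and \<nu>' = good_measuresD[OF \<nu>]
  \<comment> \<open>The displacement will stay within
    \<open>r + 8 * \<eta> = r + \<epsilon>/8\<close>, and the pieces meeting the estimate stay
    within \<open>2 * \<eta>\<close> of \<open>U\<close>, well below
    \<open>\<epsilon>/4\<close>.\<close>
  define \<eta> where "\<eta> = \<epsilon> / 64"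
  have \<eta>: "0 < \<eta>" using \<epsilon> by (simp add: \<eta>_def)
  have "W_inf \<mu> \<nu> < W_inf \<mu> \<nu> + \<epsilon>/4" using \<epsilon> by simp
  then obtain r where r: "0 < r" "r < W_inf \<mu> \<nu> + \<epsilon>/4"
    "\<And>U. U \<in> sets borel \<Longrightarrow> measure \<mu> U \<le> measure \<nu> {x. infdist x U < r}"
    using W_inf_lessE[OF compact_space \<mu>'(1,2) \<nu>'(1,2)] by metis
  have r': "measure \<nu> V \<le> measure \<mu> {x. infdist x V < r}" if "V \<in> sets borel" for V
    by (rule W_inf_bound_swap[OF \<mu>'(1,2) \<nu>'(1,2) r(3) that])
  \<comment> \<open>The error \<open>c\<close> is split in two: \<open>c/2\<close> for the mass
    outside the cells and \<open>c/2\<close> for overloaded pieces. The radius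
    \<open>\<epsilon>/2\<close> leaves room for the strict inequality in \<open>H0\<close>.\<close>
  obtain c where c: "0 < c" "\<And>\<nu>. \<lbrakk>prob_space \<nu>;
    \<And>U. U \<in> sets borel \<Longrightarrow> measure \<nu> U \<le> measure \<mu> {x. infdist x U < \<epsilon>/2/2} + c\<rbrakk> \<Longrightarrow> W_inf \<nu> \<mu> \<le> \<epsilon>/2"
    using W_inf_le_of_approx[OF compact_space connected_space \<mu>'(1,2,4) half_gt_zero[OF \<epsilon>]] by metis
  obtain P :: "nat \<Rightarrow> 'a set" and z n where P: "\<And>i. P i \<in> sets borel" "\<And>i. P i \<subseteq> ball (z i) \<eta>"
    "disjoint_family P" "(\<Union>i<n. P i) = UNIV"
    using finite_small_partition[OF compact_space \<eta>] by metis
  \<comment> \<open>Each of at most \<open>n\<close> pieces may be overloaded by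
    \<open>n * \<tau>\<close>, in total \<open>n * n * \<tau>\<close>; the added 1 makes
    \<open>q\<close> visibly positive.\<close>
  define q where "q = real n * real n + 1"
  have q: "0 < q" unfolding q_def by (simp add: add_nonneg_pos)
  define \<tau> where "\<tau> = c / (2 * q)"
  have \<tau>: "0 < \<tau>" unfolding \<tau>_def using c(1) q by simp
  have "q * \<tau> = c / 2" unfolding \<tau>_def using q by simp
  then have n\<tau>: "n * n * \<tau> \<le> c / 2" using \<tau> by (simp add: q_def algebra_simps)
  obtain d1 where d1: "0 < d1"
    "\<And>B. \<lbrakk>B \<in> sets borel; \<And>x y. x \<in> B \<Longrightarrow> y \<in> B \<Longrightarrow> dist x y < d1\<rbrakk> \<Longrightarrow> measure \<nu> B \<le> \<tau>"
    using small_sets_small_measure[OF compact_space \<nu>'(1,3,5) \<tau>] by metis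
  define d where "d = min \<eta> d1"
  have d: "0 < d" "d \<le> \<eta>" "d \<le> d1" using \<eta> d1(1) by (auto simp: d_def)
  obtain \<B> where \<B>: "finite \<B>" "disjoint_family_on (\<lambda>B. B) \<B>"
    "\<And>B. B \<in> \<B> \<Longrightarrow> (\<exists>b. convex_cell B b) \<and> (\<forall>x\<in>B. \<forall>y\<in>B. dist x y < d)"
    "measure \<nu> (- \<Union>\<B>) \<le> c/2"
    using cell_decomposition[OF compact_space \<nu>'(3,1) d(1) half_gt_zero[OF c(1)]] by metis
  obtain b where b: "\<And>B. B \<in> \<B> \<Longrightarrow> convex_cell B (b B)" using \<B>(3) by metis
  have bB: "b B \<in> B" "compact B" if "B \<in> \<B>" for B using b[OF that] by (auto simp: convex_cell_def)
  have Bborel: "B \<in> sets borel" if "B \<in> \<B>" for B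
    by (rule borel_closed[OF compact_imp_closed[OF bB(2)[OF that]]])
  have small: "measure \<nu> B \<le> \<tau>" if "B \<in> \<B>" for B
    using \<B>(3)[OF that] d(3) by (intro d1(2)[OF Bborel[OF that]]) fastforce
  \<comment> \<open>The slack \<open>2 * \<eta>\<close> absorbs the diameter of a cell and the
    radius of a piece, so \<open>N B\<close> contains every piece that meets the
    \<open>r\<close>-neighbourhood of \<open>B\<close>. That yields the Hall condition.\<close>
  define N where "N = (\<lambda>B. {j\<in>{..<n}. dist (b B) (z j) < r + 2 * \<eta>})"
  have "N B \<noteq> {}" for B
  proof -
    obtain j where j: "j < n" "b B \<in> P j" using P(4) by blast
    then have "dist (b B) (z j) < \<eta>" using P(2)[of j] by (auto simp: dist_commute)
    then have "j \<in> N B" using j(1) r(1) \<eta> by (simp add: N_def)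
    then show ?thesis by blast
  qed
  have Hall: "sum (measure \<nu>) S \<le> sum (\<lambda>j. measure \<mu> (P j)) (\<Union>B\<in>S. N B)" if S: "S \<subseteq> \<B>" for S
  proof (cases "S = {}")
    case False
    have finS: "finite S" by (rule finite_subset[OF S \<B>(1)])
    have US: "\<Union>S \<in> sets borel" using finS S Bborel by (intro sets.finite_Union) auto
    have "sum (measure \<nu>) S = measure \<nu> (\<Union>B\<in>S. B)"
      using S Bborel \<nu>'(1) disjoint_family_on_mono[OF S \<B>(2)]
      by (intro finite_measure.finite_measure_finite_Union[OF \<nu>'(3) finS, symmetric]) auto
    also have "\<dots> \<le> measure \<mu> {x. infdist x (\<Union>S) < r}" using r'[OF US] by simp
    also have "\<dots> \<le> measure \<mu> (\<Union>j\<in>(\<Union>B\<in>S. N B). P j)"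
    proof (rule finite_measure.finite_measure_mono[OF \<mu>'(3)])
      show "(\<Union>j\<in>(\<Union>B\<in>S. N B). P j) \<in> sets \<mu>"
        unfolding \<mu>'(1) using P(1) finS by (intro sets.finite_UN) (auto simp: N_def)
      show "{x. infdist x (\<Union>S) < r} \<subseteq> (\<Union>j\<in>(\<Union>B\<in>S. N B). P j)"
      proof clarify
        fix x assume x: "infdist x (\<Union>S) < r"
        have "\<Union>S \<noteq> {}" using False S bB(1) by blast
        then obtain B u where u: "B \<in> S" "u \<in> B" "dist x u < r"
          using infdist_lessE[OF x] by blast
        then have BB: "B \<in> \<B>" using S by blast
        obtain j where j: "j < n" "x \<in> P j" using P(4) by blast
        have "dist (b B) u < d" using \<B>(3)[OF BB] bB(1)[OF BB] u(2) by blast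
        moreover have "dist x (z j) < \<eta>" using P(2)[of j] j(2) by (auto simp: dist_commute)
        ultimately have "dist (b B) (z j) < r + 2 * \<eta>"
          using d(2) u(3) dist_triangle[of "b B" "z j" u] dist_triangle[of u "z j" x] dist_commute[of u x] by linarith
        then have "j \<in> N B" using j(1) by (simp add: N_def)
        then show "x \<in> (\<Union>j\<in>(\<Union>B\<in>S. N B). P j)" using u(1) j(2) by blast
      qed
    qed
    also have "\<dots> \<le> sum (\<lambda>j. measure \<mu> (P j)) (\<Union>B\<in>S. N B)"
      using P(1) finS \<mu>'(1)
      by (intro finite_measure.finite_measure_subadditive_finite[OF \<mu>'(3)]) (auto simp: N_def)
    finally show ?thesis .
  qed simp
  obtain f where f: "\<And>B. B \<in> \<B> \<Longrightarrow> f B \<in> N B"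
    "\<And>j. j \<in> {..<n} \<Longrightarrow> sum (measure \<nu>) {B\<in>\<B>. f B = j} \<le> measure \<mu> (P j) + card {..<n} * \<tau>"
  proof (rule balanced_assignment[of \<B> "{..<n}" "measure \<nu>" \<tau> "\<lambda>j. measure \<mu> (P j)" N])
    show "N B \<noteq> {}" for B by fact
  qed (use \<B>(1) small \<tau> Hall in \<open>auto simp: N_def\<close>)
  obtain h where h: "h \<in> homeos_homotopic_id" "\<And>B. B \<in> \<B> \<Longrightarrow> h ` B \<subseteq> ball (z (f B)) \<eta>"
    "\<And>x. dist (h x) x < (r + 2 * \<eta>) + d + 5 * \<eta>"
  proof (rule transport_cells[of \<B> "\<lambda>B. B" b d "\<lambda>B. z (f B)" "r + 2 * \<eta>" \<eta>])
    show "dist (b B) (z (f B)) < r + 2 * \<eta>" if "B \<in> \<B>" for B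
      using f(1)[OF that] by (simp add: N_def)
  qed (use \<B> b \<eta> d r(1) in auto)
  have "displacement h \<le> r + 8 * \<eta>"
    unfolding displacement_def
  proof (rule cSUP_least)
    fix x show "dist (h x) x \<le> r + 8 * \<eta>" using h(3)[of x] d(2) by linarith
  qed simp
  then have disp: "displacement h < W_inf \<mu> \<nu> + \<epsilon>" using r(2) \<epsilon> by (simp add: \<eta>_def)
  note dh = distr_homeo[OF \<nu>'(1,2) h(1)]
  have "W_inf (distr \<nu> borel h) \<mu> \<le> \<epsilon>/2"
  proof (rule c(2)[OF dh(1)])
    fix U :: "'a set" assume U: "U \<in> sets borel"
    show "measure (distr \<nu> borel h) U \<le> measure \<mu> {x. infdist x U < \<epsilon>/2/2} + c"
    proof (cases "U = {}")
      case True
      then show ?thesis using c(1) by (simp add: add_nonneg_nonneg)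
    next
      case False
      \<comment> \<open>If \<open>h\<close> sends a point of a cell into \<open>U\<close>, the
        target centre of that cell is within \<open>\<eta>\<close> of \<open>U\<close>. So the
        preimage of \<open>U\<close> is covered by the neglected set and the cells assigned to
        \<open>J\<close>, whose mass is at most that of the pieces in \<open>J\<close> plus the
        overload.\<close>
      define J where "J = {j\<in>{..<n}. infdist (z j) U < \<eta>}"
      define S where "S = {B\<in>\<B>. f B \<in> J}"
      have finS: "finite S" using \<B>(1) by (simp add: S_def)
      have "h -` U \<subseteq> - \<Union>\<B> \<union> (\<Union>B\<in>S. B)"
      proof
        fix x assume x: "x \<in> h -` U"
        show "x \<in> - \<Union>\<B> \<union> (\<Union>B\<in>S. B)"
        proof (cases "x \<in> \<Union>\<B>")
          case True
          then obtain B where B: "B \<in> \<B>" "x \<in> B" by blast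
          have "dist (z (f B)) (h x) < \<eta>" using h(2)[OF B(1)] B(2) by auto
          then have "infdist (z (f B)) U < \<eta>" using x by (intro infdist_less[of "h x"]) auto
          then have "B \<in> S" using B(1) f(1)[OF B(1)] by (simp add: S_def J_def N_def)
          then show ?thesis using B(2) by blast
        qed simp
      qed
      moreover have m1: "- \<Union>\<B> \<in> sets \<nu>" "(\<Union>B\<in>S. B) \<in> sets \<nu>"
      proof -
        have "\<Union>\<B> \<in> sets borel" using \<B>(1) Bborel by (intro sets.finite_Union) auto
        then show "- \<Union>\<B> \<in> sets \<nu>" using \<nu>'(1) by (simp add: borel_comp)
        show "(\<Union>B\<in>S. B) \<in> sets \<nu>"
          unfolding \<nu>'(1) using finS Bborel by (intro sets.finite_UN) (auto simp: S_def)
      qed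
      ultimately have "measure \<nu> (h -` U) \<le> measure \<nu> (- \<Union>\<B> \<union> (\<Union>B\<in>S. B))"
        by (intro finite_measure.finite_measure_mono[OF \<nu>'(3)] sets.Un)
      also have "\<dots> \<le> measure \<nu> (- \<Union>\<B>) + measure \<nu> (\<Union>B\<in>S. B)" by (rule measure_Un_le[OF m1])
      also have "measure \<nu> (\<Union>B\<in>S. B) \<le> sum (measure \<nu>) S"
        using finS Bborel \<nu>'(1)
        by (intro finite_measure.finite_measure_subadditive_finite[OF \<nu>'(3)]) (auto simp: S_def)
      also have "sum (measure \<nu>) S = (\<Sum>j\<in>J. sum (measure \<nu>) {B\<in>S. f B = j})"
        using finS by (intro sum.group[symmetric]) (auto simp: S_def J_def)
      also have "\<dots> = (\<Sum>j\<in>J. sum (measure \<nu>) {B\<in>\<B>. f B = j})"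
        by (intro sum.cong refl arg_cong2[where f = sum]) (auto simp: S_def)
      also have "\<dots> \<le> (\<Sum>j\<in>J. measure \<mu> (P j) + n * \<tau>)"
        using f(2) by (intro sum_mono) (auto simp: J_def)
      also have "\<dots> = (\<Sum>j\<in>J. measure \<mu> (P j)) + card J * (n * \<tau>)" by (simp add: sum.distrib)
      also have "\<dots> \<le> (\<Sum>j\<in>J. measure \<mu> (P j)) + c / 2"
      proof -
        have "card J \<le> n" using card_mono[of "{..<n}" J] by (auto simp: J_def)
        then have "card J * (n * \<tau>) \<le> n * (n * \<tau>)" using \<tau> by (intro mult_right_mono) auto
        then show ?thesis using n\<tau> by (simp add: mult.assoc)
      qed
      also have "(\<Sum>j\<in>J. measure \<mu> (P j)) = measure \<mu> (\<Union>j\<in>J. P j)"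
        using P(1) \<mu>'(1) disjoint_family_on_mono[OF subset_UNIV P(3)]
        by (intro finite_measure.finite_measure_finite_Union[OF \<mu>'(3), symmetric]) (auto simp: J_def)
      also have "\<dots> \<le> measure \<mu> {x. infdist x U < \<epsilon>/2/2}"
      proof (rule finite_measure.finite_measure_mono[OF \<mu>'(3)])
        show "{x. infdist x U < \<epsilon>/2/2} \<in> sets \<mu>"
          unfolding \<mu>'(1) by (intro borel_open open_infdist_less)
        show "(\<Union>j\<in>J. P j) \<subseteq> {x. infdist x U < \<epsilon>/2/2}"
        proof clarify
          fix j x assume j: "j \<in> J" "x \<in> P j"
          then have "dist x (z j) < \<eta>" using P(2)[of j] by (auto simp: dist_commute)
          then show "infdist x U < \<epsilon>/2/2"
            using infdist_triangle[of x U "z j"] j(1) \<epsilon> by (simp add: J_def \<eta>_def)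
        qed
      qed
      finally have "measure \<nu> (h -` U) \<le> measure \<mu> {x. infdist x U < \<epsilon>/2/2} + c" using \<B>(4) by simp
      then show ?thesis by (simp add: dh(3)[OF U])
    qed
  qed
  then have "h \<in> H0 \<nu> \<mu> \<epsilon>" using h(1) \<epsilon> by (simp add: H0_def)
  then show ?thesis using disp by blast
qed

text \<open>Guarantees that the outer supremum is not empty and that some quotient has a positive
  denominator; the bound from below is read off from this pair.\<close>

lemma W_inf_pos_pair:
  obtains \<mu> \<nu> :: "'a measure" where "\<mu> \<in> good_measures" "\<nu> \<in> good_measures" "\<nu> \<noteq> \<mu>" "0 < W_inf \<mu> \<nu>"
proof -
  obtain x y :: 'a where xy: "x \<noteq> y"
  proof -
    have "(UNIV :: 'a set) - {undefined} \<noteq> {}"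
      using thin_singleton[OF dim, of undefined] connected_space unfolding thin_def by blast
    then show ?thesis using that by blast
  qed
  \<comment> \<open>A third of the distance: the neighbourhood of radius \<open>r < s\<close> of
    \<open>ball x s\<close> still misses \<open>ball y s\<close>.\<close>
  define s where "s = dist x y / 3"
  have s: "0 < s" using xy by (simp add: s_def)
  obtain \<mu> where \<mu>: "\<mu> \<in> good_measures" "3/4 \<le> measure \<mu> (ball x s)"
    using good_measure_concentrated[OF compact_space, of "ball x s"] s by auto
  obtain \<nu> where \<nu>: "\<nu> \<in> good_measures" "3/4 \<le> measure \<nu> (ball y s)"
    using good_measure_concentrated[OF compact_space, of "ball y s"] s by auto
  note \<mu>' = good_measuresD[OF \<mu>(1)] and \<nu>' = good_measuresD[OF \<nu>(1)]
  have less: "measure \<nu> V < 3/4" if V: "V \<in> sets borel" "V \<inter> ball y s = {}" for V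
  proof -
    have "measure \<nu> V + measure \<nu> (ball y s) = measure \<nu> (V \<union> ball y s)"
      using V \<nu>'(1) by (intro finite_measure.finite_measure_Union[OF \<nu>'(3), symmetric]) auto
    also have "\<dots> \<le> 1" by (rule prob_space.prob_le_1[OF \<nu>'(2)])
    finally show ?thesis using \<nu>(2) by simp
  qed
  have W: "s \<le> W_inf \<mu> \<nu>"
  proof (rule ccontr)
    assume "\<not> s \<le> W_inf \<mu> \<nu>"
    then have "W_inf \<mu> \<nu> < s" by simp
    then obtain r where r: "r < s"
      "\<And>U. U \<in> sets borel \<Longrightarrow> measure \<mu> U \<le> measure \<nu> {x. infdist x U < r}"
      using W_inf_lessE[OF compact_space \<mu>'(1,2) \<nu>'(1,2)] by metis
    have "{p. infdist p (ball x s) < r} \<inter> ball y s = {}"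
    proof (rule ccontr)
      assume "{p. infdist p (ball x s) < r} \<inter> ball y s \<noteq> {}"
      then obtain p where p: "infdist p (ball x s) < r" "dist y p < s" by auto
      have "ball x s \<noteq> {}" using s by simp
      from infdist_lessE[OF p(1) this] obtain u where u: "u \<in> ball x s" "dist p u < r" .
      then have "dist x y < 3 * s"
        using p(2) r(1) dist_triangle[of x y u] dist_triangle[of u y p] by (simp add: dist_commute)
      then show False by (simp add: s_def)
    qed
    then have "measure \<nu> {p. infdist p (ball x s) < r} < 3/4"
      by (intro less borel_open open_infdist_less)
    then show False using r(2)[of "ball x s"] \<mu>(2) by simp
  qed
  have "\<nu> \<noteq> \<mu>"
  proof
    assume eq: "\<nu> = \<mu>"
    have "ball x s \<inter> ball y s = {}"
    proof (rule ccontr)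
      assume "ball x s \<inter> ball y s \<noteq> {}"
      then obtain p where "dist x p < s" "dist y p < s" by auto
      then show False using dist_triangle2[of x y p] zero_le_dist[of x y] unfolding s_def by linarith
    qed
    then show False using less[of "ball x s"] \<mu>(2) eq by simp
  qed
  then show ?thesis using \<mu>(1) \<nu>(1) W s by (intro that[of \<mu> \<nu>]) auto
qed

lemma transport_constant_eq_1: "transport_constant TYPE('a) = 1"
proof (rule antisym)
  show "transport_constant TYPE('a) \<le> 1"
    unfolding transport_constant_def
  proof (rule SUP_least, clarify, rule SUP_least)
    fix \<nu> \<mu> :: "'a measure" and \<epsilon> :: real
    assume good: "\<nu> \<in> good_measures" "\<mu> \<in> good_measures" and "\<epsilon> \<in> {0<..}"
    then have \<epsilon>: "0 < \<epsilon>" by simp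
    have W0: "0 \<le> W_inf \<mu> \<nu>"
      using good by (intro W_inf_nonneg[OF compact_space] good_measuresD)
    show "(INF h\<in>H0 \<nu> \<mu> \<epsilon>. ereal (displacement h / W_inf \<mu> \<nu>)) \<le> 1"
    proof (rule ereal_le_epsilon2)
      fix e :: real assume e: "0 < e"
      \<comment> \<open>Shrinking the tolerance below \<open>e * W_inf \<mu> \<nu>\<close> turns the
        additive error into a relative one, and \<open>H0\<close> only gets smaller. If the distance
        is 0, the quotient is 0 by the convention for division.\<close>
      define e' where "e' = (if W_inf \<mu> \<nu> = 0 then \<epsilon> else min \<epsilon> (e * W_inf \<mu> \<nu>))"
      have e': "0 < e'" "e' \<le> \<epsilon>" using \<epsilon> e W0 by (auto simp: e'_def)
      obtain h where h: "h \<in> H0 \<nu> \<mu> e'" "displacement h < W_inf \<mu> \<nu> + e'"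
        using approximate_transport[OF good(2,1) e'(1)] by blast
      have "h \<in> H0 \<nu> \<mu> \<epsilon>" using h(1) e'(2) by (auto simp: H0_def)
      then have lower: "(INF h\<in>H0 \<nu> \<mu> \<epsilon>. ereal (displacement h / W_inf \<mu> \<nu>)) \<le> ereal (displacement h / W_inf \<mu> \<nu>)"
        by (rule INF_lower)
      have "displacement h / W_inf \<mu> \<nu> \<le> 1 + e"
      proof (cases "W_inf \<mu> \<nu> = 0")
        case True then show ?thesis using e by simp
      next
        case False
        then have "displacement h \<le> (1 + e) * W_inf \<mu> \<nu>"
          using h(2) by (simp add: e'_def algebra_simps)
        then show ?thesis using W0 False by (simp add: pos_divide_le_eq)
      qed
      then have "ereal (displacement h / W_inf \<mu> \<nu>) \<le> 1 + ereal e"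
        by (simp add: one_ereal_def)
      with lower show "(INF h\<in>H0 \<nu> \<mu> \<epsilon>. ereal (displacement h / W_inf \<mu> \<nu>)) \<le> 1 + ereal e"
        by (rule order_trans)
    qed
  qed
  obtain \<mu> \<nu> :: "'a measure" where good: "\<mu> \<in> good_measures" "\<nu> \<in> good_measures" "\<nu> \<noteq> \<mu>" "0 < W_inf \<mu> \<nu>"
    using W_inf_pos_pair by metis
  let ?S = "SUP \<epsilon>\<in>{0<..}. INF h\<in>H0 \<nu> \<mu> \<epsilon>. ereal (displacement h / W_inf \<mu> \<nu>)"
  have "1 \<le> ?S"
  proof (rule ereal_le_epsilon2)
    fix e :: real assume e: "0 < e"
    \<comment> \<open>The tolerance \<open>e * W_inf \<mu> \<nu>\<close> makes the loss in
      \<open>W_inf_le_displacement\<close> exactly a fraction \<open>e\<close>.\<close>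
    have "ereal (1 - e) \<le> (INF h\<in>H0 \<nu> \<mu> (e * W_inf \<mu> \<nu>). ereal (displacement h / W_inf \<mu> \<nu>))"
    proof (rule INF_greatest)
      fix h assume "h \<in> H0 \<nu> \<mu> (e * W_inf \<mu> \<nu>)"
      then have "(1 - e) * W_inf \<mu> \<nu> \<le> displacement h"
        using W_inf_le_displacement[OF compact_space good(1,2)] by (fastforce simp: algebra_simps)
      then show "ereal (1 - e) \<le> ereal (displacement h / W_inf \<mu> \<nu>)"
        using good(4) by (simp add: pos_le_divide_eq)
    qed
    also have "\<dots> \<le> ?S" using e good(4) by (intro SUP_upper) simp
    finally have "ereal (1 - e) + ereal e \<le> ?S + ereal e" by (rule add_right_mono)
    then show "1 \<le> ?S + ereal e" by (simp add: one_ereal_def)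
  qed
  also have "?S \<le> transport_constant TYPE('a)"
    unfolding transport_constant_def using good(1-3) by (intro SUP_upper2[of "(\<nu>, \<mu>)"]) auto
  finally show "1 \<le> transport_constant TYPE('a)" .
qed

end

theorem theorem2p8:
  fixes A :: "('a::metric_space, 'e::euclidean_space) chart set"
    and g :: "('a, 'e) metric_tensor"
  assumes "compact_connected_riemannian_manifold A g"
    and "DIM('e) \<ge> 3"
  shows "transport_constant TYPE('a) = 1 \<and>
    (\<forall>\<mu>\<in>good_measures. \<forall>\<nu>\<in>(good_measures :: 'a measure set). \<forall>\<epsilon>>0.
       \<exists>h. (\<exists>k. homeomorphism UNIV UNIV h k) \<and>
           homotopic_with_canon (\<lambda>_. True) UNIV UNIV h id \<and>
           W_inf (distr \<nu> borel h) \<mu> < \<epsilon> \<and>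
           displacement h < W_inf \<mu> \<nu> + \<epsilon>)"
proof -
  interpret intrinsic_riemannian A g
    by unfold_locales (use assms(1) in \<open>auto simp: compact_connected_riemannian_manifold_def\<close>)
  interpret length_manifold A
  proof
    show "compact (UNIV :: 'a set)"
      using assms(1) by (simp add: compact_connected_riemannian_manifold_def)
  qed (use chart chart_covers connected_space short_connected_set assms(2) in blast)+
  show ?thesis
    using transport_constant_eq_1 approximate_transport
    unfolding H0_def homeos_homotopic_id_def by blast
qed

end
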